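(* Let $M=M^\star+H\in\mathbb{R}^{n\times n}$, where $M^\star$ is symmetric of rank $r$ and $H$ is an (asymmetric) noise matrix with independent entries satisfying the noise conditions with parameters $\sigma_{\min},\sigma,L$, and $\sigma\le L\le C_0\sigma\sqrt{n/(\bar\mu\log n)}$ for a universal constant $C_0>0$. Suppose $\kappa=O(1)$ and $r=O(1)$, and that, for a sufficiently large constant $C>0$, $$\lambda^\star_{\min}\ge C\max\{\sigma\sqrt{n\log^3n},\ L\log^3n\},\qquad \delta^\star_{\min}\ge C\kappa^3r^2\max\Bigl\{\frac{\bar\mu L\log^5n}{n},\ \sigma\log^{7/2}n\Bigr\}.$$ Let $a\in\mathbb{R}^n$ be a fixed vector with $\|a\|_2=1$ and define $$\hat u_{a,l}=\min\left\{\sqrt{\left|\frac{(a^\top u_l)(a^\top w_l)}{w_l^\top u_l}\right|},\ \|a\|_2\right\}.$$ Then for any $l\in[r]$, with probability at least $1-O(n^{-17})$, $$\min|\hat u_{a,l}\pm a^\top u_l^\star|\lesssim\Bigl\{\frac1{\lambda^\star_{\min}}+\max_{k:k\ne l}\frac{|a^\top u_k^\star|}{|\lambda_l^\star-\lambda_k^\star|}\Bigr\}\sqrt{\sigma^2\log^7n}+|a^\top u_l^\star|\,\frac{\sigma^2\log^7n}{(\delta_l^\star)^2}.$$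
   Context: Asymptotic conventions: $n\to\infty$ and all other parameters may depend on $n$; $f\lesssim g$ (or $f=O(g)$) means $f\le C'g$ for all large $n$ with $C'$ not depending on the parameters. $\min|x\pm y|$ denotes the minimum over the two signs. Noise conditions on $H$: all entries $H_{ij}$, $1\le i,j\le n$, are independent, and $0<\sigma_{\min}^2\le\mathbb{E}H_{ij}^2\le\sigma^2$ with $\sigma^2/\sigma_{\min}^2$ bounded above and below by constants; $|H_{ij}|\le L$ a.s.; $H_{ij}$ and $-H_{ij}$ have the same distribution. Low-rank structure: $M^\star=U^\star\Lambda^\star U^{\star\top}$, $U^\star=(u_1^\star,\dots,u_r^\star)$ with orthonormal columns, $\Lambda^\star=\mathrm{diag}(\lambda_1^\star,\dots,\lambda_r^\star)$, $|\lambda_1^\star|\ge\dots\ge|\lambda_r^\star|>0$; $\lambda^\star_{\min}=|\lambda_r^\star|$, $\kappa=|\lambda_1^\star|/|\lambda_r^\star|$; $\bar\mu=\frac nr\max_i\|U^\star_{i,\cdot}\|_2^2$. Eigengaps: $\delta_l^\star=\min_{1\le k\le r,\,k\ne l}|\lambda_l^\star-\lambda_k^\star|$ if $r>1$ and $\delta_l^\star=\infty$ if $r=1$; $\delta^\star_{\min}=\min_{l\in[r]}\delta_l^\star$. Eigenvectors of $M$: $Mu_l=\lambda_lu_l$ and $M^\top w_l=\lambda_lw_l$ with $\|u_l\|_2=\|w_l\|_2=1$, where $\lambda_1,\dots,\lambda_r$ are the $r$ leading (in magnitude) eigenvalues of $M$, indexed in correspondence with $\lambda_1^\star,\dots,\lambda_r^\star$.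 *)

theory Defs
  imports "HOL-Probability.Probability" "Jordan_Normal_Form.Char_Poly"
begin

no_notation inner (infix "\<bullet>" 70)
no_notation vec_nth (infixl "$" 90)

definition l2_norm :: "'a::real_normed_vector Matrix.vec \<Rightarrow> real" where
  "l2_norm v = L2_set (\<lambda>i. norm (v $ i)) {..<dim_vec v}"

definition noise_conditions ::
  "'w measure \<Rightarrow> nat \<Rightarrow> ('w \<Rightarrow> real mat) \<Rightarrow> real \<Rightarrow> real \<Rightarrow> real \<Rightarrow> bool" where
  "noise_conditions P n H \<sigma>_min \<sigma> L \<longleftrightarrow>
     0 < \<sigma>_min \<and> 0 < \<sigma> \<and>
     (\<forall>\<omega>\<in>space P. H \<omega> \<in> carrier_mat n n) \<and>
     prob_space.indep_vars P (\<lambda>_. borel) (\<lambda>(i, j) \<omega>. H \<omega> $$ (i, j)) ({..<n} \<times> {..<n}) \<and>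
     (\<forall>i<n. \<forall>j<n.
        \<sigma>_min\<^sup>2 \<le> prob_space.expectation P (\<lambda>\<omega>. (H \<omega> $$ (i, j))\<^sup>2) \<and>
        prob_space.expectation P (\<lambda>\<omega>. (H \<omega> $$ (i, j))\<^sup>2) \<le> \<sigma>\<^sup>2 \<and>
        (AE \<omega> in P. \<bar>H \<omega> $$ (i, j)\<bar> \<le> L) \<and>
        distr P borel (\<lambda>\<omega>. H \<omega> $$ (i, j)) = distr P borel (\<lambda>\<omega>. - H \<omega> $$ (i, j)))"

text \<open>The indices \<open>1, \<dots>, r\<close> of the eigenpairs become \<open>0, \<dots>, r - 1\<close>; in particular
  \<^term>\<open>lam 0\<close> and \<^term>\<open>lam (r - 1)\<close> are the eigenvalues of largest and of smallest modulus.\<close>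

definition low_rank_factors :: "nat \<Rightarrow> nat \<Rightarrow> real mat \<Rightarrow> (nat \<Rightarrow> real) \<Rightarrow> bool" where
  "low_rank_factors n r U lam \<longleftrightarrow>
     0 < r \<and> U \<in> carrier_mat n r \<and> transpose_mat U * U = 1\<^sub>m r \<and>
     (\<forall>i j. i \<le> j \<and> j < r \<longrightarrow> \<bar>lam j\<bar> \<le> \<bar>lam i\<bar>) \<and> 0 < \<bar>lam (r - 1)\<bar>"

definition low_rank_mat :: "nat \<Rightarrow> real mat \<Rightarrow> (nat \<Rightarrow> real) \<Rightarrow> real mat" where
  "low_rank_mat r U lam = U * mat_diag r lam * transpose_mat U"

definition lam_min :: "nat \<Rightarrow> (nat \<Rightarrow> real) \<Rightarrow> real" where
  "lam_min r lam = \<bar>lam (r - 1)\<bar>"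

definition cond_num :: "nat \<Rightarrow> (nat \<Rightarrow> real) \<Rightarrow> real" where
  "cond_num r lam = \<bar>lam 0\<bar> / \<bar>lam (r - 1)\<bar>"

definition incoherence :: "nat \<Rightarrow> nat \<Rightarrow> real mat \<Rightarrow> real" where
  "incoherence n r U = real n / real r * Max ((\<lambda>i. (l2_norm (row U i))\<^sup>2) ` {..<n})"

text \<open>An infimum over the empty set is \<open>\<infinity>\<close> in \<^typ>\<open>ereal\<close>, which is the intended
  value of both eigengaps for \<open>r = 1\<close>.\<close>

definition eigengap :: "nat \<Rightarrow> (nat \<Rightarrow> real) \<Rightarrow> nat \<Rightarrow> ereal" where
  "eigengap r lam l = (INF k\<in>{..<r} - {l}. ereal \<bar>lam l - lam k\<bar>)"

definition min_eigengap :: "nat \<Rightarrow> (nat \<Rightarrow> real) \<Rightarrow> ereal" where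
  "min_eigengap r lam = (INF l\<in>{..<r}. eigengap r lam l)"

text \<open>An asymmetric real matrix may have complex eigenvalues and eigenvectors, so they are taken
  over \<^typ>\<open>complex\<close>. The leading eigenvalues are counted with algebraic multiplicity.\<close>

definition leading_eigenvalues :: "complex mat \<Rightarrow> nat \<Rightarrow> (nat \<Rightarrow> complex) \<Rightarrow> bool" where
  "leading_eigenvalues A r z \<longleftrightarrow>
     (\<exists>zs. char_poly A = (\<Prod>k<r. [:- z k, 1:]) * (\<Prod>x\<leftarrow>zs. [:- x, 1:]) \<and>
           (\<forall>k<r. \<forall>x\<in>set zs. cmod x \<le> cmod (z k)))"

text \<open>The correspondence with the true eigenvalues is the optimal matching of the two \<open>r\<close>-tuples:
  no reordering of \<open>z\<close> has a smaller maximal deviation from \<open>lam\<close>. Sorting both tuples by modulus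
  would not do, since \<open>lam\<close> may contain values of equal modulus and opposite sign.\<close>

definition matched_eigenvalues :: "nat \<Rightarrow> (nat \<Rightarrow> real) \<Rightarrow> (nat \<Rightarrow> complex) \<Rightarrow> bool" where
  "matched_eigenvalues r lam z \<longleftrightarrow>
     (\<forall>\<pi>. bij_betw \<pi> {..<r} {..<r} \<longrightarrow>
        Max ((\<lambda>k. cmod (z k - complex_of_real (lam k))) ` {..<r})
          \<le> Max ((\<lambda>k. cmod (z (\<pi> k) - complex_of_real (lam k))) ` {..<r}))"

text \<open>The products \<open>a\<^sup>\<top> u\<close>, \<open>a\<^sup>\<top> w\<close> and \<open>w\<^sup>\<top> u\<close> are bilinear (no conjugation). The value does
  not change when \<open>u\<close> or \<open>w\<close> is multiplied by a complex number of modulus one. If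
  \<open>w\<^sup>\<top> u = 0\<close>, where the quotient is meaningless, division by zero yields the value 0.\<close>

definition u_hat :: "real Matrix.vec \<Rightarrow> complex Matrix.vec \<Rightarrow> complex Matrix.vec \<Rightarrow> real" where
  "u_hat a u w =
     (let a' = map_vec complex_of_real a
      in min (sqrt (cmod ((a' \<bullet> u) * (a' \<bullet> w) / (w \<bullet> u)))) (l2_norm a))"

definition min_pm :: "real \<Rightarrow> real \<Rightarrow> real" where
  "min_pm x y = min \<bar>x + y\<bar> \<bar>x - y\<bar>"

text \<open>The inserted \<open>0\<close> is the value of the maximum over the empty set, for \<open>r = 1\<close>; in that case
  the last summand also vanishes, being divided by \<open>\<infinity>\<close>.\<close>

definition error_bound ::
  "nat \<Rightarrow> nat \<Rightarrow> real mat \<Rightarrow> (nat \<Rightarrow> real) \<Rightarrow> real \<Rightarrow> real Matrix.vec \<Rightarrow> nat \<Rightarrow> ereal" where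
  "error_bound n r U lam \<sigma> a l =
     ereal ((1 / lam_min r lam +
             Max (insert 0 ((\<lambda>k. \<bar>a \<bullet> col U k\<bar> / \<bar>lam l - lam k\<bar>) ` ({..<r} - {l}))))
            * sqrt (\<sigma>\<^sup>2 * ln (real n) ^ 7))
     + ereal (\<bar>a \<bullet> col U l\<bar> * (\<sigma>\<^sup>2 * ln (real n) ^ 7)) / (eigengap r lam l)\<^sup>2"

end

theory Submission
  imports "HOL-Complex_Analysis.Riemann_Mapping" "HOL-Real_Asymp.Real_Asymp" Defs
begin

no_notation vec_nth (infixl "$" 90)
no_notation inner (infix "\<bullet>" 70)

text \<open>Write \<open>H\<close> for the noise. If \<open>M u = \<lambda> u\<close> with \<open>\<bar>\<lambda>\<bar>\<close> large, then
  \<open>u = \<Sum>\<^sub>s \<lambda>\<^sup>-\<^sup>s\<^sup>-\<^sup>1 H\<^sup>s U \<Lambda> U\<^sup>\<top> u\<close>, so everything follows from bounds of the form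
  \<open>\<bar>b\<^sup>\<top> H\<^sup>s u\<^sub>k\<bar> \<le> \<epsilon> \<tau>\<^sup>s\<^sup>-\<^sup>1\<close> for fixed unit vectors \<open>b\<close>, where \<open>\<epsilon>\<close> is of order
  \<open>\<sigma> ln\<^bsup>7/2\<^esup> n\<close>, and \<open>\<tau> = max (\<sigma> \<surd>(n ln\<^sup>3 n)) (L ln\<^sup>3 n)\<close>.

  These bounds come from a moment of order about \<open>ln n\<close>. It is a sum over tuples of walks in which,
  by symmetry of the entries, every edge occurs an even number of times. Reading the walks step by
  step, a step either uses a new edge or repeats one of the few edges already used. Fixing all end
  points of the walks in advance, the new edges that lead into an end point are not free, and this
  is what gains the factor \<open>1 / \<surd>n\<close> over the operator norm; the incoherence of \<open>u\<^sub>k\<close> compensates for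
  coinciding end points. Crude counting suffices: \<open>ln\<^sup>2 n\<close> repeated edges cost \<open>ln n\<close> per step.

  Given the bounds, \<open>u\<close> and \<open>w\<close> have coordinates of relative size \<open>O(\<epsilon> / \<bar>\<lambda>\<^sub>l - \<lambda>\<^sub>k\<bar>)\<close> along \<open>u\<^sub>k\<close>,
  \<open>k \<noteq> l\<close>, and expanding \<open>a\<^sup>\<top> u\<close>, \<open>a\<^sup>\<top> w\<close> and \<open>w\<^sup>\<top> u\<close> gives the error of the estimator. That each
  true eigenvalue has exactly one eigenvalue of \<open>M\<close> nearby follows by deforming \<open>H\<close> to \<open>0\<close> and
  comparing winding numbers of the characteristic polynomials.\<close>

text \<open>The eigengaps may be far smaller than the operator norm of the noise, which is typically
  of order \<sigma> \<surd>n, so norm-based perturbation bounds are of no help. The asymmetry of the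
  noise is what rescues the argument: (i, j) and (j, i) carry independent variables, so a walk
  cannot pair an edge with its reversal, and the mean of H^2 is of order \<sigma>^2 only, whereas
  for a symmetric H it would be of order \<sigma>^2 n. The price is that eigenvalues and
  eigenvectors may be complex and that left and right eigenvectors differ; hence all products are
  bilinear, left eigenvectors are right eigenvectors of the transpose, and eigenvalues are counted
  in discs. A union bound covers only finitely many powers s. Powers below 2 S, with S about ln n,
  are treated by moments; longer powers are obtained by multiplying shorter ones. The exponent 17 is
  20 - 3: each bad event has probability at most n^-20, and their number is at most a constant times
  n^3.\<close>

section \<open>Moments of bilinear forms in powers of the noise\<close>

text \<open>The sum of \<open>\<phi>\<close> over all ways to complete a tuple of walks of length \<open>s\<close>: the current walk is at
  \<open>v\<close>, has \<open>t\<close> steps left and must end at \<open>j\<close>; \<open>rest\<close> lists the end points of the remaining walks, and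
  \<open>m\<close> is the multiset of edges used so far.\<close>

function walk_sum :: "nat \<Rightarrow> nat \<Rightarrow> ((nat \<times> nat) multiset \<Rightarrow> real) \<Rightarrow> (nat \<times> nat) list \<Rightarrow> nat \<Rightarrow> nat \<Rightarrow> nat
    \<Rightarrow> (nat \<times> nat) multiset \<Rightarrow> real" where
  "walk_sum n s \<phi> rest (Suc t) v j m =
     (\<Sum>x<n. walk_sum n s \<phi> rest t x j (add_mset (v, x) m))"
| "walk_sum n s \<phi> [] 0 v j m = (if v = j then \<phi> m else 0)"
| "walk_sum n s \<phi> (ij # rest) 0 v j m =
     (if v = j then walk_sum n s \<phi> rest s (fst ij) (snd ij) m else 0)"
  by pat_completeness auto
termination
  by (relation "measures [\<lambda>(n, s, \<phi>, rest, t, v, j, m). length rest, \<lambda>(n, s, \<phi>, rest, t, v, j, m). t]") auto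

text \<open>Index functions instead of matrices carry no dimension side conditions, and real,
  complex and random arrays share one notion. The power is unfolded from the left, so that it is
  read like a walk.\<close>

fun mpow :: "nat \<Rightarrow> (nat \<Rightarrow> nat \<Rightarrow> 'a) \<Rightarrow> nat \<Rightarrow> nat \<Rightarrow> nat \<Rightarrow> 'a::comm_ring_1" where
  "mpow n A 0 i j = of_bool (i = j)"
| "mpow n A (Suc s) i j = (\<Sum>x<n. A i x * mpow n A s x j)"

text \<open>Double induction, on the pending walks and on the steps left, which keeps
  \<open>n\<close>, \<open>s\<close> and \<open>\<phi>\<close> fixed and provides the step
  hypothesis for all next vertices at once.\<close>

lemma walk_induct [case_names Step Nil Cons]:
  assumes "\<And>rest t v j m. (\<And>x. Q rest t x j (add_mset (v, x) m)) \<Longrightarrow> Q rest (Suc t) v j m"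
    and "\<And>v j m. Q [] 0 v j m"
    and "\<And>ij rest v j m. Q rest s (fst ij) (snd ij) m \<Longrightarrow> Q (ij # rest) 0 v j m"
  shows "Q rest t v j m"
proof (induction rest arbitrary: t v j m)
  case (Nil t v j m)
  show ?case
  proof (induction t arbitrary: v j m)
    case 0
    show ?case by (rule assms(2))
  next
    case (Suc t)
    show ?case by (rule assms(1), rule Suc.IH)
  qed
next
  case (Cons ij rest t v j m)
  show ?case
  proof (induction t arbitrary: v j m)
    case 0
    show ?case by (rule assms(3), rule Cons.IH)
  next
    case (Suc t)
    show ?case by (rule assms(1), rule Suc.IH)
  qed
qed

text \<open>Multiplying out matrix powers turns each choice of intermediate indices into a walk; the
  first factor is the monomial collected so far. With \<open>m\<close> empty, a product of entries
  of powers becomes a sum of monomials over tuples of walks.\<close>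

lemma walk_sum_expand:
  "(\<Prod>e\<in>#m. case_prod A e) * mpow n A t v j * (\<Prod>ij\<leftarrow>rest. mpow n A s (fst ij) (snd ij))
   = walk_sum n s (\<lambda>m. \<Prod>e\<in>#m. case_prod A e) rest t v j m"
proof (induction rest t v j m rule: walk_induct[where s = s])
  case (Step rest t v j m)
  let ?R = "\<Prod>ij\<leftarrow>rest. mpow n A s (fst ij) (snd ij)"
  have "(\<Prod>e\<in>#m. case_prod A e) * mpow n A (Suc t) v j * ?R
    = (\<Sum>x<n. (\<Prod>e\<in>#add_mset (v, x) m. case_prod A e) * mpow n A t x j * ?R)"
    by (simp add: sum_distrib_left sum_distrib_right mult_ac)
  then show ?case by (simp only: Step walk_sum.simps)
next
  case (Cons ij rest v j m)
  then show ?case by (cases "v = j") (simp_all add: mult.assoc)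
qed simp

lemma integrable_walk_sum:
  assumes "\<And>m. integrable P (f m)"
  shows "integrable P (\<lambda>\<omega>. walk_sum n s (\<lambda>m. f m \<omega>) rest t v j m)"
proof (induction rest t v j m rule: walk_induct[where s = s])
  case (Nil v j m)
  show ?case by (cases "v = j") (simp_all add: assms)
next
  case (Cons ij rest v j m)
  then show ?case by (cases "v = j") simp_all
qed simp

text \<open>\<open>walk_sum\<close> is a finite sum of values of \<open>\<phi>\<close>, so the
  expectation acts on \<open>\<phi>\<close> alone, and only mixed moments of the entries remain to
  be estimated.\<close>

lemma expectation_walk_sum:
  assumes "\<And>m. integrable P (f m)"
  shows "(\<integral>\<omega>. walk_sum n s (\<lambda>m. f m \<omega>) rest t v j m \<partial>P)
    = walk_sum n s (\<lambda>m. \<integral>\<omega>. f m \<omega> \<partial>P) rest t v j m"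
  by (induction rest t v j m rule: walk_induct[where s = s])
     (simp_all add: assms integrable_walk_sum)

text \<open>The three factors belong to new free edges, new edges into the set \<open>F\<close> of end points, and
  repeated edges. Each is the reciprocal of the number of choices for such a step, so that one step
  of a walk multiplies the total weight by at most 3.\<close>

definition edge_weight :: "nat \<Rightarrow> nat set \<Rightarrow> real \<Rightarrow> real \<Rightarrow> (nat \<times> nat) multiset \<Rightarrow> real" where
  "edge_weight n F p N m = (1 / real n) ^ card {e \<in> set_mset m. snd e \<notin> F}
     * (1 / p) ^ card {e \<in> set_mset m. snd e \<in> F} * (1 / N) ^ (size m - card (set_mset m))"

lemma card_set_mset_le_size: "card (set_mset m) \<le> size m"
  by (induction m) (auto simp: card_insert_if)

lemma edge_weight_nonneg: "0 \<le> p \<Longrightarrow> 0 \<le> N \<Longrightarrow> 0 \<le> edge_weight n F p N m"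
  by (simp add: edge_weight_def)

text \<open>The edge is either repeated, or new and into \<open>F\<close>, or new and outside
  \<open>F\<close>; the matching summand is the exact factor and the other two are nonnegative. The
  additive form can be summed over the next vertex.\<close>

lemma edge_weight_add:
  assumes "0 \<le> p" "0 \<le> N"
  shows "edge_weight n F p N (add_mset e m) \<le>
    edge_weight n F p N m * (of_bool (e \<in># m) / N + 1 / real n + of_bool (snd e \<in> F) / p)"
proof -
  let ?w = "edge_weight n F p N m"
  have w: "0 \<le> ?w" by (rule edge_weight_nonneg[OF assms])
  consider "e \<in># m" | "e \<notin># m" "snd e \<in> F" | "e \<notin># m" "snd e \<notin> F" by blast
  then show ?thesis
  proof cases
    case 1
    have i: "insert e (set_mset m) = set_mset m" using 1 by auto
    have "Suc (size m) - card (set_mset m) = Suc (size m - card (set_mset m))"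
      using card_set_mset_le_size[of m] by simp
    hence "edge_weight n F p N (add_mset e m) = ?w * (1 / N)"
      by (simp add: edge_weight_def i)
    also have "\<dots> \<le> ?w * (of_bool (e \<in># m) / N + 1 / real n + of_bool (snd e \<in> F) / p)"
      using 1 assms by (intro mult_left_mono w) auto
    finally show ?thesis .
  next
    case 2
    have a: "{x \<in> set_mset (add_mset e m). snd x \<notin> F} = {e \<in> set_mset m. snd e \<notin> F}"
      and b: "{x \<in> set_mset (add_mset e m). snd x \<in> F} = insert e {e \<in> set_mset m. snd e \<in> F}"
      using 2 by auto
    have "edge_weight n F p N (add_mset e m) = ?w * (1 / p)"
      using 2 unfolding edge_weight_def a b by (simp add: card_insert_if)
    also have "\<dots> \<le> ?w * (of_bool (e \<in># m) / N + 1 / real n + of_bool (snd e \<in> F) / p)"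
      using 2 assms by (intro mult_left_mono w) auto
    finally show ?thesis .
  next
    case 3
    have a: "{x \<in> set_mset (add_mset e m). snd x \<in> F} = {e \<in> set_mset m. snd e \<in> F}"
      and b: "{x \<in> set_mset (add_mset e m). snd x \<notin> F} = insert e {e \<in> set_mset m. snd e \<notin> F}"
      using 3 by auto
    have "edge_weight n F p N (add_mset e m) = ?w * (1 / real n)"
      using 3 unfolding edge_weight_def a b by (simp add: card_insert_if)
    also have "\<dots> \<le> ?w * (of_bool (e \<in># m) / N + 1 / real n + of_bool (snd e \<in> F) / p)"
      using 3 assms by (intro mult_left_mono w) auto
    finally show ?thesis .
  qed
qed

lemma sum_edge_weight:
  assumes "0 < p" "0 < N" "real (size m) \<le> N" "finite F" "real (card F) \<le> p"
  shows "(\<Sum>x<n. edge_weight n F p N (add_mset (v, x) m)) \<le> 3 * edge_weight n F p N m"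
proof -
  let ?w = "edge_weight n F p N m"
  have w: "0 \<le> ?w" by (rule edge_weight_nonneg) (use assms in auto)
  have inj: "inj_on (Pair v) A" for A :: "nat set" by (rule inj_onI) auto
  have "card ({..<n} \<inter> {x. (v, x) \<in># m}) = card (Pair v ` ({..<n} \<inter> {x. (v, x) \<in># m}))"
    by (rule card_image[symmetric, OF inj])
  also have "\<dots> \<le> card (set_mset m)" by (rule card_mono) auto
  finally have "card ({..<n} \<inter> {x. (v, x) \<in># m}) \<le> size m" using card_set_mset_le_size[of m] by simp
  hence c1: "(\<Sum>x<n. of_bool ((v, x) \<in># m) :: real) \<le> N"
    using assms(3) by simp
  have "card ({..<n} \<inter> F) \<le> card F" using assms by (intro card_mono) auto
  hence c2: "(\<Sum>x<n. of_bool (x \<in> F) :: real) \<le> p"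
    using assms(5) by simp
  have "(\<Sum>x<n. edge_weight n F p N (add_mset (v, x) m)) \<le>
     (\<Sum>x<n. ?w * (of_bool ((v, x) \<in># m) / N + 1 / real n + of_bool (x \<in> F) / p))"
  proof (rule sum_mono)
    fix x
    show "edge_weight n F p N (add_mset (v, x) m) \<le>
      ?w * (of_bool ((v, x) \<in># m) / N + 1 / real n + of_bool (x \<in> F) / p)"
      using edge_weight_add[of p N n F "(v, x)" m] assms by simp
  qed
  also have "\<dots> = ?w * ((\<Sum>x<n. of_bool ((v, x) \<in># m)) / N + real n / real n + (\<Sum>x<n. of_bool (x \<in> F)) / p)"
    unfolding sum_distrib_left[symmetric] by (simp only: sum.distrib sum_divide_distrib) simp
  also have "\<dots> \<le> ?w * (1 + 1 + 1)"
    using c1 c2 assms by (intro mult_left_mono w add_mono) simp_all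
  finally show ?thesis by simp
qed

text \<open>Each step multiplies the total weight by at most 3, so only complete tuples need an
  estimate. For these the invariant yields that the heads of the edges contain the multiset
  \<open>J\<close> of end points. It distinguishes \<open>t = 0\<close> because the end point
  \<open>j\<close> is then already recorded as the head of the last edge and must not be counted
  twice; this is also why walks must have positive length.\<close>

lemma walk_sum_bound:
  assumes base: "\<And>m. size m = T \<Longrightarrow> J \<subseteq># image_mset snd m \<Longrightarrow> \<bar>\<phi> m\<bar> \<le> K * edge_weight n (set_mset J) p N m"
    and pN: "0 < p" "0 < N" "real T \<le> N" "real (size J) \<le> p" and K: "0 \<le> K" and s: "0 < s"
  shows "size m + t + s * length rest = T \<Longrightarrow>
    (if t = 0 then v = j \<longrightarrow> J \<subseteq># image_mset snd m + mset (map snd rest)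
     else J \<subseteq># image_mset snd m + {#j#} + mset (map snd rest)) \<Longrightarrow>
    \<bar>walk_sum n s \<phi> rest t v j m\<bar> \<le> K * edge_weight n (set_mset J) p N m * 3 ^ (t + s * length rest)"
proof (induction rest t v j m rule: walk_induct[where s = s])
  case (Step rest t v j m)
  show ?case
  proof -
    let ?e = "edge_weight n (set_mset J) p N"
    have J: "J \<subseteq># image_mset snd m + {#j#} + mset (map snd rest)" using Step(3) by simp
    hence J': "J \<subseteq># image_mset snd (add_mset (v, x) m) + {#j#} + mset (map snd rest)" for x
      by (rule subset_mset.order_trans) (simp add: subseteq_mset_def)
    have "\<bar>walk_sum n s \<phi> rest (Suc t) v j m\<bar> \<le> (\<Sum>x<n. \<bar>walk_sum n s \<phi> rest t x j (add_mset (v, x) m)\<bar>)"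
      by simp
    also have "\<dots> \<le> (\<Sum>x<n. K * ?e (add_mset (v, x) m) * 3 ^ (t + s * length rest))"
    proof (rule sum_mono, rule Step(1))
      fix x
      show "if t = 0 then x = j \<longrightarrow> J \<subseteq># image_mset snd (add_mset (v, x) m) + mset (map snd rest)
        else J \<subseteq># image_mset snd (add_mset (v, x) m) + {#j#} + mset (map snd rest)"
        using J J'[of x] by (cases "t = 0") auto
    qed (use Step(2) in auto)
    also have "\<dots> = K * 3 ^ (t + s * length rest) * (\<Sum>x<n. ?e (add_mset (v, x) m))"
      by (simp add: sum_distrib_left mult_ac)
    also have "\<dots> \<le> K * 3 ^ (t + s * length rest) * (3 * ?e m)"
    proof (rule mult_left_mono)
      have "card (set_mset J) \<le> size J" by (rule card_set_mset_le_size)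
      thus "(\<Sum>x<n. ?e (add_mset (v, x) m)) \<le> 3 * ?e m"
        using pN Step(2) by (intro sum_edge_weight) auto
    qed (use K in auto)
    finally show ?thesis by (simp add: mult_ac)
  qed
next
  case (Nil v j m)
  have "0 \<le> K * edge_weight n (set_mset J) p N m"
    using K pN by (simp add: edge_weight_nonneg)
  then show ?case using base[of m] Nil by auto
next
  case (Cons ij rest v j m)
  have nn: "0 \<le> K * edge_weight n (set_mset J) p N m"
    using K pN by (simp add: edge_weight_nonneg)
  show ?case
  proof (cases "v = j")
    case True
    have "J \<subseteq># image_mset snd m + {#snd ij#} + mset (map snd rest)"
      using Cons(3) True by simp
    then show ?thesis using Cons(1,2) True s by simp
  qed (use nn in simp)
qed

text \<open>A parity invariant: a step from \<open>v\<close> to \<open>y\<close> records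
  \<open>v\<close> as a tail and \<open>y\<close> as a head and moves the current vertex to
  \<open>y\<close>, which changes the sum by an even number. If finally all edges have even
  multiplicity, the sum is even. Hence nonzero terms have every vertex occurring an even number of
  times among the starts and ends of the walks.\<close>

lemma walk_sum_eq_0:
  assumes "\<And>m. \<exists>e. odd (count m e) \<Longrightarrow> \<phi> m = 0"
  shows "odd (count (image_mset fst m) x + count (image_mset snd m) x + of_bool (v = x) + of_bool (j = x)
           + count_list (map fst rest) x + count_list (map snd rest) x) \<Longrightarrow>
    walk_sum n s \<phi> rest t v j m = 0"
proof (induction rest t v j m rule: walk_induct[where s = s])
  case (Nil v j m)
  have "\<exists>e. odd (count m e)" if "v = j"
  proof (rule ccontr)
    assume "\<nexists>e. odd (count m e)"
    hence "even (count m e)" for e by blast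
    hence "even (count (image_mset f m) x)" for f :: "nat \<times> nat \<Rightarrow> nat"
      by (auto simp: count_image_mset intro!: dvd_sum)
    from this[of fst] this[of snd] show False using Nil that by (simp split: if_splits)
  qed
  then show ?case using assms by auto
next
  case (Step rest t v j m)
  have "walk_sum n s \<phi> rest t y j (add_mset (v, y) m) = 0" for y
    by (rule Step(1), use Step(2) in \<open>cases "v = x"; cases "j = x"; cases "y = x"; simp\<close>)
  then show ?case by simp
next
  case (Cons ij rest v j m)
  show ?case
  proof (cases "v = j")
    case True
    then have "walk_sum n s \<phi> rest s (fst ij) (snd ij) m = 0"
      by (intro Cons(1), use Cons(2) in \<open>cases "j = x"; cases "fst ij = x"; cases "snd ij = x"; simp\<close>)
    then show ?thesis by simp
  qed simp
qed

text \<open>Let a distinct edges lead into \<open>J\<close>, let b others occur, and let r be the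
  surplus of multiplicities beyond two, so that the size is 2 a + 2 b + r. Distinct edges of the
  first kind pay g^2, of the second kind \<rho>^2, and surplus occurrences \<rho>. At least p
  occurrences lead into \<open>J\<close>, so p <= 2 a + r, and the factors \<beta> make up for the
  deficit p - 2 a when end points coincide. In this way g is always gained p times.\<close>

lemma moment_le_edge_weight:
  fixes \<sigma> L \<beta> g \<rho> N :: real
  assumes even: "\<And>e. even (count m e)"
    and \<phi>: "\<bar>\<phi>\<bar> \<le> \<sigma> ^ (2 * card (set_mset m)) * L ^ (size m - 2 * card (set_mset m))"
    and J: "J \<subseteq># image_mset snd m" and p: "size J = p" "0 < p"
    and nonneg: "0 \<le> \<beta>" "\<beta> \<le> 1" "0 \<le> g" "0 < n" "0 < N" "0 \<le> L"
    and bounds: "real n * N * \<sigma>\<^sup>2 \<le> \<rho>\<^sup>2" "real p * N * \<sigma>\<^sup>2 \<le> g\<^sup>2" "N * L \<le> \<rho>" "N * L * \<beta> \<le> g" "g \<le> \<rho>"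
  shows "\<bar>\<phi>\<bar> * \<beta> ^ (p - 2 * card (set_mset J))
    \<le> g ^ p * \<rho> ^ (size m - p) * edge_weight n (set_mset J) p N m"
proof -
  define F where "F = set_mset J"
  define A where "A = {e \<in> set_mset m. snd e \<in> F}"
  define B where "B = {e \<in> set_mset m. snd e \<notin> F}"
  have fin[simp]: "finite A" "finite B" by (auto simp: A_def B_def)
  define q where "q = card (set_mset m)"
  have AB: "set_mset m = A \<union> B" "A \<inter> B = {}" by (auto simp: A_def B_def)
  have q: "q = card A + card B" unfolding q_def AB(1) by (rule card_Un_disjoint) (use AB in auto)
  have c2: "2 \<le> count m e" if "e \<in># m" for e
  proof -
    have "count m e \<noteq> 0" using that by simp
    moreover have "count m e \<noteq> 1" using even[of e] by (metis odd_one)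
    ultimately show ?thesis by linarith
  qed
  have sm: "size m = (\<Sum>e\<in>A. count m e) + (\<Sum>e\<in>B. count m e)"
    unfolding size_multiset_overloaded_eq AB(1) by (rule sum.union_disjoint) (use AB in auto)
  have sB: "2 * card B \<le> (\<Sum>e\<in>B. count m e)"
    using sum_mono[of B "\<lambda>_. 2" "count m"] c2 by (auto simp: B_def)
  have sA: "2 * card A \<le> (\<Sum>e\<in>A. count m e)"
    using sum_mono[of A "\<lambda>_. 2" "count m"] c2 by (auto simp: A_def)
  have "J = filter_mset (\<lambda>x. x \<in> F) J" by (rule sym, rule filter_mset_eq_conv[THEN iffD2]) (auto simp: F_def)
  also have "\<dots> \<subseteq># filter_mset (\<lambda>x. x \<in> F) (image_mset snd m)"
    using J by (rule multiset_filter_mono)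
  also have "\<dots> = image_mset snd (filter_mset (\<lambda>e. snd e \<in> F) m)"
    by (simp add: filter_mset_image_mset)
  finally have "size J \<le> size (filter_mset (\<lambda>e. snd e \<in> F) m)"
    using size_mset_mono by fastforce
  also have "\<dots> = (\<Sum>e\<in>A. count m e)"
    by (simp add: size_multiset_overloaded_eq A_def)
  finally have pA: "p \<le> (\<Sum>e\<in>A. count m e)" using p by simp
  have "F \<subseteq> snd ` A" using set_mset_mono[OF J] by (auto simp: F_def A_def)
  hence FA: "card F \<le> card A" by (meson card_image_le card_mono fin(1) finite_imageI le_trans)
  define a b r where "a = card A" and "b = card B" and "r = size m - 2 * q"
  have r: "size m = 2 * a + 2 * b + r" and pr: "p \<le> 2 * a + r"
    using sm sA sB pA q by (auto simp: r_def a_def b_def)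
  have \<rho>0: "0 \<le> \<rho>" using nonneg bounds by linarith
  have sq: "size m - q = a + b + r" using r q by (simp add: a_def b_def)
  have ew: "edge_weight n F p N m = (1 / real n) ^ b * (1 / real p) ^ a * (1 / N) ^ (a + b + r)"
    unfolding edge_weight_def A_def[symmetric] B_def[symmetric] q_def[symmetric] a_def[symmetric] b_def[symmetric] sq ..
  have key: "(real n * N * \<sigma>\<^sup>2) ^ b * (real p * N * \<sigma>\<^sup>2) ^ a * ((N * L) ^ r * \<beta> ^ (p - 2 * a))
     \<le> g ^ p * \<rho> ^ (size m - p)"
  proof -
    have 1: "(real n * N * \<sigma>\<^sup>2) ^ b \<le> \<rho> ^ (2 * b)"
      unfolding power_mult[of \<rho>] by (rule power_mono[OF bounds(1)]) (use nonneg in auto)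
    have 2: "(real p * N * \<sigma>\<^sup>2) ^ a \<le> g ^ (2 * a)"
      unfolding power_mult[of g] by (rule power_mono[OF bounds(2)]) (use nonneg in auto)
    show ?thesis
    proof (cases "p \<le> 2 * a")
      case True
      have "(real n * N * \<sigma>\<^sup>2) ^ b * (real p * N * \<sigma>\<^sup>2) ^ a * ((N * L) ^ r * \<beta> ^ (p - 2 * a))
          \<le> \<rho> ^ (2 * b) * g ^ (2 * a) * (\<rho> ^ r * 1)"
        using True nonneg \<rho>0 bounds(3)
        by (intro mult_mono 1 2 power_mono) auto
      also have "g ^ (2 * a) = g ^ p * g ^ (2 * a - p)" using True by (simp flip: power_add)
      also have "\<rho> ^ (2 * b) * (g ^ p * g ^ (2 * a - p)) * (\<rho> ^ r * 1)
          \<le> \<rho> ^ (2 * b) * (g ^ p * \<rho> ^ (2 * a - p)) * (\<rho> ^ r * 1)"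
        using nonneg \<rho>0 bounds(5) by (intro mult_mono power_mono order_refl) auto
      also have "\<dots> = g ^ p * \<rho> ^ (2 * b + (2 * a - p) + r)"
        by (simp add: power_add)
      also have "2 * b + (2 * a - p) + r = size m - p" using True r by simp
      finally show ?thesis .
    next
      case False
      \<comment> \<open>There are too few distinct edges into the end points: y of the surplus
        occurrences are each paired with one factor \<beta> and bounded by g instead of
        \<rho>.\<close>
      define y where "y = p - 2 * a"
      have y: "y \<le> r" "p = 2 * a + y" using False pr by (auto simp: y_def)
      have "(N * L) ^ r * \<beta> ^ y = (N * L) ^ (r - y) * (N * L * \<beta>) ^ y"
      proof -
        have "(N * L) ^ r = (N * L) ^ (r - y) * (N * L) ^ y" using y by (simp flip: power_add)
        thus ?thesis by (simp add: power_mult_distrib)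
      qed
      also have "\<dots> \<le> \<rho> ^ (r - y) * g ^ y"
        using nonneg \<rho>0 bounds by (intro mult_mono power_mono) auto
      finally have 3: "(N * L) ^ r * \<beta> ^ y \<le> \<rho> ^ (r - y) * g ^ y" .
      have "(real n * N * \<sigma>\<^sup>2) ^ b * (real p * N * \<sigma>\<^sup>2) ^ a * ((N * L) ^ r * \<beta> ^ y)
          \<le> \<rho> ^ (2 * b) * g ^ (2 * a) * (\<rho> ^ (r - y) * g ^ y)"
        using nonneg \<rho>0 by (intro mult_mono 1 2 3) auto
      also have "\<dots> = g ^ p * \<rho> ^ (2 * b + (r - y))"
        unfolding y(2) by (simp add: power_add mult_ac)
      also have "2 * b + (r - y) = size m - p" using y r by simp
      finally show ?thesis by (simp add: y_def)
    qed
  qed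
  have "\<bar>\<phi>\<bar> * \<beta> ^ (p - 2 * card F) \<le> (\<sigma> ^ (2 * q) * L ^ r) * \<beta> ^ (p - 2 * a)"
  proof (rule mult_mono)
    show "\<beta> ^ (p - 2 * card F) \<le> \<beta> ^ (p - 2 * a)"
      by (rule power_decreasing) (use FA nonneg in \<open>auto simp: a_def\<close>)
  qed (use \<phi> nonneg in \<open>auto simp: q_def r_def\<close>)
  \<comment> \<open>The weight is the reciprocal of n^b p^a N^(a + b + r), which supplies exactly
    the factors required by the bounds on g and \<rho>.\<close>
  also have "\<dots> = (real n * N * \<sigma>\<^sup>2) ^ b * (real p * N * \<sigma>\<^sup>2) ^ a * ((N * L) ^ r * \<beta> ^ (p - 2 * a))
      * edge_weight n F p N m"
    unfolding ew using nonneg p q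
    by (simp add: a_def[symmetric] b_def[symmetric] power_mult_distrib power_add power_mult power_divide field_simps)
      (simp add: power2_eq_square power_mult_distrib)
  also have "\<dots> \<le> g ^ p * \<rho> ^ (size m - p) * edge_weight n F p N m"
    by (rule mult_right_mono[OF key]) (rule edge_weight_nonneg, use nonneg in auto)
  finally show ?thesis by (simp add: F_def)
qed

section \<open>Summation over the end points of the walks\<close>

lemma sum_lists_Suc:
  "(\<Sum>xs\<in>{xs. set xs \<subseteq> A \<and> length xs = Suc k}. g xs)
    = (\<Sum>xs\<in>{xs. set xs \<subseteq> A \<and> length xs = k}. \<Sum>x\<in>A. g (x # xs))"
proof -
  let ?S = "{xs. set xs \<subseteq> A \<and> length xs = k}"
  have inj: "inj_on (\<lambda>(xs, x). x # xs) (?S \<times> A)" by (auto simp: inj_on_def)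
  have "sum g ((\<lambda>(xs, x). x # xs) ` (?S \<times> A)) = (\<Sum>(xs, x)\<in>?S \<times> A. g (x # xs))"
    by (subst sum.reindex[OF inj]) (simp add: case_prod_beta)
  thus ?thesis unfolding lists_length_Suc_eq by (simp add: sum.cartesian_product)
qed

lemma power_sum_lists:
  fixes f :: "'a \<Rightarrow> 'b::comm_semiring_1"
  assumes "finite A"
  shows "sum f A ^ k = (\<Sum>xs\<in>{xs. set xs \<subseteq> A \<and> length xs = k}. \<Prod>x\<leftarrow>xs. f x)"
proof (induction k)
  case 0
  have "{xs. set xs \<subseteq> A \<and> length xs = 0} = {[]}" by auto
  then show ?case by simp
next
  case (Suc k)
  show ?case
    by (subst sum_lists_Suc) (simp add: Suc sum_distrib_left sum_distrib_right mult.commute)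
qed

lemma prod_list_eq_prod_count:
  fixes f :: "'a \<Rightarrow> 'b::comm_monoid_mult"
  assumes "finite V"
  shows "set xs \<subseteq> V \<Longrightarrow> (\<Prod>x\<leftarrow>xs. f x) = (\<Prod>v\<in>V. f v ^ count_list xs v)"
proof (induction xs)
  case (Cons x xs)
  have "(\<Prod>v\<in>V. f v ^ count_list (x # xs) v) = (\<Prod>v\<in>V. (if v = x then f v else 1) * f v ^ count_list xs v)"
    by (rule prod.cong) auto
  also have "\<dots> = f x * (\<Prod>v\<in>V. f v ^ count_list xs v)"
    using Cons assms by (simp add: prod.distrib)
  finally show ?case using Cons by simp
qed simp

definition ends :: "(nat \<times> nat) list \<Rightarrow> nat set" where
  "ends ps = fst ` set ps \<union> snd ` set ps"

text \<open>Every vertex occurs at least twice, so two of its factors can be kept as b^2 + u^2,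
  which is summable over the vertex. Each occurrence as an end point beyond the second leaves a
  factor \<beta>, and there are at least as many of these as the exponent says.\<close>

lemma coeff_bound:
  fixes b u :: "nat \<Rightarrow> real"
  assumes b: "\<And>v. v \<in> ends ps \<Longrightarrow> \<bar>b v\<bar> \<le> 1" and u: "\<And>v. v \<in> ends ps \<Longrightarrow> \<bar>u v\<bar> \<le> \<beta>"
    and \<beta>: "0 \<le> \<beta>" "\<beta> \<le> 1"
    and two: "\<And>v. v \<in> ends ps \<Longrightarrow> 2 \<le> count_list (map fst ps) v + count_list (map snd ps) v"
  shows "(\<Prod>ij\<leftarrow>ps. \<bar>b (fst ij)\<bar> * \<bar>u (snd ij)\<bar>)
    \<le> \<beta> ^ (length ps - 2 * card (snd ` set ps)) * (\<Prod>v\<in>ends ps. (b v)\<^sup>2 + (u v)\<^sup>2)"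
proof -
  let ?V = "ends ps"
  define k m where "k v = count_list (map fst ps) v" and "m v = count_list (map snd ps) v" for v
  have fin: "finite ?V" by (simp add: ends_def)
  have "(\<Prod>ij\<leftarrow>ps. \<bar>b (fst ij)\<bar> * \<bar>u (snd ij)\<bar>)
    = (\<Prod>i\<leftarrow>map fst ps. \<bar>b i\<bar>) * (\<Prod>j\<leftarrow>map snd ps. \<bar>u j\<bar>)"
    by (induction ps) auto
  also have "\<dots> = (\<Prod>v\<in>?V. \<bar>b v\<bar> ^ k v) * (\<Prod>v\<in>?V. \<bar>u v\<bar> ^ m v)"
    using prod_list_eq_prod_count[OF fin, of "map fst ps" "\<lambda>v. \<bar>b v\<bar>"]
      prod_list_eq_prod_count[OF fin, of "map snd ps" "\<lambda>v. \<bar>u v\<bar>"]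
    by (simp add: k_def m_def ends_def)
  also have "\<dots> = (\<Prod>v\<in>?V. \<bar>b v\<bar> ^ k v * \<bar>u v\<bar> ^ m v)" by (simp add: prod.distrib)
  also have "\<dots> \<le> (\<Prod>v\<in>?V. \<beta> ^ (m v - 2) * ((b v)\<^sup>2 + (u v)\<^sup>2))"
  proof (rule prod_mono, safe)
    fix v assume v: "v \<in> ?V"
    have bv: "\<bar>b v\<bar> \<le> 1" and uv: "\<bar>u v\<bar> \<le> \<beta>" and km: "2 \<le> k v + m v"
      using b[OF v] u[OF v] two[OF v] by (auto simp: k_def m_def)
    \<comment> \<open>The two factors kept are u^2, or |b| |u| estimated by squares, or b^2.\<close>
    consider "2 \<le> m v" | "m v = 1" "1 \<le> k v" | "m v = 0" "2 \<le> k v" using km by linarith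
    then show "\<bar>b v\<bar> ^ k v * \<bar>u v\<bar> ^ m v \<le> \<beta> ^ (m v - 2) * ((b v)\<^sup>2 + (u v)\<^sup>2)"
    proof cases
      case 1
      have "\<bar>b v\<bar> ^ k v * \<bar>u v\<bar> ^ m v = \<bar>b v\<bar> ^ k v * (\<bar>u v\<bar> ^ (m v - 2) * \<bar>u v\<bar> ^ 2)"
        by (metis 1 le_add_diff_inverse2 power_add)
      also have "\<dots> \<le> 1 * (\<beta> ^ (m v - 2) * \<bar>u v\<bar> ^ 2)"
        using bv uv \<beta> by (intro mult_mono power_le_one power_mono) auto
      also have "\<dots> \<le> \<beta> ^ (m v - 2) * ((b v)\<^sup>2 + (u v)\<^sup>2)"
        using \<beta> by (simp add: mult_left_mono)
      finally show ?thesis .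
    next
      case 2
      have "\<bar>b v\<bar> ^ k v \<le> \<bar>b v\<bar> ^ 1" by (rule power_decreasing) (use bv 2 in auto)
      hence "\<bar>b v\<bar> ^ k v * \<bar>u v\<bar> ^ m v \<le> \<bar>b v\<bar> * \<bar>u v\<bar>" using 2 by (simp add: mult_right_mono)
      also have "\<dots> \<le> (b v)\<^sup>2 + (u v)\<^sup>2"
      proof -
        have "0 \<le> (\<bar>b v\<bar> - \<bar>u v\<bar>)\<^sup>2" "0 \<le> \<bar>b v\<bar> * \<bar>u v\<bar>" by auto
        thus ?thesis unfolding power2_diff power2_abs by linarith
      qed
      finally show ?thesis using 2 by simp
    next
      case 3
      have "\<bar>b v\<bar> ^ k v \<le> \<bar>b v\<bar> ^ 2" by (rule power_decreasing) (use bv 3 in auto)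
      thus ?thesis using 3 by (simp add: add_increasing2)
    qed
  qed simp
  also have "\<dots> = \<beta> ^ (\<Sum>v\<in>?V. m v - 2) * (\<Prod>v\<in>?V. (b v)\<^sup>2 + (u v)\<^sup>2)"
    by (simp add: prod.distrib power_sum)
  also have "\<dots> \<le> \<beta> ^ (length ps - 2 * card (snd ` set ps)) * (\<Prod>v\<in>?V. (b v)\<^sup>2 + (u v)\<^sup>2)"
  proof (rule mult_right_mono, rule power_decreasing)
    have "length ps = (\<Sum>v\<in>snd ` set ps. m v)"
      using sum_count_set[of "map snd ps" "snd ` set ps"] by (simp add: m_def)
    also have "\<dots> \<le> (\<Sum>v\<in>snd ` set ps. (m v - 2) + 2)" by (rule sum_mono) auto
    also have "\<dots> = (\<Sum>v\<in>snd ` set ps. m v - 2) + 2 * card (snd ` set ps)"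
      by (simp only: sum.distrib) simp
    also have "(\<Sum>v\<in>snd ` set ps. m v - 2) \<le> (\<Sum>v\<in>?V. m v - 2)"
      by (rule sum_mono2) (auto simp: ends_def)
    finally show "length ps - 2 * card (snd ` set ps) \<le> (\<Sum>v\<in>?V. m v - 2)" by simp
  qed (use \<beta> in \<open>auto intro!: prod_nonneg\<close>)
  finally show ?thesis .
qed

text \<open>A vertex outside \<open>W\<close> contributes its weight, of total at most 2; a vertex
  of \<open>W\<close> leaves the product unchanged, and there are at most \<open>c\<close> of
  those.\<close>

lemma sum_prod_insert:
  fixes w :: "nat \<Rightarrow> real"
  assumes w: "\<And>v. 0 \<le> w v" and W: "finite W" "real (card W) \<le> c" and s: "sum w {..<n} \<le> 2"
  shows "(\<Sum>x<n. \<Prod>v\<in>insert x W. w v) \<le> (2 + c) * (\<Prod>v\<in>W. w v)"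
proof -
  let ?P = "\<Prod>v\<in>W. w v"
  have P: "0 \<le> ?P" by (rule prod_nonneg) (use w in auto)
  have "(\<Sum>x<n. \<Prod>v\<in>insert x W. w v) \<le> (\<Sum>x<n. (w x + of_bool (x \<in> W)) * ?P)"
    using w P W by (intro sum_mono) (auto simp: insert_absorb distrib_right)
  also have "\<dots> = (sum w {..<n} + real (card ({..<n} \<inter> W))) * ?P"
    unfolding sum_distrib_right[symmetric] by (simp add: sum.distrib)
  also have "\<dots> \<le> (2 + c) * ?P"
  proof (rule mult_right_mono[OF add_mono[OF s] P])
    have "card ({..<n} \<inter> W) \<le> card W" using W by (intro card_mono) auto
    thus "real (card ({..<n} \<inter> W)) \<le> c" using W by linarith
  qed
  finally show ?thesis .
qed

text \<open>\<open>W\<close> holds the vertices already chosen; a pair adds two vertices, each at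
  the cost of a factor 2 + c. The sum over all end points is thus free of n.\<close>

lemma sum_prod_ends:
  fixes w :: "nat \<Rightarrow> real"
  assumes w: "\<And>v. 0 \<le> w v" and s: "sum w {..<n} \<le> 2"
  shows "finite W \<Longrightarrow> card W + 2 * k \<le> c \<Longrightarrow>
   (\<Sum>ps\<in>{ps. set ps \<subseteq> {..<n} \<times> {..<n} \<and> length ps = k}. \<Prod>v\<in>ends ps \<union> W. w v)
     \<le> (2 + real c) ^ (2 * k) * (\<Prod>v\<in>W. w v)"
proof (induction k arbitrary: W)
  case 0
  have "{ps. set ps \<subseteq> {..<n} \<times> {..<n} \<and> length ps = 0} = {[]}" by auto
  then show ?case by (simp add: ends_def)
next
  case (Suc k)
  let ?S = "{ps. set ps \<subseteq> {..<n} \<times> {..<n} \<and> length ps = k}"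
  have "(\<Sum>ps\<in>{ps. set ps \<subseteq> {..<n} \<times> {..<n} \<and> length ps = Suc k}. \<Prod>v\<in>ends ps \<union> W. w v)
    = (\<Sum>ps\<in>?S. \<Sum>ij\<in>{..<n} \<times> {..<n}. \<Prod>v\<in>ends (ij # ps) \<union> W. w v)"
    by (rule sum_lists_Suc)
  also have "\<dots> = (\<Sum>ij\<in>{..<n} \<times> {..<n}. \<Sum>ps\<in>?S. \<Prod>v\<in>ends ps \<union> insert (fst ij) (insert (snd ij) W). w v)"
    by (subst sum.swap) (simp add: ends_def Un_commute insert_commute)
  also have "\<dots> \<le> (\<Sum>ij\<in>{..<n} \<times> {..<n}. (2 + real c) ^ (2 * k) * (\<Prod>v\<in>insert (fst ij) (insert (snd ij) W). w v))"
  proof (rule sum_mono, rule Suc.IH)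
    fix ij :: "nat \<times> nat"
    have "card (insert (fst ij) (insert (snd ij) W)) \<le> Suc (Suc (card W))"
      using card_insert_le_m1 Suc(2) by (auto simp: card_insert_if)
    thus "card (insert (fst ij) (insert (snd ij) W)) + 2 * k \<le> c" using Suc(3) by simp
  qed (use Suc in auto)
  also have "\<dots> = (2 + real c) ^ (2 * k) * (\<Sum>j<n. \<Sum>i<n. \<Prod>v\<in>insert i (insert j W). w v)"
    by (subst sum.swap) (simp add: sum_distrib_left sum.cartesian_product case_prod_beta)
  also have "\<dots> \<le> (2 + real c) ^ (2 * k) * (\<Sum>j<n. (2 + real c) * (\<Prod>v\<in>insert j W. w v))"
  proof (intro mult_left_mono sum_mono sum_prod_insert w s)
    fix j
    have "card (insert j W) \<le> Suc (card W)" using Suc(2) by (simp add: card_insert_if)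
    thus "real (card (insert j W)) \<le> real c" using Suc(3) by simp
  qed (use Suc in auto)
  also have "\<dots> = (2 + real c) ^ (2 * k) * (2 + real c) * (\<Sum>j<n. \<Prod>v\<in>insert j W. w v)"
    by (simp add: sum_distrib_left mult.assoc)
  also have "\<dots> \<le> (2 + real c) ^ (2 * k) * (2 + real c) * ((2 + real c) * (\<Prod>v\<in>W. w v))"
    using Suc by (intro mult_left_mono sum_prod_insert w s) auto
  also have "\<dots> = (2 + real c) ^ (2 * Suc k) * (\<Prod>v\<in>W. w v)" by (simp add: power2_eq_square)
  finally show ?case .
qed

text \<open>The p-th root of the bound is of order p^2 3^s g \<rho>^(s-1), where p^2 comes from the
  choice of end points and 3^s from the walks. Bounding all steps alike would give \<rho>^s; the
  gain is g / \<rho>.\<close>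

lemma moment_bilinear:
  fixes P :: "'w measure" and h :: "nat \<Rightarrow> nat \<Rightarrow> 'w \<Rightarrow> real"
    and b u :: "nat \<Rightarrow> real" and \<sigma> L \<beta> g \<rho> N :: real
  defines "\<phi> \<equiv> \<lambda>m. \<integral>\<omega>. (\<Prod>e\<in>#m. case_prod (\<lambda>i j. h i j \<omega>) e) \<partial>P"
  assumes int: "\<And>m. integrable P (\<lambda>\<omega>. \<Prod>e\<in>#m. case_prod (\<lambda>i j. h i j \<omega>) e)"
    and odd: "\<And>m. \<exists>e. odd (count m e) \<Longrightarrow> \<phi> m = 0"
    and even: "\<And>m. (\<And>e. even (count m e)) \<Longrightarrow>
       \<bar>\<phi> m\<bar> \<le> \<sigma> ^ (2 * card (set_mset m)) * L ^ (size m - 2 * card (set_mset m))"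
    and p: "0 < p" and s: "0 < s"
    and nonneg: "0 < \<beta>" "\<beta> \<le> 1" "0 \<le> g" "0 < n" "0 < N" "0 \<le> L"
    and bounds: "real n * N * \<sigma>\<^sup>2 \<le> \<rho>\<^sup>2" "real p * N * \<sigma>\<^sup>2 \<le> g\<^sup>2" "N * L \<le> \<rho>" "N * L * \<beta> \<le> g" "g \<le> \<rho>"
      "real (p * s) \<le> N"
    and b: "(\<Sum>i<n. (b i)\<^sup>2) = 1" and u: "(\<Sum>i<n. (u i)\<^sup>2) = 1" and u\<beta>: "\<And>i. i < n \<Longrightarrow> \<bar>u i\<bar> \<le> \<beta>"
  shows "integrable P (\<lambda>\<omega>. (\<Sum>i<n. \<Sum>j<n. b i * u j * mpow n (\<lambda>i j. h i j \<omega>) s i j) ^ p)" (is ?int)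
    and "(\<integral>\<omega>. (\<Sum>i<n. \<Sum>j<n. b i * u j * mpow n (\<lambda>i j. h i j \<omega>) s i j) ^ p \<partial>P)
      \<le> (2 + 2 * real p) ^ (2 * p) * (3 ^ (p * s) * (g ^ p * \<rho> ^ (p * s - p)))" (is "?E \<le> _")
proof -
  define M where "M \<omega> = mpow n (\<lambda>i j. h i j \<omega>) s" for \<omega>
  define S where "S = {ps. set ps \<subseteq> {..<n} \<times> {..<n} \<and> length ps = p}"
  define c where "c ps = (\<Prod>ij\<leftarrow>ps. b (fst ij) * u (snd ij))" for ps
  define Q where "Q ps \<omega> = (\<Prod>ij\<leftarrow>ps. M \<omega> (fst ij) (snd ij))" for ps \<omega>
  define K where "K = 3 ^ (p * s) * (g ^ p * \<rho> ^ (p * s - p))"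
  define w where "w v = (b v)\<^sup>2 + (u v)\<^sup>2" for v
  have \<rho>0: "0 \<le> \<rho>" using nonneg bounds by linarith
  have w0: "0 \<le> w v" for v by (simp add: w_def)
  have Pw: "0 \<le> (\<Prod>v\<in>A. w v)" for A by (rule prod_nonneg) (use w0 in blast)
  have K0: "0 \<le> K" using nonneg \<rho>0 by (simp add: K_def)
  have X: "(\<Sum>i<n. \<Sum>j<n. b i * u j * M \<omega> i j) ^ p = (\<Sum>ps\<in>S. c ps * Q ps \<omega>)" for \<omega>
  proof -
    have "(\<Sum>i<n. \<Sum>j<n. b i * u j * M \<omega> i j) ^ p =
      (\<Sum>ij\<in>{..<n} \<times> {..<n}. b (fst ij) * u (snd ij) * M \<omega> (fst ij) (snd ij)) ^ p"
      by (simp add: sum.cartesian_product case_prod_beta)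
    also have "\<dots> = (\<Sum>ps\<in>S. \<Prod>ij\<leftarrow>ps. b (fst ij) * u (snd ij) * M \<omega> (fst ij) (snd ij))"
      unfolding S_def by (rule power_sum_lists) simp
    also have "\<dots> = (\<Sum>ps\<in>S. c ps * Q ps \<omega>)"
    proof (rule sum.cong[OF refl])
      show "(\<Prod>ij\<leftarrow>ps. b (fst ij) * u (snd ij) * M \<omega> (fst ij) (snd ij)) = c ps * Q ps \<omega>" for ps
        unfolding c_def Q_def by (induction ps) (auto simp: mult_ac)
    qed
    finally show ?thesis .
  qed
  have Q_walk: "Q ps = (\<lambda>\<omega>. walk_sum n s (\<lambda>m. \<Prod>e\<in>#m. case_prod (\<lambda>i j. h i j \<omega>) e)
      (tl ps) s (fst (hd ps)) (snd (hd ps)) {#})" if psS: "ps \<in> S" for ps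
  proof
    fix \<omega>
    obtain ij rest where ps: "ps = ij # rest" using psS p by (cases ps) (auto simp: S_def)
    show "Q ps \<omega> = walk_sum n s (\<lambda>m. \<Prod>e\<in>#m. case_prod (\<lambda>i j. h i j \<omega>) e)
      (tl ps) s (fst (hd ps)) (snd (hd ps)) {#}"
      unfolding walk_sum_expand[symmetric] Q_def M_def ps by simp
  qed
  have Q_int: "integrable P (Q ps)" if psS: "ps \<in> S" for ps
    unfolding Q_walk[OF psS] by (rule integrable_walk_sum) (rule int)
  have Q_E: "(\<integral>\<omega>. Q ps \<omega> \<partial>P) = walk_sum n s \<phi> (tl ps) s (fst (hd ps)) (snd (hd ps)) {#}" if psS: "ps \<in> S" for ps
    unfolding Q_walk[OF psS] \<phi>_def by (rule expectation_walk_sum) (rule int)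
  have trm: "c ps * (\<integral>\<omega>. Q ps \<omega> \<partial>P) \<le> K * (\<Prod>v\<in>ends ps. w v)" if psS: "ps \<in> S" for ps
  proof (cases "\<forall>v\<in>ends ps. 2 \<le> count_list (map fst ps) v + count_list (map snd ps) v")
    \<comment> \<open>An end point that occurs exactly once violates the parity condition of
      \<open>walk_sum_eq_0\<close>, so such tuples vanish.\<close>
    case False
    then obtain v where v: "v \<in> ends ps" "count_list (map fst ps) v + count_list (map snd ps) v < 2" by auto
    obtain ij rest where ps: "ps = ij # rest" using psS p by (cases ps) (auto simp: S_def)
    have "count_list (map fst ps) v + count_list (map snd ps) v \<noteq> 0"
      using v(1) by (auto simp: ends_def count_list_0_iff)
    hence "count_list (map fst ps) v + count_list (map snd ps) v = 1" using v by linarith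
    hence "odd (of_bool (fst ij = v) + of_bool (snd ij = v) + count_list (map fst rest) v + count_list (map snd rest) v :: nat)"
      unfolding ps by (cases "fst ij = v"; cases "snd ij = v") simp_all
    hence "walk_sum n s \<phi> rest s (fst ij) (snd ij) {#} = 0"
      by (intro walk_sum_eq_0[where x = v] odd) (simp_all del: even_add)
    hence "(\<integral>\<omega>. Q ps \<omega> \<partial>P) = 0" using Q_E[OF psS] ps by simp
    thus ?thesis using mult_nonneg_nonneg[OF K0 Pw] by simp
  next
    case True
    define J where "J = mset (map snd ps)"
    define d where "d = p - 2 * card (set_mset J)"
    obtain ij rest where ps: "ps = ij # rest" using psS p by (cases ps) (auto simp: S_def)
    have len: "length ps = p" and sub: "ends ps \<subseteq> {..<n}" using psS by (auto simp: S_def ends_def)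
    have pS: "p = Suc (length rest)" using len ps by simp
    have sizeJ: "size J = p" by (simp add: J_def len)
    have \<beta>d: "0 < \<beta> ^ d" using nonneg by simp
    \<comment> \<open>The walk sum is bounded up to the factor \<open>1 / \<beta> ^ d\<close>; the
      coefficient \<open>c ps\<close> brings the compensating \<open>\<beta> ^ d\<close>.\<close>
    have "\<bar>walk_sum n s \<phi> rest s (fst ij) (snd ij) {#}\<bar>
      \<le> (g ^ p * \<rho> ^ (p * s - p) / \<beta> ^ d) * edge_weight n (set_mset J) p N {#} * 3 ^ (s + s * length rest)"
    proof (rule walk_sum_bound[where T = "p * s" and J = J])
      fix m :: "(nat \<times> nat) multiset" assume m: "size m = p * s" "J \<subseteq># image_mset snd m"
      show "\<bar>\<phi> m\<bar> \<le> g ^ p * \<rho> ^ (p * s - p) / \<beta> ^ d * edge_weight n (set_mset J) p N m"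
      proof (cases "\<exists>e. odd (count m e)")
        case True
        hence "\<phi> m = 0" by (rule odd)
        moreover have "0 \<le> edge_weight n (set_mset J) p N m" by (rule edge_weight_nonneg) (use nonneg in auto)
        ultimately show ?thesis using nonneg \<rho>0 by simp
      next
        case False
        hence ev: "\<And>e. even (count m e)" by blast
        have "\<bar>\<phi> m\<bar> * \<beta> ^ (p - 2 * card (set_mset J))
          \<le> g ^ p * \<rho> ^ (size m - p) * edge_weight n (set_mset J) p N m"
          by (rule moment_le_edge_weight[OF ev even[OF ev] m(2) sizeJ p]) (use nonneg bounds in simp_all)
        thus ?thesis using \<beta>d m(1) by (simp add: d_def pos_le_divide_eq)
      qed
    next
      show "size {#} + s + s * length rest = p * s" using pS by (simp add: algebra_simps)
      show "if s = 0 then fst ij = snd ij \<longrightarrow> J \<subseteq># image_mset snd {#} + mset (map snd rest)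
        else J \<subseteq># image_mset snd {#} + {#snd ij#} + mset (map snd rest)"
        using s by (simp add: J_def ps)
    qed (use p s nonneg \<rho>0 bounds sizeJ in simp_all)
    moreover have "s + s * length rest = p * s" using pS by (simp add: algebra_simps)
    moreover have "edge_weight n (set_mset J) p N {#} = 1" by (simp add: edge_weight_def)
    ultimately have Z: "\<bar>\<integral>\<omega>. Q ps \<omega> \<partial>P\<bar> \<le> K / \<beta> ^ d"
      using Q_E[OF psS] by (simp add: ps K_def mult_ac)
    have "\<bar>c ps\<bar> = (\<Prod>ij\<leftarrow>ps. \<bar>b (fst ij)\<bar> * \<bar>u (snd ij)\<bar>)"
      unfolding c_def by (induction ps) (auto simp: abs_mult)
    also have "\<dots> \<le> \<beta> ^ (length ps - 2 * card (snd ` set ps)) * (\<Prod>v\<in>ends ps. (b v)\<^sup>2 + (u v)\<^sup>2)"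
    proof (rule coeff_bound)
      fix v assume v: "v \<in> ends ps"
      hence "v < n" using sub by auto
      hence "(b v)\<^sup>2 \<le> (\<Sum>i<n. (b i)\<^sup>2)" by (intro member_le_sum) auto
      thus "\<bar>b v\<bar> \<le> 1" by (simp add: b abs_square_le_1)
      show "\<bar>u v\<bar> \<le> \<beta>" using \<open>v < n\<close> by (rule u\<beta>)
      show "2 \<le> count_list (map fst ps) v + count_list (map snd ps) v" using True v by blast
    qed (use nonneg in auto)
    also have "\<dots> = \<beta> ^ d * (\<Prod>v\<in>ends ps. w v)" by (simp add: d_def J_def len w_def)
    finally have c: "\<bar>c ps\<bar> \<le> \<beta> ^ d * (\<Prod>v\<in>ends ps. w v)" .
    have "c ps * (\<integral>\<omega>. Q ps \<omega> \<partial>P) \<le> \<bar>c ps\<bar> * \<bar>\<integral>\<omega>. Q ps \<omega> \<partial>P\<bar>"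
      by (simp flip: abs_mult)
    also have "\<dots> \<le> (\<beta> ^ d * (\<Prod>v\<in>ends ps. w v)) * (K / \<beta> ^ d)"
      by (rule mult_mono[OF c Z]) (use \<beta>d Pw in simp_all)
    also have "\<dots> = K * (\<Prod>v\<in>ends ps. w v)" using nonneg by simp
    finally show ?thesis .
  qed
  show int: ?int
    unfolding M_def[symmetric] X by (intro Bochner_Integration.integrable_sum integrable_mult_right Q_int)
  have "?E = (\<Sum>ps\<in>S. c ps * (\<integral>\<omega>. Q ps \<omega> \<partial>P))"
    unfolding M_def[symmetric] X
    by (subst Bochner_Integration.integral_sum) (use Q_int in simp_all)
  also have "\<dots> \<le> (\<Sum>ps\<in>S. K * (\<Prod>v\<in>ends ps \<union> {}. w v))" using trm by (intro sum_mono) simp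
  also have "\<dots> = K * (\<Sum>ps\<in>S. \<Prod>v\<in>ends ps \<union> {}. w v)" by (simp only: sum_distrib_left)
  also have "\<dots> \<le> K * ((2 + real (2 * p)) ^ (2 * p) * (\<Prod>v\<in>{}. w v))"
    unfolding S_def
  proof (intro mult_left_mono sum_prod_ends)
    show "sum w {..<n} \<le> 2" using b u by (simp add: w_def sum.distrib)
  qed (use w0 K0 in simp_all)
  finally show "?E \<le> (2 + 2 * real p) ^ (2 * p) * (3 ^ (p * s) * (g ^ p * \<rho> ^ (p * s - p)))"
    by (simp add: K_def mult_ac)
qed

section \<open>Counting eigenvalues in a disc\<close>

text \<open>The continuous logarithms of the two paths add up to one of the product.\<close>

lemma winding_number_mult:
  assumes "path f" "path g" "0 \<notin> path_image f" "0 \<notin> path_image g"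
  shows "winding_number (\<lambda>t. f t * g t) 0 = winding_number f 0 + winding_number g 0"
proof -
  obtain p where p: "path p" "pathfinish p - pathstart p = 2 * of_real pi * \<i> * winding_number f 0"
    "\<And>t. t \<in> {0..1} \<Longrightarrow> f t = 0 + exp (p t)"
    using winding_number_as_continuous_log[OF assms(1,3)] by blast
  obtain q where q: "path q" "pathfinish q - pathstart q = 2 * of_real pi * \<i> * winding_number g 0"
    "\<And>t. t \<in> {0..1} \<Longrightarrow> g t = 0 + exp (q t)"
    using winding_number_as_continuous_log[OF assms(2,4)] by blast
  have pq: "path (\<lambda>t. p t + q t)" using p q unfolding path_def by (intro continuous_on_add)
  have "winding_number (\<lambda>t. f t * g t) 0 = winding_number (exp \<circ> (\<lambda>t. p t + q t)) 0"
  proof (rule winding_number_cong)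
    show "f t * g t = (exp \<circ> (\<lambda>t. p t + q t)) t" if "0 \<le> t" "t \<le> 1" for t
      using p(3) q(3) that by (simp add: exp_add)
  qed
  also have "\<dots> = ((pathfinish p - pathstart p) + (pathfinish q - pathstart q)) / (2 * of_real pi * \<i>)"
    by (subst winding_number_compose_exp[OF pq]) (simp add: pathfinish_def pathstart_def)
  also have "\<dots> = winding_number f 0 + winding_number g 0"
    unfolding p q by (simp add: field_simps)
  finally show ?thesis .
qed

lemma winding_number_prod_list:
  assumes "0 < r" "\<And>x. x \<in> set as \<Longrightarrow> cmod (x - c) \<noteq> r"
  shows "winding_number (\<lambda>t. \<Prod>x\<leftarrow>as. circlepath c r t - x) 0
    = of_nat (length (filter (\<lambda>x. cmod (x - c) < r) as))"
  using assms(2)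
proof (induction as)
  case Nil
  then show ?case by (simp add: winding_number_zero_const)
next
  case (Cons x as)
  have path: "path (circlepath c r)" by simp
  have img: "x \<notin> path_image (circlepath c r)" if "x \<in> set (y # as)" "\<And>x. x \<in> set (y # as) \<Longrightarrow> cmod (x - c) \<noteq> r" for x y as
    using that(2)[OF that(1)] assms(1) by (simp add: dist_norm norm_minus_commute)
  have 1: "path (\<lambda>t. circlepath c r t - x)" 
    using path unfolding path_def by (intro continuous_intros)
  have 2: "path (\<lambda>t. \<Prod>x\<leftarrow>as. circlepath c r t - x)"
  proof (induction as)
    case (Cons a as)
    then show ?case using path unfolding path_def by (auto intro!: continuous_intros)
  qed (simp add: path_def)
  have 3: "0 \<notin> path_image (\<lambda>t. circlepath c r t - x)"
    using img[of x x as] Cons.prems by (auto simp: path_image_def)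
  have 4: "0 \<notin> path_image (\<lambda>t. \<Prod>x\<leftarrow>as. circlepath c r t - x)"
  proof
    assume "0 \<in> path_image (\<lambda>t. \<Prod>x\<leftarrow>as. circlepath c r t - x)"
    then obtain t where t: "t \<in> {0..1}" "(\<Prod>x\<leftarrow>as. circlepath c r t - x) = 0"
      by (auto simp: path_image_def)
    then obtain y where "y \<in> set as" "circlepath c r t = y"
      by (auto simp: prod_list_zero_iff)
    hence "y \<in> path_image (circlepath c r)" using t by (auto simp: path_image_def)
    thus False using img[of y x as] Cons.prems \<open>y \<in> set as\<close> by auto
  qed
  have "winding_number (\<lambda>t. circlepath c r t - x) 0 = of_bool (cmod (x - c) < r)"
  proof (cases "cmod (x - c) < r")
    case True
    then show ?thesis by (simp add: winding_number_circlepath flip: winding_number_offset)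
  next
    case False
    have "winding_number (circlepath c r) x = 0"
      by (rule winding_number_zero_outside[of _ "cball c r"])
         (use False assms(1) Cons.prems[of x] in \<open>auto simp: dist_norm norm_minus_commute\<close>)
    then show ?thesis using False by (simp flip: winding_number_offset)
  qed
  then show ?case
    using winding_number_mult[OF 1 2 3 4] Cons by simp
qed

text \<open>As t varies, the images of the circle under \<open>F t\<close> form a homotopy of loops
  avoiding 0, so their winding number about 0 is constant. For a product of linear factors it counts
  the roots inside, with multiplicity.\<close>

lemma root_count_homotopy:
  fixes F :: "real \<Rightarrow> complex \<Rightarrow> complex"
  assumes r: "0 < r" and cont: "continuous_on ({0..1} \<times> UNIV) (\<lambda>(t, z). F t z)"
    and nz: "\<And>t z. 0 \<le> t \<Longrightarrow> t \<le> 1 \<Longrightarrow> cmod (z - c) = r \<Longrightarrow> F t z \<noteq> 0"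
    and as: "\<And>z. F 0 z = (\<Prod>x\<leftarrow>as. z - x)" and bs: "\<And>z. F 1 z = (\<Prod>x\<leftarrow>bs. z - x)"
  shows "length (filter (\<lambda>x. cmod (x - c) < r) as) = length (filter (\<lambda>x. cmod (x - c) < r) bs)"
proof -
  let ?\<gamma> = "circlepath c r"
  have \<gamma>: "cmod (?\<gamma> t - c) = r" if "t \<in> {0..1}" for t
  proof -
    have "?\<gamma> t \<in> path_image ?\<gamma>" using that by (auto simp: path_image_def)
    thus ?thesis using r by (simp add: dist_norm norm_minus_commute)
  qed
  have "homotopic_loops (-{0}) (\<lambda>t. F 0 (?\<gamma> t)) (\<lambda>t. F 1 (?\<gamma> t))"
    unfolding homotopic_loops
  proof (intro exI[of _ "\<lambda>(s, t). F s (?\<gamma> t)"] conjI ballI)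
    have "continuous_on ({0..1::real} \<times> {0..1}) (\<lambda>x. (case (fst x, ?\<gamma> (snd x)) of (t, z) \<Rightarrow> F t z))"
    proof (rule continuous_on_compose2[OF cont])
      have "continuous_on {0..1} ?\<gamma>" using path_circlepath[of c r] unfolding path_def .
      hence "continuous_on ({0..1::real} \<times> {0..1::real}) (\<lambda>x. ?\<gamma> (snd x))"
        by (rule continuous_on_compose2) (auto intro!: continuous_intros)
      thus "continuous_on ({0..1::real} \<times> {0..1}) (\<lambda>x. (fst x, ?\<gamma> (snd x)))"
        by (intro continuous_intros)
    qed auto
    thus "continuous_on ({0..1::real} \<times> {0..1}) (\<lambda>(s, t). F s (?\<gamma> t))"
      by (simp add: case_prod_beta)
    show "(\<lambda>(s, t). F s (?\<gamma> t)) \<in> {0..1} \<times> {0..1} \<rightarrow> - {0}"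
      using nz \<gamma> by auto
    show "pathfinish ((\<lambda>(s, t). F s (?\<gamma> t)) \<circ> Pair t) = pathstart ((\<lambda>(s, t). F s (?\<gamma> t)) \<circ> Pair t)" for t
      using pathfinish_circlepath[of c r] pathstart_circlepath[of c r]
      by (simp add: pathstart_def pathfinish_def del: pathfinish_circlepath pathstart_circlepath)
  qed simp_all
  hence w: "winding_number (\<lambda>t. F 0 (?\<gamma> t)) 0 = winding_number (\<lambda>t. F 1 (?\<gamma> t)) 0"
    by (rule winding_number_homotopic_loops)
  have "cmod (x - c) \<noteq> r" if "x \<in> set as" for x
    using nz[of 0 x] that by (auto simp: as prod_list_zero_iff)
  moreover have "cmod (x - c) \<noteq> r" if "x \<in> set bs" for x
    using nz[of 1 x] that by (auto simp: bs prod_list_zero_iff)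
  ultimately show ?thesis
    using w unfolding as bs by (simp add: winding_number_prod_list r)
qed

section \<open>Characteristic polynomial of a perturbed low-rank matrix\<close>

lemma poly_char_poly_eq_det:
  fixes A :: "'a::field mat"
  assumes "A \<in> carrier_mat n n"
  shows "poly (char_poly A) z = Determinant.det (z \<cdot>\<^sub>m 1\<^sub>m n - A)"
  unfolding char_poly_matrix[OF assms]
  by (rule arg_cong[where f = Determinant.det]) (use assms in \<open>auto simp: char_matrix_def\<close>)

text \<open>Sylvester's identity by block elimination: \<open>?X\<close> becomes block triangular
  when multiplied by \<open>?Y\<close> on the right and also by \<open>?W\<close> on the left.
  Powers of z on both sides avoid division by z and keep the identity polynomial.\<close>

lemma det_sylvester:
  fixes A B :: "'a::idom mat"
  assumes A: "A \<in> carrier_mat n r" and B: "B \<in> carrier_mat r n"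
  shows "z ^ r * Determinant.det (z \<cdot>\<^sub>m 1\<^sub>m n - A * B) = z ^ n * Determinant.det (z \<cdot>\<^sub>m 1\<^sub>m r - B * A)"
proof -
  let ?Z = "z \<cdot>\<^sub>m 1\<^sub>m n" and ?I = "1\<^sub>m r :: 'a mat"
  let ?X = "four_block_mat ?Z A B ?I"
  let ?Y = "four_block_mat (1\<^sub>m n) (0\<^sub>m n r) (- B) ?I"
  let ?W = "four_block_mat (1\<^sub>m n) (0\<^sub>m n r) (- B) (z \<cdot>\<^sub>m ?I)"
  have X: "?X \<in> carrier_mat (n + r) (n + r)" and Y: "?Y \<in> carrier_mat (n + r) (n + r)"
    and W: "?W \<in> carrier_mat (n + r) (n + r)" using A B by auto
  have "?X * ?Y = four_block_mat (?Z * 1\<^sub>m n + A * (- B)) (?Z * 0\<^sub>m n r + A * ?I)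
      (B * 1\<^sub>m n + ?I * (- B)) (B * 0\<^sub>m n r + ?I * ?I)"
    by (rule mult_four_block_mat) (use A B in auto)
  also have "\<dots> = four_block_mat (?Z - A * B) A (0\<^sub>m r n) ?I"
    using A B by (intro arg_cong4[where f = four_block_mat]) auto
  finally have "Determinant.det (?X * ?Y) = Determinant.det (four_block_mat (?Z - A * B) A (0\<^sub>m r n) ?I)" by simp
  also have "\<dots> = Determinant.det (?Z - A * B)"
    by (subst det_four_block_mat_lower_left_zero) (use A B in auto)
  also have "Determinant.det (?X * ?Y) = Determinant.det ?X"
    unfolding det_mult[OF X Y] by (subst det_four_block_mat_upper_right_zero[of "1\<^sub>m n" n]) (use A B in auto)
  finally have dX: "Determinant.det ?X = Determinant.det (?Z - A * B)" .
  have "?W * ?X = four_block_mat (1\<^sub>m n * ?Z + 0\<^sub>m n r * B) (1\<^sub>m n * A + 0\<^sub>m n r * ?I)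
      ((- B) * ?Z + (z \<cdot>\<^sub>m ?I) * B) ((- B) * A + (z \<cdot>\<^sub>m ?I) * ?I)"
    by (rule mult_four_block_mat) (use A B in auto)
  also have "\<dots> = four_block_mat ?Z A (0\<^sub>m r n) (z \<cdot>\<^sub>m ?I - B * A)"
    using A B by (intro arg_cong4[where f = four_block_mat]) (auto simp: add_uminus_minus_mat)
  finally have "Determinant.det (?W * ?X) = Determinant.det (four_block_mat ?Z A (0\<^sub>m r n) (z \<cdot>\<^sub>m ?I - B * A))" by simp
  also have "\<dots> = z ^ n * Determinant.det (z \<cdot>\<^sub>m ?I - B * A)"
    by (subst det_four_block_mat_lower_left_zero[of _ n]) (use A B in auto)
  also have "Determinant.det (?W * ?X) = z ^ r * Determinant.det ?X"
    unfolding det_mult[OF W X] by (subst det_four_block_mat_upper_right_zero[of "1\<^sub>m n" n]) (use A B in auto)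
  finally show ?thesis unfolding dX .
qed

lemma eigenvalue_count_perturbation:
  fixes A B E :: "complex mat" and d :: "nat \<Rightarrow> complex"
  assumes A: "A \<in> carrier_mat n k" and B: "B \<in> carrier_mat k n" and E: "E \<in> carrier_mat n n"
    and BA: "B * A = mat_diag k d" and r: "0 < r" "r < cmod c"
    and nz: "\<And>t z. 0 \<le> t \<Longrightarrow> t \<le> 1 \<Longrightarrow> cmod (z - c) = r \<Longrightarrow> \<not> eigenvalue (A * B + complex_of_real t \<cdot>\<^sub>m E) z"
    and bs: "char_poly (A * B + E) = (\<Prod>x\<leftarrow>bs. [:- x, 1:])"
  shows "length (filter (\<lambda>x. cmod (x - c) < r) bs) = card {i. i < k \<and> cmod (d i - c) < r}"
proof -
  define G where "G t = A * B + complex_of_real t \<cdot>\<^sub>m E" for t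
  \<comment> \<open>The factor \<open>z ^ k\<close> makes \<open>det_sylvester\<close> applicable at
    t = 0. It only adds roots at 0, which lie outside the disc because
    \<open>r < cmod c\<close>.\<close>
  define F where "F t z = z ^ k * Determinant.det (z \<cdot>\<^sub>m 1\<^sub>m n - G t)" for t z
  have G: "G t \<in> carrier_mat n n" for t using A B E by (simp add: G_def)
  have G1: "G 1 = A * B + E" and G0: "G 0 = A * B" using A B E by (auto simp: G_def)
  have out: "\<not> cmod (0 - c) < r" using r by simp
  have "length (filter (\<lambda>x. cmod (x - c) < r) (replicate n 0 @ map d [0..<k]))
      = length (filter (\<lambda>x. cmod (x - c) < r) (replicate k 0 @ bs))"
  proof (rule root_count_homotopy[OF r(1), where F = F])
    \<comment> \<open>The Leibniz formula exhibits the determinant as a polynomial in t and z, hence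
      as jointly continuous.\<close>
    have "continuous_on ({0..1} \<times> UNIV) (\<lambda>x. snd x ^ k * (\<Sum> p \<in> {p. p permutes {0 ..< n}}.
      signof p * (\<Prod> i = 0 ..< n. of_bool (i = p i) * snd x - ((A * B) $$ (i, p i) + complex_of_real (fst x) * E $$ (i, p i)))))"
      by (intro continuous_intros)
    moreover have "F t z = z ^ k * (\<Sum> p \<in> {p. p permutes {0 ..< n}}.
      signof p * (\<Prod> i = 0 ..< n. of_bool (i = p i) * z - ((A * B) $$ (i, p i) + complex_of_real t * E $$ (i, p i))))" for t z
    proof -
      have "z \<cdot>\<^sub>m 1\<^sub>m n - G t \<in> carrier_mat n n" by (rule minus_carrier_mat[OF G])
      moreover have "(z \<cdot>\<^sub>m 1\<^sub>m n - G t) $$ (i, p i) = of_bool (i = p i) * z - ((A * B) $$ (i, p i) + complex_of_real t * E $$ (i, p i))"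
        if "p permutes {0..<n}" "i \<in> {0..<n}" for p i
        using that A B E permutes_in_image[OF that(1), of i] by (auto simp: G_def)
      ultimately show ?thesis
        unfolding F_def by (subst det_def'[of _ n]) (auto intro!: sum.cong prod.cong)
    qed
    ultimately show "continuous_on ({0..1} \<times> UNIV) (\<lambda>(t, z). F t z)"
      by (simp add: case_prod_beta)
    show "F t z \<noteq> 0" if "0 \<le> t" "t \<le> 1" "cmod (z - c) = r" for t z
    proof -
      have "z \<noteq> 0" using that r by auto
      moreover have "poly (char_poly (G t)) z \<noteq> 0"
        using nz[OF that] eigenvalue_root_char_poly[OF G, of t z] by (simp add: G_def)
      ultimately show ?thesis by (simp add: F_def poly_char_poly_eq_det[OF G])
    qed
    show "F 0 z = (\<Prod>x\<leftarrow>replicate n 0 @ map d [0..<k]. z - x)" for z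
    proof -
      have ut: "upper_triangular (z \<cdot>\<^sub>m 1\<^sub>m k - mat_diag k d)" 
        by (auto simp: upper_triangular_def mat_diag_def)
      have dm: "diag_mat (z \<cdot>\<^sub>m 1\<^sub>m k - mat_diag k d) = map (\<lambda>i. z - d i) [0..<k]"
        by (auto simp: diag_mat_def mat_diag_def)
      have "Determinant.det (z \<cdot>\<^sub>m 1\<^sub>m k - B * A) = (\<Prod>x\<leftarrow>map d [0..<k]. z - x)"
        unfolding BA by (subst det_upper_triangular[OF ut, of k]) (auto simp: dm o_def intro!: minus_carrier_mat)
      thus ?thesis
        unfolding F_def G0 det_sylvester[OF A B] by (simp add: map_replicate_const)
    qed
    show "F 1 z = (\<Prod>x\<leftarrow>replicate k 0 @ bs. z - x)" for z
    proof -
      have "poly (\<Prod>x\<leftarrow>bs. [:- x, 1:]) z = (\<Prod>x\<leftarrow>bs. z - x)"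
        by (induction bs) (auto simp: algebra_simps)
      hence "Determinant.det (z \<cdot>\<^sub>m 1\<^sub>m n - G 1) = (\<Prod>x\<leftarrow>bs. z - x)"
        using poly_char_poly_eq_det[OF G, of 1 z] bs by (simp add: G1)
      thus ?thesis by (simp add: F_def map_replicate_const)
    qed
  qed
  also have "length (filter (\<lambda>x. cmod (x - c) < r) (replicate n 0 @ map d [0..<k]))
     = card {i. i < k \<and> cmod (d i - c) < r}"
    using out by (simp add: length_filter_conv_card cong: conj_cong)
  also have "length (filter (\<lambda>x. cmod (x - c) < r) (replicate k 0 @ bs)) = length (filter (\<lambda>x. cmod (x - c) < r) bs)"
    using out by simp
  finally show ?thesis by simp
qed

section \<open>Neumann series and perturbation of an eigenpair\<close>

text \<open>There is no conjugation over the complex numbers: transposing the array then simply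
  exchanges the two vectors, which is how left eigenvectors are handled.\<close>

definition bil :: "nat \<Rightarrow> (nat \<Rightarrow> nat \<Rightarrow> 'a) \<Rightarrow> nat \<Rightarrow> (nat \<Rightarrow> 'a) \<Rightarrow> (nat \<Rightarrow> 'a) \<Rightarrow> 'a::comm_ring_1" where
  "bil n A s b c = (\<Sum>i<n. \<Sum>j<n. b i * c j * mpow n A s i j)"

definition dot :: "nat \<Rightarrow> (nat \<Rightarrow> 'a) \<Rightarrow> (nat \<Rightarrow> 'a) \<Rightarrow> 'a::comm_ring_1" where
  "dot n b c = (\<Sum>i<n. b i * c i)"

lemma mpow_add:
  "i < n \<Longrightarrow> mpow n A (s + t) i j = (\<Sum>x<n. mpow n A s i x * mpow n A t x j)"
proof (induction s arbitrary: i)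
  case 0
  then show ?case by (simp add: of_bool_def if_distrib[of "\<lambda>x. x * _"] cong: if_cong)
next
  case (Suc s)
  have "mpow n A (Suc s + t) i j = (\<Sum>y<n. \<Sum>x<n. A i y * (mpow n A s y x * mpow n A t x j))"
    by (simp add: Suc sum_distrib_left)
  also have "\<dots> = (\<Sum>x<n. mpow n A (Suc s) i x * mpow n A t x j)"
    by (subst sum.swap) (simp add: sum_distrib_right mult.assoc)
  finally show ?case .
qed

lemma mpow_1: "j < n \<Longrightarrow> mpow n A (Suc 0) i j = A i j"
  by (simp add: of_bool_def if_distrib[of "\<lambda>x. _ * x"] cong: if_cong)

lemma mpow_Suc_right:
  "i < n \<Longrightarrow> j < n \<Longrightarrow> mpow n A (Suc s) i j = (\<Sum>x<n. mpow n A s i x * A x j)"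
  using mpow_add[of i n A s 1 j] by (simp add: mpow_1 del: mpow.simps(2))

lemma mpow_transpose: "i < n \<Longrightarrow> j < n \<Longrightarrow> mpow n (\<lambda>i j. A j i) s i j = mpow n A s j i"
proof (induction s arbitrary: i j)
  case (Suc s)
  then show ?case
    by (subst mpow_Suc_right) (auto intro!: sum.cong simp: mult.commute)
qed auto

lemma mpow_scale: "mpow n (\<lambda>i j. c * A i j) s i j = c ^ s * mpow n A s i j"
  by (induction s arbitrary: i) (auto simp: sum_distrib_left mult_ac)

lemma mpow_of_real:
  "mpow n (\<lambda>i j. of_real (A i j)) s i j = (of_real (mpow n A s i j) :: 'a::{real_algebra_1,comm_ring_1})"
  by (induction s arbitrary: i) (auto simp: of_bool_def)

lemma mpow_cong:
  assumes "\<And>i j. i < n \<Longrightarrow> j < n \<Longrightarrow> A i j = B i j"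
  shows "i < n \<Longrightarrow> mpow n A s i j = mpow n B s i j"
  by (induction s arbitrary: i) (auto intro!: sum.cong simp: assms)

lemma bil_0: "bil n A 0 b c = dot n b c"
  unfolding bil_def dot_def
  by (rule sum.cong) (auto simp: of_bool_def if_distrib[of "\<lambda>x. _ * x"] cong: if_cong)

lemma bil_transpose: "bil n (\<lambda>i j. A j i) s b c = bil n A s c b"
proof -
  have "bil n (\<lambda>i j. A j i) s b c = (\<Sum>i<n. \<Sum>j<n. c j * b i * mpow n A s j i)"
    unfolding bil_def by (intro sum.cong refl) (simp add: mpow_transpose[of _ n _ A])
  also have "\<dots> = bil n A s c b" unfolding bil_def by (rule sum.swap)
  finally show ?thesis .
qed

lemma bil_scale: "bil n (\<lambda>i j. t * A i j) s b c = t ^ s * bil n A s b c"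
  by (simp add: bil_def mpow_scale sum_distrib_left mult_ac)

lemma bil_of_real:
  "bil n (\<lambda>i j. of_real (A i j)) s (\<lambda>i. of_real (b i)) (\<lambda>i. of_real (c i))
    = (of_real (bil n A s b c) :: 'a::{real_algebra_1,comm_ring_1})"
  by (simp add: bil_def mpow_of_real)

lemma bil_add: "bil n A s b (\<lambda>j. c j + d j) = bil n A s b c + bil n A s b d"
  by (simp add: bil_def sum.distrib[symmetric] algebra_simps)

lemma bil_sum: "bil n A s b (\<lambda>j. \<Sum>k<r. x k * c k j) = (\<Sum>k<r. x k * bil n A s b (c k))"
proof -
  have "bil n A s b (\<lambda>j. \<Sum>k<r. x k * c k j) = (\<Sum>i<n. \<Sum>j<n. \<Sum>k<r. x k * (b i * c k j * mpow n A s i j))"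
    by (simp add: bil_def sum_distrib_left sum_distrib_right mult_ac)
  also have "\<dots> = (\<Sum>k<r. x k * bil n A s b (c k))"
    unfolding bil_def sum_distrib_left
    by (subst (2) sum.swap, subst sum.swap) (rule refl)
  finally show ?thesis .
qed

lemma bil_mult: "bil n A s b (\<lambda>j. z * c j) = z * bil n A s b c"
  by (simp add: bil_def sum_distrib_left mult_ac)

lemma bil_cong: "(\<And>j. j < n \<Longrightarrow> c j = d j) \<Longrightarrow> bil n A s b c = bil n A s b d"
  by (simp add: bil_def)

lemma bil_Suc: "bil n A (Suc s) b c = bil n A s b (\<lambda>i. \<Sum>j<n. A i j * c j)"
proof -
  have "bil n A (Suc s) b c = (\<Sum>i<n. \<Sum>j<n. \<Sum>x<n. b i * c j * (mpow n A s i x * A x j))"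
    unfolding bil_def by (intro sum.cong refl) (simp add: mpow_Suc_right sum_distrib_left del: mpow.simps(2))
  also have "\<dots> = (\<Sum>i<n. \<Sum>x<n. \<Sum>j<n. b i * c j * (mpow n A s i x * A x j))"
    by (intro sum.cong refl sum.swap)
  also have "\<dots> = bil n A s b (\<lambda>i. \<Sum>j<n. A i j * c j)"
    by (simp add: bil_def sum_distrib_left sum_distrib_right mult_ac)
  finally show ?thesis .
qed

text \<open>The truncated Neumann series of \<open>z - A\<close>: iterating \<open>z u = A u + f\<close> and letting the
  remainder, controlled by the entries of high powers of \<open>A\<close>, tend to zero.\<close>

lemma neumann_bound:
  fixes A :: "nat \<Rightarrow> nat \<Rightarrow> complex"
  assumes u: "\<And>i. i < n \<Longrightarrow> z * u i = (\<Sum>j<n. A i j * u j) + f i"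
    and \<tau>: "0 < \<tau>" "2 * \<tau> \<le> cmod z"
    and tail: "\<And>s i j. S \<le> s \<Longrightarrow> i < n \<Longrightarrow> j < n \<Longrightarrow> cmod (mpow n A s i j) \<le> \<tau> ^ s"
    and f: "\<And>t. 1 \<le> t \<Longrightarrow> cmod (bil n A t c f) \<le> B * \<tau> ^ (t - 1)"
    and t: "1 \<le> t"
  shows "cmod (bil n A t c u) \<le> 2 * B * \<tau> ^ (t - 1) / cmod z"
proof -
  have z: "0 < cmod z" using \<tau> by linarith
  have B: "0 \<le> B" using order_trans[OF norm_ge_zero f[of 1]] by simp
  have rec: "z * bil n A t c u = bil n A (Suc t) c u + bil n A t c f" for t
    unfolding bil_Suc bil_mult[symmetric] bil_add[symmetric] by (rule bil_cong) (use u in auto)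
  have step: "cmod (bil n A t c u) \<le> B * \<tau> ^ (t - 1) / cmod z + cmod (bil n A (Suc t) c u) / cmod z" if "1 \<le> t" for t
  proof -
    have "cmod z * cmod (bil n A t c u) \<le> cmod (bil n A (Suc t) c u) + cmod (bil n A t c f)"
      unfolding norm_mult[symmetric] rec by (rule norm_triangle_ineq)
    thus ?thesis using f[OF that] z by (simp add: field_simps)
  qed
  \<comment> \<open>The factor 2 - 2 / 2^k is the sum of the first k terms of 1 + 1/2 + 1/4 + ...,
    since each iteration gains \<tau> / |z|, which is at most 1/2.\<close>
  have iter: "cmod (bil n A t c u) \<le> B * \<tau> ^ (t - 1) / cmod z * (2 - 2 / 2 ^ k) + cmod (bil n A (t + k) c u) / cmod z ^ k"
    if "1 \<le> t" for t k
    using that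
  proof (induction k arbitrary: t)
    case (Suc k)
    have "B * \<tau> ^ t / cmod z = (B * \<tau> ^ (t - 1) / cmod z) * \<tau>"
      using Suc.prems by (cases t) auto
    also have "\<dots> \<le> (B * \<tau> ^ (t - 1) / cmod z) * (cmod z / 2)"
      using \<tau> B by (intro mult_left_mono) auto
    finally have "B * \<tau> ^ t / cmod z * (2 - 2 / 2 ^ k) \<le> (B * \<tau> ^ (t - 1) / cmod z) * (cmod z / 2) * (2 - 2 / 2 ^ k)"
      by (rule mult_right_mono) (simp add: field_simps)
    note h = this
    have IH: "cmod (bil n A (Suc t) c u)
      \<le> B * \<tau> ^ t / cmod z * (2 - 2 / 2 ^ k) + cmod (bil n A (Suc t + k) c u) / cmod z ^ k"
      using Suc.IH[of "Suc t"] by (simp only: diff_Suc_1)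
    have "cmod (bil n A (Suc t) c u)
      \<le> (B * \<tau> ^ (t - 1) / cmod z) * (cmod z / 2) * (2 - 2 / 2 ^ k) + cmod (bil n A (Suc t + k) c u) / cmod z ^ k"
      by (rule order_trans[OF IH add_right_mono[OF h]])
    hence "cmod (bil n A (Suc t) c u) / cmod z
      \<le> ((B * \<tau> ^ (t - 1) / cmod z) * (cmod z / 2) * (2 - 2 / 2 ^ k) + cmod (bil n A (Suc t + k) c u) / cmod z ^ k) / cmod z"
      using z by (intro divide_right_mono) auto
    also have "\<dots> = (B * \<tau> ^ (t - 1) / cmod z) * (1 - 1 / 2 ^ k) + cmod (bil n A (t + Suc k) c u) / cmod z ^ Suc k"
      using z by (simp add: field_simps)
    finally have "cmod (bil n A t c u) \<le> B * \<tau> ^ (t - 1) / cmod z +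
       ((B * \<tau> ^ (t - 1) / cmod z) * (1 - 1 / 2 ^ k) + cmod (bil n A (t + Suc k) c u) / cmod z ^ Suc k)"
      using step[OF Suc.prems] by linarith
    also have "\<dots> = B * \<tau> ^ (t - 1) / cmod z * (2 - 2 / 2 ^ Suc k) + cmod (bil n A (t + Suc k) c u) / cmod z ^ Suc k"
    proof -
      have "(2::real) - 2 / 2 ^ Suc k = 1 + (1 - 1 / 2 ^ k)" by simp
      thus ?thesis by (simp only: distrib_left mult_1_right add.assoc)
    qed
    finally show ?case .
  qed simp
  \<comment> \<open>\<open>W\<close> may depend on \<open>u\<close>, \<open>c\<close> and
    \<open>n\<close>; it only has to be independent of k, since the remainder is sent to 0.\<close>
  define W where "W = (\<Sum>i<n. \<Sum>j<n. cmod (c i) * cmod (u j)) * \<tau> ^ t"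
  have W0: "0 \<le> W" unfolding W_def using \<tau> by (intro mult_nonneg_nonneg sum_nonneg) auto
  have rem: "cmod (bil n A (t + k) c u) / cmod z ^ k \<le> W * (1 / 2) ^ k" if "S \<le> k" for k
  proof -
    have "cmod (bil n A (t + k) c u) \<le> (\<Sum>i<n. \<Sum>j<n. cmod (c i) * cmod (u j) * \<tau> ^ (t + k))"
      unfolding bil_def
      by (intro order_trans[OF norm_sum] sum_mono) (use tail that in \<open>auto simp: norm_mult intro!: mult_left_mono\<close>)
    also have "\<dots> = W * \<tau> ^ k" by (simp add: W_def sum_distrib_right power_add mult.assoc)
    finally have "cmod (bil n A (t + k) c u) / cmod z ^ k \<le> W * \<tau> ^ k / cmod z ^ k"
      using z by (intro divide_right_mono) auto
    also have "\<dots> = W * (\<tau> / cmod z) ^ k" by (simp add: power_divide)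
    also have "\<dots> \<le> W * (1 / 2) ^ k"
      using \<tau> z W0 by (intro mult_left_mono power_mono) (auto simp: field_simps)
    finally show ?thesis .
  qed
  have lim: "(\<lambda>k. 2 * B * \<tau> ^ (t - 1) / cmod z + W * (1 / 2) ^ k) \<longlonglongrightarrow> 2 * B * \<tau> ^ (t - 1) / cmod z + W * 0"
    by (intro tendsto_intros LIMSEQ_realpow_zero) auto
  have "cmod (bil n A t c u) \<le> 2 * B * \<tau> ^ (t - 1) / cmod z + W * 0"
  proof (rule LIMSEQ_le_const[OF lim], intro exI[of _ S] allI impI)
    fix k assume k: "S \<le> k"
    have "B * \<tau> ^ (t - 1) / cmod z * (2 - 2 / 2 ^ k) \<le> B * \<tau> ^ (t - 1) / cmod z * 2"
      using B \<tau> z by (intro mult_left_mono) auto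
    thus "cmod (bil n A t c u) \<le> 2 * B * \<tau> ^ (t - 1) / cmod z + W * (1 / 2) ^ k"
      using iter[OF t, of k] rem[OF k] by simp
  qed
  thus ?thesis by simp
qed

text \<open>What the deterministic part of the argument has to know about the noise
  \<open>A\<close>. The quantitative bounds are in \<open>noise\<close>; \<open>tail\<close> makes
  Neumann remainders vanish, and no size of \<open>S\<close> enters the conclusions.\<close>

locale spiked =
  fixes n r :: nat and A :: "nat \<Rightarrow> nat \<Rightarrow> complex" and U :: "nat \<Rightarrow> nat \<Rightarrow> complex"
    and d :: "nat \<Rightarrow> complex" and \<tau> \<epsilon> :: real and S :: nat
  assumes orth: "k < r \<Longrightarrow> l < r \<Longrightarrow> dot n (U k) (U l) = of_bool (k = l)"
    and \<tau>: "0 < \<tau>"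
    and tail: "S \<le> s \<Longrightarrow> i < n \<Longrightarrow> j < n \<Longrightarrow> cmod (mpow n A s i j) \<le> \<tau> ^ s"
    and noise: "1 \<le> s \<Longrightarrow> k < r \<Longrightarrow> l < r \<Longrightarrow> cmod (bil n A s (U k) (U l)) \<le> \<epsilon> * \<tau> ^ (s - 1)"
begin

text \<open>Makes results on right eigenvectors available for left eigenvectors.\<close>

lemma transposed: "spiked n r (\<lambda>i j. A j i) U \<tau> \<epsilon> S"
proof
  show "cmod (mpow n (\<lambda>i j. A j i) s i j) \<le> \<tau> ^ s" if "S \<le> s" "i < n" "j < n" for s i j
    unfolding mpow_transpose[of i n j A s, OF that(2,3)] using that by (intro tail)
  show "cmod (bil n (\<lambda>i j. A j i) s (U k) (U l)) \<le> \<epsilon> * \<tau> ^ (s - 1)" if "1 \<le> s" "k < r" "l < r" for s k l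
    unfolding bil_transpose[of n A] using that by (intro noise)
qed (fact orth \<tau>)+

text \<open>Covers the whole deformation of the noise to 0: powers of t in [0, 1] can only improve
  the bounds.\<close>

lemma scaled:
  assumes t: "0 \<le> t" "t \<le> 1"
  shows "spiked n r (\<lambda>i j. complex_of_real t * A i j) U \<tau> \<epsilon> S"
proof
  have p: "t ^ s \<le> 1" for s using t by (simp add: power_le_one)
  show "cmod (mpow n (\<lambda>i j. complex_of_real t * A i j) s i j) \<le> \<tau> ^ s" if "S \<le> s" "i < n" "j < n" for s i j
    using mult_mono[OF p[of s] tail[OF that]] t by (simp add: mpow_scale norm_mult norm_power)
  show "cmod (bil n (\<lambda>i j. complex_of_real t * A i j) s (U k) (U l)) \<le> \<epsilon> * \<tau> ^ (s - 1)" if "1 \<le> s" "k < r" "l < r" for s k l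
    using mult_mono[OF p[of s] noise[OF that]] t by (simp add: bil_scale norm_mult norm_power)
qed (fact orth \<tau>)+

definition eigenpair :: "complex \<Rightarrow> (nat \<Rightarrow> complex) \<Rightarrow> bool" where
  "eigenpair z u \<longleftrightarrow> (\<exists>i<n. u i \<noteq> 0) \<and>
    (\<forall>i<n. z * u i = (\<Sum>j<n. A i j * u j) + (\<Sum>k<r. d k * dot n (U k) u * U k i))"

text \<open>Total size of the coefficients of the low-rank part of M u with respect to the
  \<open>U k\<close>. That part is the inhomogeneity in the Neumann series, so errors are first
  expressed through it.\<close>

abbreviation mass :: "(nat \<Rightarrow> complex) \<Rightarrow> real" where
  "mass u \<equiv> (\<Sum>k<r. cmod (d k) * cmod (dot n (U k) u))"

context
  fixes z u
  assumes eig: "eigenpair z u" and z: "2 * \<tau> \<le> cmod z"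
begin

lemma z_pos: "0 < cmod z" using \<tau> z by linarith

lemma bil_eigenvector_bound:
  assumes c: "\<And>s k. 1 \<le> s \<Longrightarrow> k < r \<Longrightarrow> cmod (bil n A s c (U k)) \<le> B * \<tau> ^ (s - 1)" and t: "1 \<le> t"
  shows "cmod (bil n A t c u) \<le> 2 * (B * mass u) * \<tau> ^ (t - 1) / cmod z"
proof (rule neumann_bound[where f = "\<lambda>i. \<Sum>k<r. d k * dot n (U k) u * U k i" and S = S])
  fix t :: nat assume t: "1 \<le> t"
  have "cmod (bil n A t c (\<lambda>i. \<Sum>k<r. d k * dot n (U k) u * U k i))
      \<le> (\<Sum>k<r. cmod (d k) * cmod (dot n (U k) u) * (B * \<tau> ^ (t - 1)))"
    unfolding bil_sum
    by (rule order_trans[OF norm_sum] sum_mono)+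
       (use c[OF t] in \<open>auto simp: norm_mult intro!: mult_left_mono\<close>)
  also have "\<dots> = B * mass u * \<tau> ^ (t - 1)" by (simp add: sum_distrib_left sum_distrib_right mult_ac)
  finally show "cmod (bil n A t c (\<lambda>i. \<Sum>k<r. d k * dot n (U k) u * U k i)) \<le> B * mass u * \<tau> ^ (t - 1)" .
qed (use eig z t tail \<tau> in \<open>auto simp: eigenpair_def\<close>)

lemma dot_eigenvector:
  "z * dot n c u = (\<Sum>k<r. d k * dot n (U k) u * dot n c (U k)) + bil n A 1 c u"
proof -
  have "z * dot n c u = bil n A 0 c (\<lambda>i. z * u i)" by (simp only: bil_0 bil_mult)
  also have "\<dots> = bil n A 0 c (\<lambda>i. (\<Sum>j<n. A i j * u j) + (\<Sum>k<r. d k * dot n (U k) u * U k i))"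
    by (rule bil_cong) (use eig in \<open>auto simp: eigenpair_def\<close>)
  also have "\<dots> = bil n A 1 c u + (\<Sum>k<r. d k * dot n (U k) u * dot n c (U k))"
    by (simp add: bil_add bil_sum bil_Suc bil_0)
  finally show ?thesis by simp
qed

text \<open>By orthonormality, projecting the eigenvalue equation on \<open>U k\<close> cancels all
  other coordinates and leaves only the noise term on the right.\<close>

lemma coordinate_bound:
  assumes k: "k < r"
  shows "cmod (z - d k) * cmod (dot n (U k) u) \<le> 2 * \<epsilon> * mass u / cmod z"
proof -
  have "(\<Sum>l<r. d l * dot n (U l) u * dot n (U k) (U l)) = (\<Sum>l<r. if l = k then d l * dot n (U l) u else 0)"
    by (rule sum.cong) (auto simp: orth k)
  also have "\<dots> = d k * dot n (U k) u" using k by simp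
  finally have "(z - d k) * dot n (U k) u = bil n A 1 (U k) u"
    using dot_eigenvector[of "U k"] by (simp add: algebra_simps)
  moreover have "cmod (bil n A 1 (U k) u) \<le> 2 * (\<epsilon> * mass u) * \<tau> ^ (1 - 1) / cmod z"
    by (rule bil_eigenvector_bound) (use noise k in auto)
  ultimately show ?thesis by (simp flip: norm_mult)
qed

text \<open>Otherwise \<open>u\<close> would be an eigenvector of the noise alone with an eigenvalue
  of modulus at least 2 \<tau>, and the Neumann bound with zero inhomogeneity forces each of its
  entries to vanish.\<close>

lemma exists_coordinate: "\<exists>k<r. dot n (U k) u \<noteq> 0"
proof (rule ccontr)
  assume "\<not> ?thesis"
  hence 0: "dot n (U k) u = 0" if "k < r" for k using that by blast
  obtain i where i: "i < n" "u i \<noteq> 0" using eig by (auto simp: eigenpair_def)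
  define c :: "nat \<Rightarrow> complex" where "c j = of_bool (j = i)" for j
  have "cmod (bil n A 1 c u) \<le> 2 * 0 * \<tau> ^ (1 - 1) / cmod z"
  proof (rule neumann_bound[where f = "\<lambda>_. 0" and S = S])
    show "z * u i = (\<Sum>j<n. A i j * u j) + 0" if "i < n" for i
      using eig that by (simp add: eigenpair_def 0)
  qed (use z tail \<tau> in \<open>auto simp: bil_def\<close>)
  hence "z * dot n c u = 0" unfolding dot_eigenvector by (simp add: 0)
  moreover have "dot n c u = u i" using i
    by (simp add: dot_def c_def of_bool_def if_distrib[of "\<lambda>x. x * _"] cong: if_cong)
  ultimately show False using i z_pos by simp
qed

text \<open>Take the largest coordinate of \<open>u\<close>. It bounds \<open>mass u\<close> up to
  the factor r D, so it cancels from \<open>coordinate_bound\<close>.\<close>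

lemma eigenvalue_near:
  assumes D: "\<And>k. k < r \<Longrightarrow> cmod (d k) \<le> D"
  shows "\<exists>k<r. cmod (z - d k) \<le> 2 * \<epsilon> * (real r * D) / cmod z"
proof -
  obtain k1 where k1: "k1 < r" "dot n (U k1) u \<noteq> 0" using exists_coordinate by blast
  define Mx where "Mx = Max ((\<lambda>k. cmod (dot n (U k) u)) ` {..<r})"
  have "Mx \<in> (\<lambda>k. cmod (dot n (U k) u)) ` {..<r}" unfolding Mx_def using k1 by (intro Max_in) auto
  then obtain k where k: "k < r" "Mx = cmod (dot n (U k) u)" by auto
  have le: "cmod (dot n (U l) u) \<le> Mx" if "l < r" for l unfolding Mx_def using that by auto
  have pos: "0 < Mx" using le[OF k1(1)] k1(2) by (meson less_le_trans zero_less_norm_iff)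
  have "mass u \<le> (\<Sum>l<r. D * Mx)"
    using D le by (intro sum_mono mult_mono) (auto intro: order_trans[OF norm_ge_zero D])
  hence m: "mass u \<le> real r * D * Mx" by simp
  have \<epsilon>0: "0 \<le> \<epsilon>" using order_trans[OF norm_ge_zero noise[of 1 k k]] k by simp
  have "cmod (z - d k) * Mx \<le> 2 * \<epsilon> * mass u / cmod z" using coordinate_bound[OF k(1)] k by simp
  also have "\<dots> \<le> 2 * \<epsilon> * (real r * D * Mx) / cmod z"
    using m \<epsilon>0 z_pos by (intro divide_right_mono mult_left_mono) auto
  finally have "cmod (z - d k) * Mx \<le> (2 * \<epsilon> * (real r * D) / cmod z) * Mx" by simp
  hence "cmod (z - d k) \<le> 2 * \<epsilon> * (real r * D) / cmod z" using pos by (rule mult_right_le_imp_le)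
  thus ?thesis using k(1) by blast
qed

end
end

text \<open>The geometric mean of two numbers within b of |\<alpha>| is itself within b of
  |\<alpha>|; dividing by the square root of |\<zeta>|, which is at least 1/2, costs a relative
  error e and doubles b.\<close>

lemma abs_sqrt_diff_le:
  fixes \<alpha> D1 D2 \<zeta> :: complex
  assumes D: "cmod D1 \<le> b" "cmod D2 \<le> b" and \<zeta>: "cmod (\<zeta> - 1) \<le> e" "e \<le> 1 / 2"
  shows "\<bar>sqrt (cmod ((\<alpha> + D1) * (\<alpha> + D2) / \<zeta>)) - cmod \<alpha>\<bar> \<le> 2 * b + cmod \<alpha> * e"
proof -
  have b: "0 \<le> b" using order_trans[OF norm_ge_zero D(1)] .
  have e: "0 \<le> e" using order_trans[OF norm_ge_zero \<zeta>(1)] .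
  have dist1: "\<bar>cmod (\<alpha> + D1) - cmod \<alpha>\<bar> \<le> b" using norm_triangle_ineq3[of "\<alpha> + D1" \<alpha>] D by simp
  have dist2: "\<bar>cmod (\<alpha> + D2) - cmod \<alpha>\<bar> \<le> b" using norm_triangle_ineq3[of "\<alpha> + D2" \<alpha>] D by simp
  define p where "p = sqrt (cmod (\<alpha> + D1) * cmod (\<alpha> + D2))"
  have p0: "0 \<le> p" by (simp add: p_def)
  have "cmod (\<alpha> + D1) * cmod (\<alpha> + D2) \<le> (cmod \<alpha> + b) * (cmod \<alpha> + b)"
    using dist1 dist2 b by (intro mult_mono) auto
  hence p1: "p \<le> cmod \<alpha> + b" unfolding p_def using b by (intro real_le_lsqrt) (auto simp: power2_eq_square)
  have p2: "cmod \<alpha> - b \<le> p"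
  proof (cases "cmod \<alpha> \<le> b")
    case True
    then show ?thesis using p0 by linarith
  next
    case False
    have "(cmod \<alpha> - b) * (cmod \<alpha> - b) \<le> cmod (\<alpha> + D1) * cmod (\<alpha> + D2)"
      using dist1 dist2 b False by (intro mult_mono) auto
    then show ?thesis unfolding p_def by (intro real_le_rsqrt) (auto simp: power2_eq_square)
  qed
  define t where "t = sqrt (cmod \<zeta>)"
  have t2: "t\<^sup>2 = cmod \<zeta>" by (simp add: t_def)
  have \<zeta>1: "\<bar>cmod \<zeta> - 1\<bar> \<le> e" using norm_triangle_ineq3[of \<zeta> 1] \<zeta> by simp
  have tge: "1 / 2 \<le> t"
    unfolding t_def using \<zeta>1 \<zeta>(2) by (intro real_le_rsqrt) (auto simp: power2_eq_square)
  have "\<bar>t - 1\<bar> * (t + 1) = \<bar>t\<^sup>2 - 1\<bar>"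
  proof -
    have "t\<^sup>2 - 1 = (t - 1) * (t + 1)" by (simp add: power2_eq_square algebra_simps)
    thus ?thesis using tge by (simp add: abs_mult)
  qed
  hence te: "\<bar>t - 1\<bar> * (t + 1) \<le> e" using \<zeta>1 t2 by simp
  \<comment> \<open>Hence dividing |t - 1| by t gives at most |t - 1| (t + 1) = |t^2 - 1|, which
    avoids losing a constant in front of e.\<close>
  have tt: "1 \<le> t * (t + 1)"
  proof -
    have "1 / 2 + 1 / 2 \<le> t\<^sup>2 + t" using \<zeta>1 \<zeta>(2) t2 tge by linarith
    thus ?thesis by (simp add: power2_eq_square algebra_simps)
  qed
  have inv: "\<bar>1 / t - 1\<bar> \<le> e"
  proof -
    have "\<bar>1 / t - 1\<bar> = \<bar>t - 1\<bar> / t" using tge by (simp add: field_simps abs_if)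
    also have "\<dots> \<le> \<bar>t - 1\<bar> * (t + 1)"
      using tge tt mult_left_mono[OF tt, of "\<bar>t - 1\<bar>"] by (simp add: field_simps)
    finally show ?thesis using te by simp
  qed
  have "sqrt (cmod ((\<alpha> + D1) * (\<alpha> + D2) / \<zeta>)) = p * (1 / t)"
    by (simp add: p_def t_def norm_mult norm_divide real_sqrt_divide)
  also have "p * (1 / t) - cmod \<alpha> = (p - cmod \<alpha>) * (1 / t) + cmod \<alpha> * (1 / t - 1)"
    by (simp add: algebra_simps)
  also have "\<bar>\<dots>\<bar> \<le> \<bar>p - cmod \<alpha>\<bar> * \<bar>1 / t\<bar> + cmod \<alpha> * \<bar>1 / t - 1\<bar>"
    by (rule order_trans[OF abs_triangle_ineq]) (simp add: abs_mult)
  also have "\<dots> \<le> b * 2 + cmod \<alpha> * e"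
    using p1 p2 tge inv b by (intro add_mono mult_mono) (auto simp: field_simps)
  finally show ?thesis by simp
qed

section \<open>Expansion around one isolated eigenvalue of the low-rank part\<close>

context spiked
begin

context
  fixes m K \<eta> :: real and l :: nat
  assumes m: "0 < m" "4 * \<tau> \<le> m" and dm: "\<And>k. k < r \<Longrightarrow> m \<le> cmod (d k)" and dK: "\<And>k. k < r \<Longrightarrow> cmod (d k) \<le> K * m"
    and \<eta>: "\<eta> = 8 * real r * K * \<epsilon>" "2 * \<eta> \<le> m" and l: "l < r"
    and gap: "\<And>k. k < r \<Longrightarrow> k \<noteq> l \<Longrightarrow> 2 * \<eta> \<le> cmod (d l - d k) \<and> 0 < cmod (d l - d k)"
begin

lemma K_ge_1: "1 \<le> K"
proof -
  have "1 * m \<le> K * m" using dm[OF l] dK[OF l] by simp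
  thus ?thesis using m by (simp only: mult_le_cancel_right_pos)
qed

lemma eps_nonneg: "0 \<le> \<epsilon>"
  using order_trans[OF norm_ge_zero noise[of 1 l l]] l by simp

lemma eta_nonneg: "0 \<le> \<eta>"
  using eps_nonneg K_ge_1 by (simp add: \<eta>)

context
  fixes z u
  assumes eig: "eigenpair z u" and near: "cmod (z - d l) \<le> \<eta>"
begin

lemma z_large: "m / 2 \<le> cmod z" "2 * \<tau> \<le> cmod z"
proof -
  have "cmod (d l) - cmod z \<le> cmod (z - d l)"
    using norm_triangle_ineq2[of "d l" z] by (simp add: norm_minus_commute)
  thus "m / 2 \<le> cmod z" using near dm[OF l] \<eta> by linarith
  thus "2 * \<tau> \<le> cmod z" using m by linarith
qed

text \<open>For k other than l, z keeps at least half the gap away from \<open>d k\<close>, so that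
  coordinate is at most \<eta> / gap, hence at most half, of the largest one. The largest coordinate
  therefore belongs to l.\<close>

lemma other_coordinates:
  shows "dot n (U l) u \<noteq> 0"
    and "k < r \<Longrightarrow> k \<noteq> l \<Longrightarrow> cmod (dot n (U k) u) \<le> \<eta> / cmod (d l - d k) * cmod (dot n (U l) u)"
    and "mass u \<le> real r * (K * m) * cmod (dot n (U l) u)"
proof -
  let ?x = "\<lambda>k. cmod (dot n (U k) u)"
  obtain k1 where k1: "k1 < r" "dot n (U k1) u \<noteq> 0" using exists_coordinate[OF eig z_large(2)] by blast
  define Mx where "Mx = Max (?x ` {..<r})"
  have "Mx \<in> ?x ` {..<r}" unfolding Mx_def using k1 by (intro Max_in) auto
  then obtain k0 where k0: "k0 < r" "Mx = ?x k0" by auto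
  have le: "?x k \<le> Mx" if "k < r" for k unfolding Mx_def using that by auto
  have pos: "0 < Mx" using le[OF k1(1)] k1(2) by (meson less_le_trans zero_less_norm_iff)
  have "mass u \<le> (\<Sum>k<r. K * m * Mx)"
    using dK le K_ge_1 m by (intro sum_mono mult_mono) auto
  hence mass: "mass u \<le> real r * (K * m) * Mx" by simp
  have z0: "0 < cmod z" using z_large m by linarith
  have bound: "?x k \<le> \<eta> / cmod (d l - d k) * Mx" if k: "k < r" "k \<noteq> l" for k
  proof -
    define g where "g = cmod (d l - d k)"
    have g: "2 * \<eta> \<le> g" "0 < g" using gap[OF k] by (auto simp: g_def)
    have "g \<le> cmod (z - d k) + cmod (z - d l)"
      unfolding g_def using norm_triangle_ineq4[of "z - d k" "z - d l"] by simp
    hence "g / 2 \<le> cmod (z - d k)" using near g by linarith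
    hence "g / 2 * ?x k \<le> cmod (z - d k) * ?x k" by (rule mult_right_mono) simp
    also have "\<dots> \<le> 2 * \<epsilon> * mass u / cmod z" by (rule coordinate_bound[OF eig z_large(2) k(1)])
    \<comment> \<open>Origin of the 8 in \<eta>: a factor 2 from the Neumann series, 2 from |z| >= m
      / 2, and 2 from the halved gap.\<close>
    also have "\<dots> \<le> 2 * \<epsilon> * (real r * (K * m) * Mx) / (m / 2)"
      using mass eps_nonneg z_large(1) m z0 K_ge_1 pos
      by (intro frac_le mult_left_mono mult_nonneg_nonneg) auto
    also have "\<dots> = \<eta> / 2 * Mx" using m by (simp add: \<eta> field_simps)
    finally show ?thesis using g by (simp add: g_def[symmetric] field_simps)
  qed
  have "k0 = l"
  proof (rule ccontr)
    assume "k0 \<noteq> l"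
    have "\<eta> / cmod (d l - d k0) \<le> 1 / 2" using gap[OF k0(1) \<open>k0 \<noteq> l\<close>] by (simp add: field_simps)
    hence "\<eta> / cmod (d l - d k0) * Mx \<le> 1 / 2 * Mx" using pos by (intro mult_right_mono) auto
    thus False using bound[OF k0(1) \<open>k0 \<noteq> l\<close>] k0(2) pos by linarith
  qed
  hence Ml: "Mx = ?x l" using k0 by simp
  show "dot n (U l) u \<noteq> 0" using pos Ml by auto
  show "k < r \<Longrightarrow> k \<noteq> l \<Longrightarrow> ?x k \<le> \<eta> / cmod (d l - d k) * ?x l" using bound Ml by simp
  show "mass u \<le> real r * (K * m) * ?x l" using mass Ml by simp
qed

lemma sum_other_coordinates:
  assumes c: "\<And>k. k < r \<Longrightarrow> k \<noteq> l \<Longrightarrow> \<eta> / cmod (d l - d k) * c k \<le> b" "\<And>k. 0 \<le> c k" "0 \<le> b"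
  shows "(\<Sum>k\<in>{..<r} - {l}. cmod (d k) * cmod (dot n (U k) u) * c k)
    \<le> real r * (K * b) * (cmod (d l) * cmod (dot n (U l) u))"
proof -
  let ?x = "\<lambda>k. cmod (dot n (U k) u)"
  have "(\<Sum>k\<in>{..<r} - {l}. cmod (d k) * ?x k * c k) \<le> (\<Sum>k\<in>{..<r} - {l}. K * b * (cmod (d l) * ?x l))"
  proof (rule sum_mono)
    fix k assume "k \<in> {..<r} - {l}"
    hence k: "k < r" "k \<noteq> l" by auto
    have "cmod (d k) \<le> K * cmod (d l)"
      using dK[OF k(1)] mult_left_mono[OF dm[OF l], of K] K_ge_1 by linarith
    moreover have "?x k * c k \<le> b * ?x l"
    proof -
      have "?x k * c k \<le> \<eta> / cmod (d l - d k) * ?x l * c k"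
        using other_coordinates(2)[OF k] c(2) by (rule mult_right_mono)
      also have "\<dots> = \<eta> / cmod (d l - d k) * c k * ?x l" by (simp add: mult_ac)
      also have "\<dots> \<le> b * ?x l" using c(1)[OF k] by (rule mult_right_mono) simp
      finally show ?thesis .
    qed
    ultimately have "cmod (d k) * (?x k * c k) \<le> (K * cmod (d l)) * (b * ?x l)"
      by (rule mult_mono) (use c(2) K_ge_1 in simp_all)
    thus "cmod (d k) * ?x k * c k \<le> K * b * (cmod (d l) * ?x l)" by (simp add: mult_ac)
  qed
  also have "\<dots> = real (card ({..<r} - {l})) * (K * b * (cmod (d l) * ?x l))" by simp
  also have "\<dots> \<le> real r * (K * b * (cmod (d l) * ?x l))"
    using l c K_ge_1 by (intro mult_right_mono) auto
  finally show ?thesis by (simp add: mult_ac)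
qed

text \<open>The contribution of \<open>U l\<close> is factored out and the rest is measured relative
  to it: \<open>b1\<close> covers the other eigenvectors, \<open>b2\<close> the noise. The vector
  \<open>a\<close> may depend on the noise; later it is also the left eigenvector.\<close>

lemma dot_expansion:
  assumes a: "\<And>k. k < r \<Longrightarrow> k \<noteq> l \<Longrightarrow> \<eta> / cmod (d l - d k) * cmod (dot n a (U k)) \<le> b1" "0 \<le> b1"
    and b2: "cmod (bil n A 1 a u) \<le> b2 * (cmod (d l) * cmod (dot n (U l) u))"
  obtains D where "z * dot n a u = d l * dot n (U l) u * (dot n a (U l) + D)"
    "cmod D \<le> real r * (K * b1) + b2"
proof -
  define e where "e = (\<Sum>k\<in>{..<r} - {l}. d k * dot n (U k) u * dot n a (U k)) + bil n A 1 a u"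
  have nz: "d l * dot n (U l) u \<noteq> 0" using other_coordinates(1) dm[OF l] m by auto
  have "z * dot n a u = d l * dot n (U l) u * dot n a (U l) + e"
    unfolding dot_eigenvector[OF eig z_large(2)] e_def
    by (subst sum.remove[of _ l]) (use l in auto)
  also have "\<dots> = d l * dot n (U l) u * (dot n a (U l) + e / (d l * dot n (U l) u))"
    using nz by (simp add: field_simps)
  finally have 1: "z * dot n a u = d l * dot n (U l) u * (dot n a (U l) + e / (d l * dot n (U l) u))" .
  have "cmod e \<le> (\<Sum>k\<in>{..<r} - {l}. cmod (d k) * cmod (dot n (U k) u) * cmod (dot n a (U k))) + cmod (bil n A 1 a u)"
    unfolding e_def
    by (rule order_trans[OF norm_triangle_ineq add_right_mono[OF order_trans[OF norm_sum]]]) (simp add: norm_mult)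
  also have "\<dots> \<le> real r * (K * b1) * (cmod (d l) * cmod (dot n (U l) u)) + b2 * (cmod (d l) * cmod (dot n (U l) u))"
    by (intro add_mono sum_other_coordinates b2 a) auto
  finally have "cmod (e / (d l * dot n (U l) u)) \<le> real r * (K * b1) + b2"
    using nz by (simp add: norm_divide norm_mult divide_le_eq distrib_right)
  with 1 show thesis by (rule that)
qed

text \<open>The noise term contributes \<eta> / m and the other coordinates \<eta> M; the first is
  absorbed using \<open>1 \<le> real r * K\<close>.\<close>

lemma functional_estimate:
  assumes a: "\<And>s k. 1 \<le> s \<Longrightarrow> k < r \<Longrightarrow> cmod (bil n A s a (U k)) \<le> \<epsilon> * \<tau> ^ (s - 1)"
    and M: "\<And>k. k < r \<Longrightarrow> k \<noteq> l \<Longrightarrow> cmod (dot n a (U k)) / cmod (d l - d k) \<le> M" "0 \<le> M"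
  obtains D where "z * dot n a u = d l * dot n (U l) u * (dot n a (U l) + D)"
    "cmod D \<le> real r * K * \<eta> * (1 / m + M)"
proof -
  let ?x = "cmod (dot n (U l) u)"
  have z0: "0 < cmod z" using z_large m by linarith
  have "cmod (bil n A 1 a u) \<le> 2 * (\<epsilon> * mass u) * \<tau> ^ (1 - 1) / cmod z"
    by (rule bil_eigenvector_bound[OF eig z_large(2)]) (use a in auto)
  also have "\<dots> \<le> 2 * (\<epsilon> * (real r * (K * m) * ?x)) / (m / 2)"
    using other_coordinates(3) eps_nonneg z_large(1) m z0 K_ge_1
    by (simp only: diff_self_eq_0 power_0 mult_1_right) (intro frac_le mult_left_mono mult_nonneg_nonneg; simp)
  also have "\<dots> = \<eta> / 2 * ?x" using m by (simp add: \<eta>)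
  also have "\<dots> \<le> \<eta> / m * (cmod (d l) * ?x)"
  proof -
    have "\<eta> / 2 * ?x * m \<le> \<eta> * ?x * cmod (d l)"
      using eta_nonneg dm[OF l] m by (intro mult_mono) auto
    thus ?thesis using m by (simp add: field_simps)
  qed
  finally have b2: "cmod (bil n A 1 a u) \<le> \<eta> / m * (cmod (d l) * ?x)" .
  have b1: "\<eta> / cmod (d l - d k) * cmod (dot n a (U k)) \<le> \<eta> * M" if "k < r" "k \<noteq> l" for k
    using mult_left_mono[OF M(1)[OF that] eta_nonneg] by simp
  obtain D where D: "z * dot n a u = d l * dot n (U l) u * (dot n a (U l) + D)"
    "cmod D \<le> real r * (K * (\<eta> * M)) + \<eta> / m"
    using dot_expansion[OF b1 _ b2] eta_nonneg M(2) by auto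
  have "1 * (\<eta> / m) \<le> real r * K * (\<eta> / m)"
    using l K_ge_1 eta_nonneg m by (intro mult_right_mono) (auto intro: mult_ge1_I)
  hence "cmod D \<le> real r * K * \<eta> * (1 / m + M)"
    using D(2) by (simp add: algebra_simps)
  with D(1) show thesis by (rule that)
qed

end

text \<open>Since \<open>w\<close> depends on the noise, no bound on its bilinear forms is assumed.
  The Neumann bound is applied twice: to \<open>w\<close>, for the transposed noise, tested with
  \<open>U k\<close>, and then to \<open>u\<close>, tested with \<open>w\<close>. Both vectors have
  coordinates of relative size \<eta> / gap along the other \<open>U k\<close>, so gaps enter only
  squared, through \<open>q\<close>.\<close>

lemma overlap_estimate:
  assumes eu: "eigenpair z u" and near: "cmod (z - d l) \<le> \<eta>"
    and ew: "spiked.eigenpair n r (\<lambda>i j. A j i) U d z w"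
    and q: "\<And>k. k < r \<Longrightarrow> k \<noteq> l \<Longrightarrow> (\<eta> / cmod (d l - d k))\<^sup>2 \<le> q" "0 \<le> q"
  obtains e where "z * dot n w u = d l * dot n (U l) u * dot n (U l) w * (1 + e)"
    "cmod e \<le> real r * K * (q + 2 * \<eta> / m)"
proof -
  interpret T: spiked n r "\<lambda>i j. A j i" U d \<tau> \<epsilon> S by (rule transposed)
  note prem = m dm dK \<eta> l gap
  define x y where "x = cmod (dot n (U l) u)" and "y = cmod (dot n (U l) w)"
  have y0: "dot n (U l) w \<noteq> 0"
    by (rule T.other_coordinates(1)[where m = m and K = K and \<eta> = \<eta>, OF _ _ _ _ _ _ _ _ ew near]) (fact prem)+
  have yk: "cmod (dot n (U k) w) \<le> \<eta> / cmod (d l - d k) * y" if "k < r" "k \<noteq> l" for k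
    unfolding y_def
    by (rule T.other_coordinates(2)[where m = m and K = K and \<eta> = \<eta>, OF _ _ _ _ _ _ _ _ ew near that]) (fact prem)+
  have massw: "mass w \<le> real r * (K * m) * y"
    unfolding y_def
    by (rule T.other_coordinates(3)[where m = m and K = K and \<eta> = \<eta>, OF _ _ _ _ _ _ _ _ ew near]) (fact prem)+
  have massu: "mass u \<le> real r * (K * m) * x"
    unfolding x_def by (rule other_coordinates(3)[OF eu near])
  note z = z_large[OF eu near]
  have z0: "0 < cmod z" using z m by linarith
  have mass0: "0 \<le> mass v" for v by (intro sum_nonneg) auto
  have "cmod (bil n A s w (U k)) \<le> 2 * (\<epsilon> * mass w) / cmod z * \<tau> ^ (s - 1)" if "1 \<le> s" "k < r" for s k
    using T.bil_eigenvector_bound[OF ew z(2) T.noise[OF _ that(2)] that(1)] by (simp add: bil_transpose[of n A])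
  hence "cmod (bil n A 1 w u) \<le> 2 * (2 * (\<epsilon> * mass w) / cmod z * mass u) * \<tau> ^ (1 - 1) / cmod z"
    by (intro bil_eigenvector_bound[OF eu z(2)]) auto
  also have "\<dots> = 4 * \<epsilon> * (mass w * mass u) / (cmod z * cmod z)" by simp
  also have "\<dots> \<le> 4 * \<epsilon> * ((real r * (K * m) * y) * (real r * (K * m) * x)) / (m / 2 * (m / 2))"
    using massw massu eps_nonneg z m z0 K_ge_1 mass0
    by (intro frac_le mult_left_mono mult_mono mult_nonneg_nonneg) (auto simp: x_def y_def)
  also have "\<dots> = 2 * real r * K * \<eta> * y * x" using m by (simp add: \<eta> field_simps)
  also have "\<dots> \<le> (2 * real r * K * \<eta> / m * y) * (cmod (d l) * x)"
  proof -
    have "2 * real r * K * \<eta> * y * x * m \<le> 2 * real r * K * \<eta> * y * x * cmod (d l)"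
      using K_ge_1 eta_nonneg dm[OF l] by (intro mult_left_mono) (auto simp: x_def y_def)
    thus ?thesis using m by (simp add: field_simps)
  qed
  finally have b2: "cmod (bil n A 1 w u) \<le> (2 * real r * K * \<eta> / m * y) * (cmod (d l) * cmod (dot n (U l) u))"
    by (simp add: x_def)
  have sym: "dot n w (U k) = dot n (U k) w" for k by (simp add: dot_def mult.commute)
  have b1: "\<eta> / cmod (d l - d k) * cmod (dot n w (U k)) \<le> q * y" if k: "k < r" "k \<noteq> l" for k
  proof -
    have "\<eta> / cmod (d l - d k) * cmod (dot n w (U k)) \<le> \<eta> / cmod (d l - d k) * (\<eta> / cmod (d l - d k) * y)"
      unfolding sym using yk[OF k] eta_nonneg by (intro mult_left_mono) auto
    also have "\<dots> = (\<eta> / cmod (d l - d k))\<^sup>2 * y" by (simp add: power2_eq_square)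
    also have "\<dots> \<le> q * y" using q(1)[OF k] by (rule mult_right_mono) (simp add: y_def)
    finally show ?thesis .
  qed
  obtain D where D: "z * dot n w u = d l * dot n (U l) u * (dot n w (U l) + D)"
    "cmod D \<le> real r * (K * (q * y)) + 2 * real r * K * \<eta> / m * y"
    using dot_expansion[OF eu near b1 _ b2] q(2) by (auto simp: y_def)
  show thesis
  proof (rule that)
    show "z * dot n w u = d l * dot n (U l) u * dot n (U l) w * (1 + D / dot n (U l) w)"
      using D(1) y0 by (simp add: sym field_simps)
    have "cmod D \<le> (real r * K * (q + 2 * \<eta> / m)) * y"
      using D(2) by (simp add: algebra_simps)
    thus "cmod (D / dot n (U l) w) \<le> real r * K * (q + 2 * \<eta> / m)"
      using y0 by (simp add: norm_divide y_def divide_le_eq)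
  qed
qed

text \<open>The unknown coordinates of \<open>u\<close> and \<open>w\<close> along
  \<open>U l\<close> occur once in the numerator and once in the denominator, so they cancel; this
  is the reason for the form of the estimator.\<close>

lemma ratio_estimate:
  assumes eu: "eigenpair z u" and near: "cmod (z - d l) \<le> \<eta>"
    and ew: "spiked.eigenpair n r (\<lambda>i j. A j i) U d z w"
    and q: "\<And>k. k < r \<Longrightarrow> k \<noteq> l \<Longrightarrow> (\<eta> / cmod (d l - d k))\<^sup>2 \<le> q" "0 \<le> q"
    and a: "\<And>s k. 1 \<le> s \<Longrightarrow> k < r \<Longrightarrow> cmod (bil n A s a (U k)) \<le> \<epsilon> * \<tau> ^ (s - 1)"
      "\<And>s k. 1 \<le> s \<Longrightarrow> k < r \<Longrightarrow> cmod (bil n A s (U k) a) \<le> \<epsilon> * \<tau> ^ (s - 1)"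
    and M: "\<And>k. k < r \<Longrightarrow> k \<noteq> l \<Longrightarrow> cmod (dot n a (U k)) / cmod (d l - d k) \<le> M" "0 \<le> M"
    and e: "real r * K * (q + 4 * \<eta> / m) \<le> 1 / 2"
  shows "\<bar>sqrt (cmod (dot n a u * dot n a w / dot n w u)) - cmod (dot n a (U l))\<bar>
    \<le> 2 * (real r * K * \<eta> * (1 / m + M)) + cmod (dot n a (U l)) * (real r * K * (q + 4 * \<eta> / m))"
proof -
  interpret T: spiked n r "\<lambda>i j. A j i" U d \<tau> \<epsilon> S by (rule transposed)
  note prem = m dm dK \<eta> l gap
  let ?\<alpha> = "dot n a (U l)" and ?x = "dot n (U l) u" and ?y = "dot n (U l) w"
  obtain D1 where D1: "z * dot n a u = d l * ?x * (?\<alpha> + D1)" "cmod D1 \<le> real r * K * \<eta> * (1 / m + M)"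
    by (rule functional_estimate[OF eu near a(1) M])
  have aT: "cmod (bil n (\<lambda>i j. A j i) s a (U k)) \<le> \<epsilon> * \<tau> ^ (s - 1)" if "1 \<le> s" "k < r" for s k
    unfolding bil_transpose[of n A] by (rule a(2)[OF that])
  obtain D2 where D2: "z * dot n a w = d l * ?y * (?\<alpha> + D2)" "cmod D2 \<le> real r * K * \<eta> * (1 / m + M)"
    using T.functional_estimate[OF m dm dK \<eta> l gap ew near aT M] by blast
  obtain e1 where e1: "z * dot n w u = d l * ?x * ?y * (1 + e1)" "cmod e1 \<le> real r * K * (q + 2 * \<eta> / m)"
    by (rule overlap_estimate[OF eu near ew q])
  have x0: "?x \<noteq> 0" by (rule other_coordinates(1)[OF eu near])
  have y0: "?y \<noteq> 0"
    by (rule T.other_coordinates(1)[where m = m and K = K and \<eta> = \<eta>, OF _ _ _ _ _ _ _ _ ew near]) (fact prem)+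
  have dl0: "d l \<noteq> 0" using dm[OF l] m by auto
  have z0: "z \<noteq> 0" using z_large[OF eu near] m by auto
  \<comment> \<open>\<open>\<zeta>\<close> collects what remains of the denominator. In its distance
    from 1, the summand 4 \<eta> / m is made up of 2 \<eta> / m from z / d l and 2 \<eta> / m from
    \<open>e1\<close>.\<close>
  define \<zeta> where "\<zeta> = z / d l * (1 + e1)"
  have rK: "1 \<le> real r * K" using l K_ge_1 by (auto intro: mult_ge1_I)
  have "\<zeta> - 1 = (z - d l) / d l * (1 + e1) + e1" using dl0 by (simp add: \<zeta>_def field_simps)
  also have "cmod \<dots> \<le> cmod ((z - d l) / d l) * cmod (1 + e1) + cmod e1"
    by (rule order_trans[OF norm_triangle_ineq]) (simp only: norm_mult order_refl)
  also have "\<dots> \<le> \<eta> / m * 2 + real r * K * (q + 2 * \<eta> / m)"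
  proof (intro add_mono mult_mono e1)
    show "cmod ((z - d l) / d l) \<le> \<eta> / m"
      unfolding norm_divide using near dm[OF l] m eta_nonneg by (intro frac_le) auto
    have "real r * K * (q + 2 * \<eta> / m) \<le> real r * K * (q + 4 * \<eta> / m)"
      using rK eta_nonneg m by (intro mult_left_mono add_left_mono divide_right_mono) auto
    hence "cmod e1 \<le> 1" using e1(2) e by linarith
    thus "cmod (1 + e1) \<le> 2" using norm_triangle_ineq[of 1 e1] by simp
  qed (use eta_nonneg m in auto)
  also have "\<dots> \<le> real r * K * (q + 4 * \<eta> / m)"
  proof -
    define h where "h = \<eta> / m"
    have h: "2 * \<eta> / m = 2 * h" "4 * \<eta> / m = 4 * h" by (simp_all add: h_def)
    have "1 * (2 * h) \<le> real r * K * (2 * h)"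
      unfolding h_def using rK eta_nonneg m by (intro mult_right_mono) auto
    thus ?thesis unfolding h h_def[symmetric] by (simp add: algebra_simps)
  qed
  finally have \<zeta>: "cmod (\<zeta> - 1) \<le> real r * K * (q + 4 * \<eta> / m)" .
  have "dot n a u * dot n a w / dot n w u = (z * dot n a u) * (z * dot n a w) / (z * (z * dot n w u))"
    using z0 by simp
  also have "\<dots> = (d l * ?x * (?\<alpha> + D1)) * (d l * ?y * (?\<alpha> + D2)) / (z * (d l * ?x * ?y * (1 + e1)))"
    unfolding D1(1) D2(1) e1(1) ..
  also have "\<dots> = (?\<alpha> + D1) * (?\<alpha> + D2) / \<zeta>"
    using x0 y0 dl0 by (simp add: \<zeta>_def mult_ac)
  finally show ?thesis using abs_sqrt_diff_le[OF D1(2) D2(2) \<zeta> e] by simp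
qed

end
end

section \<open>Matching of eigenvalues and error of the estimator\<close>

definition entry :: "'a mat \<Rightarrow> nat \<Rightarrow> nat \<Rightarrow> 'a" where "entry A i j = A $$ (i, j)"

lemma low_rank_mat_carrier:
  assumes "low_rank_factors n r U lam"
  shows "low_rank_mat r U lam \<in> carrier_mat n n"
  using assms by (auto simp: low_rank_factors_def low_rank_mat_def)

lemma low_rank_mat_entry:
  assumes "low_rank_factors n r U lam" "i < n" "j < n"
  shows "low_rank_mat r U lam $$ (i, j) = (\<Sum>k<r. lam k * U $$ (j, k) * U $$ (i, k))"
proof -
  have U: "U \<in> carrier_mat n r" using assms by (simp add: low_rank_factors_def)
  show ?thesis
    unfolding low_rank_mat_def mat_diag_mult_right[OF U]
    using assms(2,3) U by (auto simp: scalar_prod_def lessThan_atLeast0 mult_ac intro!: sum.cong)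
qed

lemma columns_orthonormal:
  assumes "low_rank_factors n r U lam" "k < r" "l < r"
  shows "(\<Sum>i<n. U $$ (i, k) * U $$ (i, l)) = of_bool (k = l)"
proof -
  have U: "U \<in> carrier_mat n r" and o: "transpose_mat U * U = 1\<^sub>m r"
    using assms by (auto simp: low_rank_factors_def)
  have "(\<Sum>i<n. U $$ (i, k) * U $$ (i, l)) = (transpose_mat U * U) $$ (k, l)"
    using U assms(2,3) by (auto simp: scalar_prod_def lessThan_atLeast0 intro!: sum.cong)
  also have "\<dots> = of_bool (k = l)" unfolding o using assms by simp
  finally show ?thesis .
qed

lemma lam_min_le:
  assumes "low_rank_factors n r U lam" "k < r"
  shows "lam_min r lam \<le> \<bar>lam k\<bar>" "\<bar>lam k\<bar> \<le> cond_num r lam * lam_min r lam" "0 < lam_min r lam"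
proof -
  have mono: "\<And>i j. i \<le> j \<Longrightarrow> j < r \<Longrightarrow> \<bar>lam j\<bar> \<le> \<bar>lam i\<bar>" and pos: "0 < \<bar>lam (r - 1)\<bar>"
    using assms by (auto simp: low_rank_factors_def)
  show "lam_min r lam \<le> \<bar>lam k\<bar>" unfolding lam_min_def using assms(2) by (intro mono) auto
  show "\<bar>lam k\<bar> \<le> cond_num r lam * lam_min r lam"
    unfolding lam_min_def cond_num_def using mono[of 0 k] assms(2) pos by simp
  show "0 < lam_min r lam" unfolding lam_min_def by (rule pos)
qed

text \<open>Positions in the list are counted, not values, so a repeated eigenvalue is excluded as
  well.\<close>

lemma inj_from_filter:
  assumes "length (filter Q (map z [0..<r] @ zs)) \<le> 1" "i < r" "j < r" "Q (z i)" "Q (z j)"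
  shows "i = j"
proof (rule ccontr)
  assume "i \<noteq> j"
  let ?I = "{k. k < length (map z [0..<r] @ zs) \<and> Q ((map z [0..<r] @ zs) ! k)}"
  have "{i, j} \<subseteq> ?I" using assms by (auto simp: nth_append)
  hence "card {i, j} \<le> card ?I" by (intro card_mono) auto
  also have "card ?I = length (filter Q (map z [0..<r] @ zs))" by (rule length_filter_conv_card[symmetric])
  finally show False using assms(1) \<open>i \<noteq> j\<close> by simp
qed

text \<open>The sign can be chosen to match y with |y|, and truncation at 1 cannot move x away from
  |y|, which is at most 1.\<close>

lemma min_pm_le:
  assumes "0 \<le> x" "\<bar>y\<bar> \<le> 1"
  shows "min_pm (min x 1) y \<le> \<bar>x - \<bar>y\<bar>\<bar>"
  using assms by (auto simp: min_pm_def min_def abs_if split: if_splits)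

section \<open>Localisation and matching of the eigenvalues of the noisy matrix\<close>

context
  fixes n r :: nat and U :: "real mat" and lam :: "nat \<Rightarrow> real" and H :: "real mat"
    and \<tau> \<epsilon> K \<eta> :: real and S :: nat
  assumes lr: "low_rank_factors n r U lam" and H: "H \<in> carrier_mat n n"
    and \<tau>: "0 < \<tau>" "4 * \<tau> \<le> lam_min r lam" and K: "cond_num r lam \<le> K"
    and \<epsilon>: "0 < \<epsilon>" and \<eta>: "\<eta> = 8 * real r * K * \<epsilon>" "4 * \<eta> \<le> lam_min r lam"
    and gap: "\<And>i j. i < r \<Longrightarrow> j < r \<Longrightarrow> i \<noteq> j \<Longrightarrow> 4 * \<eta> \<le> \<bar>lam i - lam j\<bar>"
    and tail: "\<And>s i j. S \<le> s \<Longrightarrow> i < n \<Longrightarrow> j < n \<Longrightarrow> \<bar>mpow n (entry H) s i j\<bar> \<le> \<tau> ^ s"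
    and noise: "\<And>s k l. 1 \<le> s \<Longrightarrow> k < r \<Longrightarrow> l < r \<Longrightarrow>
      \<bar>bil n (entry H) s (\<lambda>i. U $$ (i, k)) (\<lambda>i. U $$ (i, l))\<bar> \<le> \<epsilon> * \<tau> ^ (s - 1)"
begin

definition noiseC :: "nat \<Rightarrow> nat \<Rightarrow> complex" where "noiseC i j = complex_of_real (entry H i j)"
definition factorC :: "nat \<Rightarrow> nat \<Rightarrow> complex" where "factorC k i = complex_of_real (U $$ (i, k))"
definition eigvalC :: "nat \<Rightarrow> complex" where "eigvalC k = complex_of_real (lam k)"

lemma K_pos: "1 \<le> K"
proof -
  have r: "0 < r" using lr by (simp add: low_rank_factors_def)
  have "1 * lam_min r lam \<le> cond_num r lam * lam_min r lam"
    using order_trans[OF lam_min_le(1)[OF lr r] lam_min_le(2)[OF lr r]] by (simp only: mult_1_left)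
  hence "1 \<le> cond_num r lam" using lam_min_le(3)[OF lr r] by (simp only: mult_le_cancel_right_pos)
  thus ?thesis using K by simp
qed

lemma eta_pos: "0 < \<eta>"
proof -
  have "0 < r" using lr by (simp add: low_rank_factors_def)
  thus ?thesis using K_pos \<epsilon> by (simp add: \<eta>(1))
qed

lemma eigval_bounds:
  assumes "k < r"
  shows "lam_min r lam \<le> cmod (eigvalC k)" "cmod (eigvalC k) \<le> K * lam_min r lam"
proof -
  show "lam_min r lam \<le> cmod (eigvalC k)" using lam_min_le[OF lr assms] by (simp add: eigvalC_def)
  have "cond_num r lam * lam_min r lam \<le> K * lam_min r lam"
    using K lam_min_le(3)[OF lr assms] by (intro mult_right_mono) auto
  thus "cmod (eigvalC k) \<le> K * lam_min r lam" using lam_min_le(2)[OF lr assms] by (simp add: eigvalC_def)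
qed

lemma eigval_gap: "i < r \<Longrightarrow> j < r \<Longrightarrow> i \<noteq> j \<Longrightarrow> 4 * \<eta> \<le> cmod (eigvalC i - eigvalC j)"
  using gap by (simp add: eigvalC_def flip: of_real_diff)

lemma spiked_noise: "spiked n r noiseC factorC \<tau> \<epsilon> S"
proof
  show "dot n (factorC k) (factorC l) = of_bool (k = l)" if "k < r" "l < r" for k l
  proof -
    have "dot n (factorC k) (factorC l) = complex_of_real (\<Sum>i<n. U $$ (i, k) * U $$ (i, l))"
      by (simp add: dot_def factorC_def)
    thus ?thesis by (simp add: columns_orthonormal[OF lr that])
  qed
  show "cmod (mpow n noiseC s i j) \<le> \<tau> ^ s" if "S \<le> s" "i < n" "j < n" for s i j
    using tail[OF that] unfolding noiseC_def mpow_of_real by simp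
  show "cmod (bil n noiseC s (factorC k) (factorC l)) \<le> \<epsilon> * \<tau> ^ (s - 1)" if "1 \<le> s" "k < r" "l < r" for s k l
    using noise[OF that] unfolding noiseC_def factorC_def bil_of_real by simp
qed (rule \<tau>)

lemma spiked_scaled:
  "0 \<le> t \<Longrightarrow> t \<le> 1 \<Longrightarrow> spiked n r (\<lambda>i j. complex_of_real t * noiseC i j) factorC \<tau> \<epsilon> S"
  by (rule spiked.scaled[OF spiked_noise])

lemma eigenvector_eigenpair:
  assumes sp: "spiked n r A factorC \<tau> \<epsilon> S" and M: "M \<in> carrier_mat n n"
    "\<And>i j. i < n \<Longrightarrow> j < n \<Longrightarrow> M $$ (i, j) = A i j + (\<Sum>k<r. eigvalC k * factorC k j * factorC k i)"
    and v: "eigenvector M v z"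
  shows "spiked.eigenpair n r A factorC eigvalC z (\<lambda>i. v $ i)"
proof -
  have v': "v \<in> carrier_vec n" "v \<noteq> 0\<^sub>v n" "M *\<^sub>v v = z \<cdot>\<^sub>v v"
    using v M(1) by (auto simp: eigenvector_def)
  have ne: "\<exists>i<n. v $ i \<noteq> 0"
  proof (rule ccontr)
    assume "\<not> ?thesis"
    hence "v = 0\<^sub>v n" using v'(1) by (intro eq_vecI) auto
    thus False using v'(2) by simp
  qed
  have "z * v $ i = (\<Sum>j<n. A i j * v $ j) + (\<Sum>k<r. eigvalC k * dot n (factorC k) (\<lambda>i. v $ i) * factorC k i)" if i: "i < n" for i
  proof -
    have "z * v $ i = (M *\<^sub>v v) $ i" using v' i by simp
    also have "\<dots> = (\<Sum>j<n. M $$ (i, j) * v $ j)"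
      using M(1) v'(1) i by (auto simp: scalar_prod_def lessThan_atLeast0 intro!: sum.cong)
    also have "\<dots> = (\<Sum>j<n. A i j * v $ j) + (\<Sum>j<n. \<Sum>k<r. eigvalC k * (factorC k j * v $ j) * factorC k i)"
    proof -
      have "M $$ (i, j) * v $ j = A i j * v $ j + (\<Sum>k<r. eigvalC k * (factorC k j * v $ j) * factorC k i)" if "j < n" for j
        by (simp add: M(2) i that distrib_right sum_distrib_right) (simp add: mult_ac)
      thus ?thesis by (simp add: sum.distrib)
    qed
    also have "(\<Sum>j<n. \<Sum>k<r. eigvalC k * (factorC k j * v $ j) * factorC k i) = (\<Sum>k<r. eigvalC k * dot n (factorC k) (\<lambda>i. v $ i) * factorC k i)"
      unfolding dot_def by (subst sum.swap) (simp add: sum_distrib_left sum_distrib_right)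
    finally show ?thesis .
  qed
  thus ?thesis using ne unfolding spiked.eigenpair_def[OF sp] by blast
qed

lemma spiked_matrix_entry:
  assumes "i < n" "j < n"
  shows "(map_mat complex_of_real (low_rank_mat r U lam) + t \<cdot>\<^sub>m map_mat complex_of_real H) $$ (i, j)
    = t * noiseC i j + (\<Sum>k<r. eigvalC k * factorC k j * factorC k i)"
  using assms low_rank_mat_carrier[OF lr] H
  by (simp add: low_rank_mat_entry[OF lr] noiseC_def factorC_def eigvalC_def entry_def)

text \<open>\<open>eigenvalue_near\<close> for the noise scaled by t. The radius \<eta> / 2, uniform
  in t, keeps eigenvalues off the circles of radius \<eta> used for counting.\<close>

lemma eigenvalue_localized:
  assumes t: "0 \<le> t" "t \<le> 1" and z: "lam_min r lam / 2 \<le> cmod z"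
    and ev: "eigenvalue (map_mat complex_of_real (low_rank_mat r U lam) + complex_of_real t \<cdot>\<^sub>m map_mat complex_of_real H) z"
  shows "\<exists>k<r. cmod (z - eigvalC k) \<le> \<eta> / 2"
proof -
  have r: "0 < r" using lr by (simp add: low_rank_factors_def)
  note m = lam_min_le(3)[OF lr r]
  interpret T: spiked n r "\<lambda>i j. complex_of_real t * noiseC i j" factorC eigvalC \<tau> \<epsilon> S by (rule spiked_scaled[OF t])
  obtain v where "eigenvector (map_mat complex_of_real (low_rank_mat r U lam) + complex_of_real t \<cdot>\<^sub>m map_mat complex_of_real H) v z"
    using ev by (auto simp: eigenvalue_def)
  hence e: "T.eigenpair z (\<lambda>i. v $ i)"
    by (rule eigenvector_eigenpair[OF T.spiked_axioms, rotated 2])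
       (use H low_rank_mat_carrier[OF lr] spiked_matrix_entry in auto)
  have "2 * \<tau> \<le> cmod z" using z \<tau> by linarith
  then obtain k where k: "k < r" "cmod (z - eigvalC k) \<le> 2 * \<epsilon> * (real r * (K * lam_min r lam)) / cmod z"
    using T.eigenvalue_near[OF e _ eigval_bounds(2)] by blast
  have "2 * \<epsilon> * (real r * (K * lam_min r lam)) / cmod z \<le> 2 * \<epsilon> * (real r * (K * lam_min r lam)) / (lam_min r lam / 2)"
    using z m \<epsilon> K_pos by (intro divide_left_mono mult_nonneg_nonneg mult_pos_pos) auto
  also have "\<dots> = \<eta> / 2" using m by (simp add: \<eta>)
  finally show ?thesis using k by force
qed

text \<open>At t = 0 the gap leaves only the k-th true eigenvalue in the disc, and no eigenvalue
  crosses its boundary during the deformation.\<close>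

lemma root_count_disc:
  assumes k: "k < r"
    and bs: "char_poly (map_mat complex_of_real (low_rank_mat r U lam + H)) = (\<Prod>x\<leftarrow>bs. [:- x, 1:])"
  shows "length (filter (\<lambda>x. cmod (x - eigvalC k) < \<eta>) bs) = 1"
proof -
  let ?A = "map_mat complex_of_real (U * mat_diag r lam)" and ?B = "map_mat complex_of_real (transpose_mat U)"
  have U: "U \<in> carrier_mat n r" and o: "transpose_mat U * U = 1\<^sub>m r"
    using lr by (auto simp: low_rank_factors_def)
  have A: "?A \<in> carrier_mat n r" and B: "?B \<in> carrier_mat r n" using U by auto
  have AB: "?A * ?B = map_mat complex_of_real (low_rank_mat r U lam)"
    unfolding low_rank_mat_def
    by (rule of_real_hom.mat_hom_mult[symmetric, of _ n r _ n]) (use U in auto)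
  have "?B * ?A = map_mat complex_of_real (transpose_mat U * (U * mat_diag r lam))"
    by (rule of_real_hom.mat_hom_mult[symmetric, of _ r n _ r]) (use U in auto)
  also have "transpose_mat U * (U * mat_diag r lam) = mat_diag r lam"
    using U by (simp add: o left_mult_one_mat[of _ r r] flip: assoc_mult_mat[of "transpose_mat U" r n U r "mat_diag r lam" r])
  also have "map_mat complex_of_real (mat_diag r lam) = mat_diag r eigvalC"
    by (auto simp: mat_diag_def eigvalC_def)
  finally have BA: "?B * ?A = mat_diag r eigvalC" .
  note m = lam_min_le(3)[OF lr k]
  have "length (filter (\<lambda>x. cmod (x - eigvalC k) < \<eta>) bs) = card {i. i < r \<and> cmod (eigvalC i - eigvalC k) < \<eta>}"
  proof (rule eigenvalue_count_perturbation[OF A B _ BA eta_pos])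
    show "map_mat complex_of_real H \<in> carrier_mat n n" using H by simp
    show "\<eta> < cmod (eigvalC k)" using eigval_bounds(1)[OF k] \<eta>(2) m by linarith
    show "char_poly (?A * ?B + map_mat complex_of_real H) = (\<Prod>x\<leftarrow>bs. [:- x, 1:])"
      unfolding AB bs[symmetric] using H low_rank_mat_carrier[OF lr]
      by (intro arg_cong[where f = char_poly]) auto
    show "\<not> eigenvalue (?A * ?B + complex_of_real t \<cdot>\<^sub>m map_mat complex_of_real H) z"
      if t: "0 \<le> t" "t \<le> 1" and z: "cmod (z - eigvalC k) = \<eta>" for t z
    proof
      assume "eigenvalue (?A * ?B + complex_of_real t \<cdot>\<^sub>m map_mat complex_of_real H) z"
      hence ev: "eigenvalue (map_mat complex_of_real (low_rank_mat r U lam) + complex_of_real t \<cdot>\<^sub>m map_mat complex_of_real H) z"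
        unfolding AB .
      have "cmod (eigvalC k) - cmod z \<le> cmod (z - eigvalC k)"
        using norm_triangle_ineq2[of "eigvalC k" z] by (simp add: norm_minus_commute)
      hence "lam_min r lam / 2 \<le> cmod z" using z \<eta>(2) m eigval_bounds(1)[OF k] by linarith
      then obtain j where j: "j < r" "cmod (z - eigvalC j) \<le> \<eta> / 2"
        using eigenvalue_localized[OF t _ ev] by blast
      \<comment> \<open>A point of the circle is too far from the centre to be within \<eta> / 2 of
        it, and the gap of 4 \<eta> keeps it away from all other true eigenvalues.\<close>
      show False
      proof (cases "j = k")
        case True
        then show False using j z eta_pos by simp
      next
        case False
        have "cmod (eigvalC j - eigvalC k) \<le> cmod (z - eigvalC k) + cmod (z - eigvalC j)"
          using norm_triangle_ineq4[of "z - eigvalC k" "z - eigvalC j"] by simp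
        then show False using eigval_gap[OF j(1) k False] j z eta_pos by linarith
      qed
    qed
  qed
  also have "{i. i < r \<and> cmod (eigvalC i - eigvalC k) < \<eta>} = {k}"
  proof -
    have "i = k" if "i < r" "cmod (eigvalC i - eigvalC k) < \<eta>" for i
    proof (rule ccontr)
      assume "i \<noteq> k"
      thus False using eigval_gap[OF that(1) k] that(2) eta_pos by linarith
    qed
    thus ?thesis using k eta_pos by auto
  qed
  finally show ?thesis by simp
qed

text \<open>It suffices to find some matching with all deviations below \<eta>, because an optimal
  one is at least as good. Each disc contains exactly one root; the point is to show that this root
  is among the leading ones.\<close>

lemma matched_eigenvalue_near:
  assumes lead: "leading_eigenvalues (map_mat complex_of_real (low_rank_mat r U lam + H)) r z"
    and match: "matched_eigenvalues r lam z" and l: "l < r"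
  shows "cmod (z l - eigvalC l) \<le> \<eta>"
proof -
  let ?M = "map_mat complex_of_real (low_rank_mat r U lam + H)"
  obtain zs where zs: "char_poly ?M = (\<Prod>k<r. [:- z k, 1:]) * (\<Prod>x\<leftarrow>zs. [:- x, 1:])"
    and dom: "\<And>k x. k < r \<Longrightarrow> x \<in> set zs \<Longrightarrow> cmod x \<le> cmod (z k)"
    using lead by (auto simp: leading_eigenvalues_def)
  define bs where "bs = map z [0..<r] @ zs"
  have "(\<Prod>k<r. [:- z k, 1:]) = (\<Prod>k\<leftarrow>[0..<r]. [:- z k, 1:])"
    using prod.distinct_set_conv_list[of "[0..<r]" "\<lambda>k. [:- z k, 1:]"] by (simp add: lessThan_atLeast0)
  hence cp: "char_poly ?M = (\<Prod>x\<leftarrow>bs. [:- x, 1:])" by (simp add: zs bs_def o_def)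
  have M: "?M \<in> carrier_mat n n" using H low_rank_mat_carrier[OF lr] by simp
  have count: "length (filter (\<lambda>x. cmod (x - eigvalC k) < \<eta>) bs) = 1" if "k < r" for k
    by (rule root_count_disc[OF that cp])
  note m = lam_min_le(3)[OF lr l]
  have loc: "\<exists>k<r. cmod (x - eigvalC k) < \<eta>" if x: "x \<in> set bs" "lam_min r lam / 2 \<le> cmod x" for x
  proof -
    have "poly (char_poly ?M) x = 0" unfolding cp using x(1) by (auto simp: poly_prod_list prod_list_zero_iff o_def)
    hence "eigenvalue ?M x" using eigenvalue_root_char_poly[OF M] by simp
    moreover have "?M = map_mat complex_of_real (low_rank_mat r U lam) + complex_of_real 1 \<cdot>\<^sub>m map_mat complex_of_real H"
      using H low_rank_mat_carrier[OF lr] by auto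
    ultimately obtain k where "k < r" "cmod (x - eigvalC k) \<le> \<eta> / 2"
      using eigenvalue_localized[of 1 x] x(2) by auto
    thus ?thesis using eta_pos by (intro exI[of _ k]) auto
  qed
  have "\<exists>i<r. cmod (z i - eigvalC k) < \<eta>" if k: "k < r" for k
  proof -
    have "filter (\<lambda>x. cmod (x - eigvalC k) < \<eta>) bs \<noteq> []" using count[OF k] by auto
    then obtain x where x: "x \<in> set bs" "cmod (x - eigvalC k) < \<eta>" by (auto simp: filter_empty_conv)
    show ?thesis
    proof (cases "x \<in> z ` {..<r}")
      case True
      then show ?thesis using x by auto
    next
      \<comment> \<open>The root of this disc is not among the leading values. By dominance all
        leading values are then large, so each lies in some disc; no disc holds two of them, and by
        counting every disc, including the k-th, holds one.\<close>
      case False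
      hence xz: "x \<in> set zs" using x by (auto simp: bs_def)
      have "cmod (eigvalC k) - cmod x \<le> cmod (x - eigvalC k)"
        using norm_triangle_ineq2[of "eigvalC k" x] by (simp add: norm_minus_commute)
      hence xm: "lam_min r lam / 2 \<le> cmod x" using x(2) \<eta>(2) m eigval_bounds(1)[OF k] by linarith
      have "\<exists>j<r. cmod (z i - eigvalC j) < \<eta>" if "i < r" for i
        using dom[OF that xz] xm that by (intro loc) (auto simp: bs_def)
      then obtain s where s: "\<And>i. i < r \<Longrightarrow> s i < r \<and> cmod (z i - eigvalC (s i)) < \<eta>" by metis
      have "inj_on s {..<r}"
      proof (rule inj_onI)
        fix i j assume ij: "i \<in> {..<r}" "j \<in> {..<r}" "s i = s j"
        show "i = j"
          by (rule inj_from_filter[where Q = "\<lambda>x. cmod (x - eigvalC (s i)) < \<eta>" and z = z and zs = zs and r = r])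
             (use ij s[of i] s[of j] count[of "s i"] in \<open>auto simp: bs_def\<close>)
      qed
      hence "s ` {..<r} = {..<r}" by (intro endo_inj_surj) (use s in auto)
      then obtain i where "i < r" "s i = k" using k by (metis imageE lessThan_iff)
      thus ?thesis using s by auto
    qed
  qed
  then obtain f where f: "\<And>k. k < r \<Longrightarrow> f k < r \<and> cmod (z (f k) - eigvalC k) < \<eta>" by metis
  have "inj_on f {..<r}"
  proof (rule inj_onI)
    fix i j assume ij: "i \<in> {..<r}" "j \<in> {..<r}" "f i = f j"
    show "i = j"
    proof (rule ccontr)
      assume "i \<noteq> j"
      have "cmod (eigvalC i - eigvalC j) \<le> cmod (z (f i) - eigvalC j) + cmod (z (f i) - eigvalC i)"
        using norm_triangle_ineq4[of "z (f i) - eigvalC j" "z (f i) - eigvalC i"] by simp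
      thus False using eigval_gap[of i j] f[of i] f[of j] ij \<open>i \<noteq> j\<close> eta_pos by auto
    qed
  qed
  hence bij: "bij_betw f {..<r} {..<r}"
    unfolding bij_betw_def by (intro conjI endo_inj_surj) (use f in auto)
  have "cmod (z l - eigvalC l) \<le> Max ((\<lambda>k. cmod (z k - complex_of_real (lam k))) ` {..<r})"
    using l by (intro Max_ge) (auto simp: eigvalC_def)
  also have "\<dots> \<le> Max ((\<lambda>k. cmod (z (f k) - complex_of_real (lam k))) ` {..<r})"
    using match bij by (auto simp: matched_eigenvalues_def)
  also have "\<dots> \<le> \<eta>"
    using l f by (subst Max_le_iff) (auto simp: eigvalC_def intro: less_imp_le)
  finally show ?thesis .
qed

lemma estimator_error:
  assumes l: "l < r" and a: "a \<in> carrier_vec n" "l2_norm a = 1"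
    and na: "\<And>s k. 1 \<le> s \<Longrightarrow> k < r \<Longrightarrow> \<bar>bil n (entry H) s (\<lambda>i. a $ i) (\<lambda>i. U $$ (i, k))\<bar> \<le> \<epsilon> * \<tau> ^ (s - 1)"
      "\<And>s k. 1 \<le> s \<Longrightarrow> k < r \<Longrightarrow> \<bar>bil n (entry H) s (\<lambda>i. U $$ (i, k)) (\<lambda>i. a $ i)\<bar> \<le> \<epsilon> * \<tau> ^ (s - 1)"
    and lead: "leading_eigenvalues (map_mat complex_of_real (low_rank_mat r U lam + H)) r z"
    and match: "matched_eigenvalues r lam z"
    and u: "eigenvector (map_mat complex_of_real (low_rank_mat r U lam + H)) u (z l)"
    and w: "eigenvector (transpose_mat (map_mat complex_of_real (low_rank_mat r U lam + H))) w (z l)"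
    and q: "\<And>k. k < r \<Longrightarrow> k \<noteq> l \<Longrightarrow> (\<eta> / \<bar>lam l - lam k\<bar>)\<^sup>2 \<le> q" "0 \<le> q"
    and Mx: "\<And>k. k < r \<Longrightarrow> k \<noteq> l \<Longrightarrow> \<bar>a \<bullet> col U k\<bar> / \<bar>lam l - lam k\<bar> \<le> Mx" "0 \<le> Mx"
    and e: "real r * K * (q + 4 * \<eta> / lam_min r lam) \<le> 1 / 2"
  shows "min_pm (u_hat a u w) (a \<bullet> col U l)
    \<le> 6 * (real r * K * \<eta> * (1 / lam_min r lam + Mx)) + \<bar>a \<bullet> col U l\<bar> * (real r * K * q)"
proof -
  interpret sp: spiked n r noiseC factorC eigvalC \<tau> \<epsilon> S by (rule spiked_noise)
  let ?M = "map_mat complex_of_real (low_rank_mat r U lam + H)"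
  have U: "U \<in> carrier_mat n r" using lr by (simp add: low_rank_factors_def)
  have M: "?M \<in> carrier_mat n n" using H low_rank_mat_carrier[OF lr] by simp
  have Mij: "?M $$ (i, j) = noiseC i j + (\<Sum>k<r. eigvalC k * factorC k j * factorC k i)" if "i < n" "j < n" for i j
  proof -
    have "?M $$ (i, j) = (map_mat complex_of_real (low_rank_mat r U lam) + 1 \<cdot>\<^sub>m map_mat complex_of_real H) $$ (i, j)"
      using that H low_rank_mat_carrier[OF lr] by simp
    also have "\<dots> = 1 * noiseC i j + (\<Sum>k<r. eigvalC k * factorC k j * factorC k i)" by (rule spiked_matrix_entry[OF that])
    finally show ?thesis by simp
  qed
  have eu: "sp.eigenpair (z l) (\<lambda>i. u $ i)"
    by (rule eigenvector_eigenpair[OF spiked_noise M Mij u])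
  have ew: "spiked.eigenpair n r (\<lambda>i j. noiseC j i) factorC eigvalC (z l) (\<lambda>i. w $ i)"
  proof (rule eigenvector_eigenpair[OF sp.transposed _ _ w])
    show "transpose_mat ?M \<in> carrier_mat n n" using M by simp
    show "transpose_mat ?M $$ (i, j) = noiseC j i + (\<Sum>k<r. eigvalC k * factorC k j * factorC k i)" if "i < n" "j < n" for i j
    proof -
      have "transpose_mat ?M $$ (i, j) = ?M $$ (j, i)" using M that by (intro index_transpose_mat) auto
      thus ?thesis unfolding Mij[OF that(2,1)] by (simp add: mult.assoc mult.commute[of "factorC _ j"])
    qed
  qed
  define ca where "ca i = complex_of_real (a $ i)" for i
  have dotU: "dot n ca (factorC k) = complex_of_real (a \<bullet> col U k)" if "k < r" for k
    using U that by (simp add: dot_def ca_def factorC_def scalar_prod_def lessThan_atLeast0)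
  have na': "cmod (bil n noiseC s ca (factorC k)) \<le> \<epsilon> * \<tau> ^ (s - 1)" "cmod (bil n noiseC s (factorC k) ca) \<le> \<epsilon> * \<tau> ^ (s - 1)"
    if "1 \<le> s" "k < r" for s k
    using na(1)[OF that] na(2)[OF that] unfolding noiseC_def factorC_def ca_def bil_of_real by simp_all
  have gap0: "2 * \<eta> \<le> cmod (eigvalC l - eigvalC k) \<and> 0 < cmod (eigvalC l - eigvalC k)" if "k < r" "k \<noteq> l" for k
    using eigval_gap[OF l that(1)] that(2) eta_pos by auto
  have cdd: "cmod (eigvalC l - eigvalC k) = \<bar>lam l - lam k\<bar>" for k by (simp add: eigvalC_def flip: of_real_diff)
  have "\<bar>sqrt (cmod (dot n ca (\<lambda>i. u $ i) * dot n ca (\<lambda>i. w $ i) / dot n (\<lambda>i. w $ i) (\<lambda>i. u $ i))) - cmod (dot n ca (factorC l))\<bar>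
    \<le> 2 * (real r * K * \<eta> * (1 / lam_min r lam + Mx))
      + cmod (dot n ca (factorC l)) * (real r * K * (q + 4 * \<eta> / lam_min r lam))"
  proof (rule sp.ratio_estimate[OF lam_min_le(3)[OF lr l] \<tau>(2) eigval_bounds \<eta>(1) _ l gap0 eu _ ew])
    show "2 * \<eta> \<le> lam_min r lam" using \<eta>(2) eta_pos by linarith
    show "cmod (z l - eigvalC l) \<le> \<eta>" by (rule matched_eigenvalue_near[OF lead match l])
    show "cmod (dot n ca (factorC k)) / cmod (eigvalC l - eigvalC k) \<le> Mx" if "k < r" "k \<noteq> l" for k
      using Mx(1)[OF that] by (simp add: dotU[OF that(1)] cdd)
  qed (use q Mx(2) e na' in \<open>simp_all add: cdd\<close>)
  moreover have "dot n ca (\<lambda>i. v $ i) = map_vec complex_of_real a \<bullet> v" if "v \<in> carrier_vec n" for v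
    using that a(1) by (simp add: dot_def ca_def scalar_prod_def lessThan_atLeast0)
  moreover have uw: "u \<in> carrier_vec n" "w \<in> carrier_vec n"
    using u w M by (auto simp: eigenvector_def)
  moreover have "dot n (\<lambda>i. w $ i) (\<lambda>i. u $ i) = w \<bullet> u"
    using uw by (simp add: dot_def scalar_prod_def lessThan_atLeast0)
  ultimately have main: "\<bar>sqrt (cmod (map_vec complex_of_real a \<bullet> u * (map_vec complex_of_real a \<bullet> w) / (w \<bullet> u))) - \<bar>a \<bullet> col U l\<bar>\<bar>
    \<le> 2 * (real r * K * \<eta> * (1 / lam_min r lam + Mx))
      + \<bar>a \<bullet> col U l\<bar> * (real r * K * (q + 4 * \<eta> / lam_min r lam))"
    by (simp add: dotU l)
  have "\<bar>a \<bullet> col U l\<bar> \<le> 1"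
  proof -
    have "\<bar>a \<bullet> col U l\<bar> \<le> (\<Sum>i<n. \<bar>a $ i\<bar> * \<bar>U $$ (i, l)\<bar>)"
      using U l a(1) by (simp add: scalar_prod_def lessThan_atLeast0 order_trans[OF sum_abs] flip: abs_mult)
    also have "\<dots> \<le> L2_set (\<lambda>i. a $ i) {..<n} * L2_set (\<lambda>i. U $$ (i, l)) {..<n}"
      by (rule L2_set_mult_ineq)
    also have "L2_set (\<lambda>i. U $$ (i, l)) {..<n} = 1"
      using columns_orthonormal[OF lr l l] by (simp add: L2_set_def power2_eq_square)
    also have "L2_set (\<lambda>i. a $ i) {..<n} = 1" using a by (simp add: l2_norm_def L2_set_def)
    finally show ?thesis by simp
  qed
  note \<alpha> = this
  \<comment> \<open>Since |a^T u_l| <= 1, the part of the relative error that involves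
    \<open>4 * \<eta> / lam_min r lam\<close> is absorbed in the first summand; this gives 6 = 2 +
    4.\<close>
  have "\<bar>a \<bullet> col U l\<bar> * (real r * K * (4 * \<eta> / lam_min r lam)) \<le> 1 * (real r * K * (4 * \<eta> / lam_min r lam))"
    using \<alpha> K_pos eta_pos lam_min_le(3)[OF lr l] by (intro mult_right_mono) auto
  also have "\<dots> \<le> 4 * (real r * K * \<eta> * (1 / lam_min r lam + Mx))"
    using Mx(2) K_pos eta_pos by (simp add: algebra_simps)
  finally have h: "\<bar>a \<bullet> col U l\<bar> * (real r * K * (4 * \<eta> / lam_min r lam))
    \<le> 4 * (real r * K * \<eta> * (1 / lam_min r lam + Mx))" .
  have "2 * (real r * K * \<eta> * (1 / lam_min r lam + Mx))
      + \<bar>a \<bullet> col U l\<bar> * (real r * K * (q + 4 * \<eta> / lam_min r lam))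
    \<le> 6 * (real r * K * \<eta> * (1 / lam_min r lam + Mx)) + \<bar>a \<bullet> col U l\<bar> * (real r * K * q)"
  proof -
    have "\<bar>a \<bullet> col U l\<bar> * (real r * K * (q + 4 * \<eta> / lam_min r lam))
      = \<bar>a \<bullet> col U l\<bar> * (real r * K * q) + \<bar>a \<bullet> col U l\<bar> * (real r * K * (4 * \<eta> / lam_min r lam))"
      by (simp only: distrib_left)
    moreover have "W \<le> 4 * Z \<Longrightarrow> 2 * Z + (Y + W) \<le> 6 * Z + Y" for W Y Z :: real by linarith
    ultimately show ?thesis using h by metis
  qed
  from order_trans[OF order_trans[OF min_pm_le[OF real_sqrt_ge_zero[OF norm_ge_zero] \<alpha>] main] this]
  show ?thesis unfolding u_hat_def Let_def a(2) .
qed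
end

section \<open>Tail bounds for the noise\<close>

text \<open>Isolates what the moment method takes from independence, symmetry and boundedness, so
  that transposed noise is just another instance.\<close>

locale even_moments = prob_space P for P :: "'w measure" +
  fixes h :: "nat \<Rightarrow> nat \<Rightarrow> 'w \<Rightarrow> real" and \<sigma> L :: real
  assumes int: "integrable P (\<lambda>\<omega>. \<Prod>e\<in>#m. case_prod (\<lambda>i j. h i j \<omega>) e)"
    and odd: "\<exists>e. odd (count m e) \<Longrightarrow> (\<integral>\<omega>. (\<Prod>e\<in>#m. case_prod (\<lambda>i j. h i j \<omega>) e) \<partial>P) = 0"
    and even: "(\<And>e. even (count m e)) \<Longrightarrow>
       \<bar>\<integral>\<omega>. (\<Prod>e\<in>#m. case_prod (\<lambda>i j. h i j \<omega>) e) \<partial>P\<bar>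
         \<le> \<sigma> ^ (2 * card (set_mset m)) * L ^ (size m - 2 * card (set_mset m))"
    and L: "0 \<le> L"
begin

lemma h_measurable [measurable]: "h i j \<in> borel_measurable P"
  using int[of "{#(i, j)#}"] by (simp add: integrable_iff_bounded)

lemma mpow_measurable [measurable]: "(\<lambda>\<omega>. mpow n (\<lambda>i j. h i j \<omega>) s i j) \<in> borel_measurable P"
  by (induction s arbitrary: i) simp_all

lemma bil_measurable [measurable]: "(\<lambda>\<omega>. bil n (\<lambda>i j. h i j \<omega>) s b c) \<in> borel_measurable P"
  unfolding bil_def by measurable

text \<open>The tail bound exploits incoherence of the right vector; forms with the incoherent
  vector on the left are reduced to it by transposition.\<close>

lemma even_moments_transposed: "even_moments P (\<lambda>i j. h j i) \<sigma> L"
proof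
  let ?s = "image_mset prod.swap :: (nat \<times> nat) multiset \<Rightarrow> _"
  have eq: "(\<Prod>e\<in>#m. case_prod (\<lambda>i j. h j i \<omega>) e) = (\<Prod>e\<in>#?s m. case_prod (\<lambda>i j. h i j \<omega>) e)" for m \<omega>
    by (simp add: multiset.map_comp o_def case_prod_beta)
  have cnt: "count (?s m) (prod.swap e) = count m e" for m e
    by (induction m) (auto simp: inj_eq[OF inj_swap])
  have card: "card (set_mset (?s m)) = card (set_mset m)" for m
    by (simp add: card_image inj_on_subset[OF inj_swap])
  show "integrable P (\<lambda>\<omega>. \<Prod>e\<in>#m. case_prod (\<lambda>i j. h j i \<omega>) e)" for m
    unfolding eq by (rule int)
  show "(\<integral>\<omega>. (\<Prod>e\<in>#m. case_prod (\<lambda>i j. h j i \<omega>) e) \<partial>P) = 0" if "\<exists>e. odd (count m e)" for m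
    unfolding eq by (rule odd) (use that cnt[of m] in metis)
  show "\<bar>\<integral>\<omega>. (\<Prod>e\<in>#m. case_prod (\<lambda>i j. h j i \<omega>) e) \<partial>P\<bar>
    \<le> \<sigma> ^ (2 * card (set_mset m)) * L ^ (size m - 2 * card (set_mset m))"
    if "\<And>e. even (count m e)" for m
  proof -
    have "even (count (?s m) e)" for e using cnt[of m "prod.swap e"] that[of "prod.swap e"] by simp
    from even[OF this] show ?thesis unfolding eq by (simp only: card size_image_mset)
  qed
qed (rule L)

text \<open>Markov's inequality for the p-th power at a level \<open>exp \<kappa>\<close> times the
  p-th root of the moment bound.\<close>

lemma bilinear_tail:
  fixes b u :: "nat \<Rightarrow> real"
  assumes p: "0 < p" "even p" and s: "0 < s"
    and pos: "0 < \<beta>" "\<beta> \<le> 1" "0 < g" "0 < n" "0 < N"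
    and bounds: "real n * N * \<sigma>\<^sup>2 \<le> \<rho>\<^sup>2" "real p * N * \<sigma>\<^sup>2 \<le> g\<^sup>2" "N * L \<le> \<rho>" "N * L * \<beta> \<le> g" "g \<le> \<rho>"
      "real (p * s) \<le> N"
    and b: "(\<Sum>i<n. (b i)\<^sup>2) = 1" and u: "(\<Sum>i<n. (u i)\<^sup>2) = 1" and u\<beta>: "\<And>i. i < n \<Longrightarrow> \<bar>u i\<bar> \<le> \<beta>"
  shows "prob {\<omega> \<in> space P. exp \<kappa> * ((2 + 2 * real p)\<^sup>2 * (3 ^ s * (g * \<rho> ^ (s - 1)))) \<le> \<bar>bil n (\<lambda>i j. h i j \<omega>) s b u\<bar>}
    \<le> exp (- \<kappa> * real p)"
proof -
  define X where "X \<omega> = bil n (\<lambda>i j. h i j \<omega>) s b u" for \<omega>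
  define Y where "Y = (2 + 2 * real p)\<^sup>2 * (3 ^ s * (g * \<rho> ^ (s - 1)))"
  have "0 < \<rho>" using pos bounds by linarith
  hence Y: "0 < Y" unfolding Y_def using pos by simp
  have "p * s - p = (s - 1) * p" using s by (simp add: algebra_simps diff_mult_distrib)
  hence Yp: "Y ^ p = (2 + 2 * real p) ^ (2 * p) * (3 ^ (p * s) * (g ^ p * \<rho> ^ (p * s - p)))"
    by (simp add: Y_def power_mult_distrib power_mult[symmetric] mult.commute)
  note moment = moment_bilinear[OF int odd even p(1) s pos(1,2) less_imp_le[OF pos(3)] pos(4,5) L bounds b u u\<beta>]
  have intX: "integrable P (\<lambda>\<omega>. X \<omega> ^ p)" and EX: "(\<integral>\<omega>. X \<omega> ^ p \<partial>P) \<le> Y ^ p"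
    unfolding X_def bil_def Yp by (rule moment; assumption)+
  have "{\<omega> \<in> space P. exp \<kappa> * Y \<le> \<bar>X \<omega>\<bar>} = {\<omega> \<in> space P. X \<omega> ^ p \<ge> (exp \<kappa> * Y) ^ p}"
  proof -
    have "exp \<kappa> * Y \<le> \<bar>X \<omega>\<bar> \<longleftrightarrow> (exp \<kappa> * Y) ^ p \<le> \<bar>X \<omega>\<bar> ^ p" for \<omega>
      using Y p by (intro power_mono_iff[symmetric]) auto
    thus ?thesis using p by (simp add: power_even_abs)
  qed
  also have "prob \<dots> \<le> (\<integral>\<omega>. X \<omega> ^ p \<partial>P) / (exp \<kappa> * Y) ^ p"
    by (rule integral_Markov_inequality_measure[where A = "{}"]) (use intX p Y in \<open>auto simp: zero_le_even_power\<close>)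
  also have "\<dots> \<le> Y ^ p / (exp \<kappa> * Y) ^ p"
    using EX Y by (intro divide_right_mono) auto
  also have "\<dots> = exp (- \<kappa> * real p)"
    using Y by (simp add: power_mult_distrib exp_minus exp_of_nat_mult[symmetric] mult.commute field_simps)
  finally show ?thesis by (simp add: X_def Y_def)
qed

end

text \<open>Extension by 0 makes the moment bounds and integrability hold for all index pairs,
  without range conditions.\<close>

definition noise_entry :: "nat \<Rightarrow> ('w \<Rightarrow> real mat) \<Rightarrow> nat \<Rightarrow> nat \<Rightarrow> 'w \<Rightarrow> real" where
  "noise_entry n H i j \<omega> = (if i < n \<and> j < n then H \<omega> $$ (i, j) else 0)"

lemma expectation_odd_power_symmetric:
  assumes [measurable]: "X \<in> borel_measurable P" and sym: "distr P borel X = distr P borel (\<lambda>\<omega>. - X \<omega>)" and k: "odd k"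
  shows "(\<integral>\<omega>. X \<omega> ^ k \<partial>P) = (0::real)"
proof -
  have "(\<integral>\<omega>. X \<omega> ^ k \<partial>P) = (\<integral>x. x ^ k \<partial>distr P borel X)" by (simp add: integral_distr)
  also have "\<dots> = (\<integral>x. x ^ k \<partial>distr P borel (\<lambda>\<omega>. - X \<omega>))" by (simp only: sym)
  also have "\<dots> = (\<integral>\<omega>. (- X \<omega>) ^ k \<partial>P)" by (simp add: integral_distr)
  also have "\<dots> = - (\<integral>\<omega>. X \<omega> ^ k \<partial>P)" using k by simp
  finally show ?thesis by simp
qed

text \<open>Independence factorises a monomial over its distinct entries. Odd powers have mean 0 by
  symmetry; an even power contributes one variance and a factor L for each occurrence beyond the
  second.\<close>

lemma even_moments_noise:
  assumes "prob_space P" and nc: "noise_conditions P n H \<sigma>_min \<sigma> L" and \<sigma>L: "\<sigma> \<le> L"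
  shows "even_moments P (noise_entry n H) \<sigma> L"
proof -
  interpret prob_space P by fact
  have \<sigma>: "0 < \<sigma>" using nc by (simp add: noise_conditions_def)
  have L: "0 \<le> L" using \<sigma> \<sigma>L by linarith
  define X where "X e \<omega> = (case e of (i, j) \<Rightarrow> H \<omega> $$ (i, j))" for e \<omega>
  let ?I = "{..<n} \<times> {..<n}"
  have indep: "indep_vars (\<lambda>_. borel) X ?I"
    using nc unfolding noise_conditions_def X_def by (simp add: case_prod_beta' case_prod_unfold)
  have Xm[measurable]: "X e \<in> borel_measurable P" if "e \<in> ?I" for e
    using indep that unfolding indep_vars_def by blast
  have var: "expectation (\<lambda>\<omega>. (X e \<omega>)\<^sup>2) \<le> \<sigma>\<^sup>2" and bd: "AE \<omega> in P. \<bar>X e \<omega>\<bar> \<le> L"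
    and sym: "distr P borel (X e) = distr P borel (\<lambda>\<omega>. - X e \<omega>)" if "e \<in> ?I" for e
    using nc that unfolding noise_conditions_def X_def by auto
  have intp: "integrable P (\<lambda>\<omega>. X e \<omega> ^ k)" if e: "e \<in> ?I" for e k
  proof (rule integrable_const_bound)
    show "AE \<omega> in P. norm (X e \<omega> ^ k) \<le> L ^ k"
      using bd[OF e] by eventually_elim (simp add: power_abs power_mono)
  qed (use Xm[OF e] in measurable)
  have evenp: "\<bar>expectation (\<lambda>\<omega>. X e \<omega> ^ k)\<bar> \<le> \<sigma>\<^sup>2 * L ^ (k - 2)" if e: "e \<in> ?I" and k: "even k" "0 < k" for e k
  proof -
    have k2: "k = 2 + (k - 2)" and ek: "even (k - 2)" using k by (auto elim!: evenE)
    have "\<bar>expectation (\<lambda>\<omega>. X e \<omega> ^ k)\<bar> = expectation (\<lambda>\<omega>. X e \<omega> ^ k)"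
      using k by (intro abs_of_nonneg integral_nonneg_AE) (auto simp: zero_le_even_power)
    also have "\<dots> \<le> expectation (\<lambda>\<omega>. (X e \<omega>)\<^sup>2 * L ^ (k - 2))"
    proof (rule integral_mono_AE)
      show "AE \<omega> in P. X e \<omega> ^ k \<le> (X e \<omega>)\<^sup>2 * L ^ (k - 2)"
        using bd[OF e]
      proof eventually_elim
        case (elim \<omega>)
        have "X e \<omega> ^ k = (X e \<omega>)\<^sup>2 * \<bar>X e \<omega>\<bar> ^ (k - 2)"
          using ek by (subst k2) (simp only: power_add power_even_abs)
        also have "\<dots> \<le> (X e \<omega>)\<^sup>2 * L ^ (k - 2)" using elim by (intro mult_left_mono power_mono) auto
        finally show ?case .
      qed
    qed (use intp[OF e] in auto)
    also have "\<dots> \<le> \<sigma>\<^sup>2 * L ^ (k - 2)" using var[OF e] L by (simp add: mult_right_mono)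
    finally show ?thesis .
  qed
  have prodX: "(\<Prod>e\<in>#m. case_prod (\<lambda>i j. noise_entry n H i j \<omega>) e)
    = (if set_mset m \<subseteq> ?I then \<Prod>e\<in>set_mset m. X e \<omega> ^ count m e else 0)" for m \<omega>
  proof (cases "set_mset m \<subseteq> ?I")
    case True
    have "(\<Prod>e\<in>#m. case_prod (\<lambda>i j. noise_entry n H i j \<omega>) e)
      = (\<Prod>e\<in>set_mset m. (case_prod (\<lambda>i j. noise_entry n H i j \<omega>) e) ^ count m e)"
      by (rule image_prod_mset_multiplicity)
    also have "\<dots> = (\<Prod>e\<in>set_mset m. X e \<omega> ^ count m e)"
      using True by (intro prod.cong) (auto simp: X_def noise_entry_def)
    finally show ?thesis using True by simp
  next
    case False
    then obtain e where e: "e \<in># m" "e \<notin> ?I" by auto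
    then obtain m' where "m = add_mset e m'" by (metis mset_add)
    moreover have "case_prod (\<lambda>i j. noise_entry n H i j \<omega>) e = 0"
      using e by (cases e) (auto simp: noise_entry_def)
    ultimately have "(\<Prod>e\<in>#m. case_prod (\<lambda>i j. noise_entry n H i j \<omega>) e) = 0" by simp
    then show ?thesis using False by presburger
  qed
  have ind: "indep_vars (\<lambda>_. borel) (\<lambda>e \<omega>. X e \<omega> ^ count m e) (set_mset m)" if "set_mset m \<subseteq> ?I" for m
    using indep_vars_compose2[OF indep_vars_subset[OF indep that], of "\<lambda>e x. x ^ count m e" "\<lambda>_. borel"] by simp
  have E: "expectation (\<lambda>\<omega>. \<Prod>e\<in>set_mset m. X e \<omega> ^ count m e) = (\<Prod>e\<in>set_mset m. expectation (\<lambda>\<omega>. X e \<omega> ^ count m e))"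
    and I: "integrable P (\<lambda>\<omega>. \<Prod>e\<in>set_mset m. X e \<omega> ^ count m e)" if "set_mset m \<subseteq> ?I" for m
    using that by (auto intro!: indep_vars_lebesgue_integral indep_vars_integrable ind intp)
  show ?thesis
  proof
    fix m :: "(nat \<times> nat) multiset"
    show "integrable P (\<lambda>\<omega>. \<Prod>e\<in>#m. case_prod (\<lambda>i j. noise_entry n H i j \<omega>) e)"
      unfolding prodX using I[of m] by (cases "set_mset m \<subseteq> ?I") simp_all
    show "expectation (\<lambda>\<omega>. \<Prod>e\<in>#m. case_prod (\<lambda>i j. noise_entry n H i j \<omega>) e) = 0" if oddm: "\<exists>e. odd (count m e)"
    proof (cases "set_mset m \<subseteq> ?I")
      case True
      obtain e where e: "odd (count m e)" using oddm by blast
      hence em: "e \<in># m" by (metis count_inI even_zero)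
      have "expectation (\<lambda>\<omega>. X e \<omega> ^ count m e) = 0"
        using em True by (intro expectation_odd_power_symmetric sym Xm e) auto
      hence "(\<Prod>e\<in>set_mset m. expectation (\<lambda>\<omega>. X e \<omega> ^ count m e)) = 0"
        using em by (intro prod_zero) auto
      then show ?thesis unfolding prodX using True E[OF True] by simp
    qed (simp add: prodX)
    show "\<bar>expectation (\<lambda>\<omega>. \<Prod>e\<in>#m. case_prod (\<lambda>i j. noise_entry n H i j \<omega>) e)\<bar>
        \<le> \<sigma> ^ (2 * card (set_mset m)) * L ^ (size m - 2 * card (set_mset m))"
      if ev: "\<And>e. even (count m e)"
    proof (cases "set_mset m \<subseteq> ?I")
      case True
      have "\<bar>expectation (\<lambda>\<omega>. \<Prod>e\<in>#m. case_prod (\<lambda>i j. noise_entry n H i j \<omega>) e)\<bar>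
        = (\<Prod>e\<in>set_mset m. \<bar>expectation (\<lambda>\<omega>. X e \<omega> ^ count m e)\<bar>)"
        unfolding prodX using True E[OF True] by (simp add: abs_prod)
      also have "\<dots> \<le> (\<Prod>e\<in>set_mset m. \<sigma>\<^sup>2 * L ^ (count m e - 2))"
        using True ev by (intro prod_mono conjI evenp) auto
      also have "\<dots> = \<sigma> ^ (2 * card (set_mset m)) * L ^ (\<Sum>e\<in>set_mset m. count m e - 2)"
        by (simp add: prod.distrib power_sum power_mult)
      also have "(\<Sum>e\<in>set_mset m. count m e - 2) = size m - 2 * card (set_mset m)"
      proof -
        have c2: "2 \<le> count m e" if "e \<in># m" for e
        proof -
          have "count m e \<noteq> 0" using that by simp
          moreover have "count m e \<noteq> 1" using ev[of e] by (metis odd_one)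
          ultimately show ?thesis by linarith
        qed
        have "size m = (\<Sum>e\<in>set_mset m. (count m e - 2) + 2)"
          unfolding size_multiset_overloaded_eq
        proof (rule sum.cong[OF refl])
          show "count m e = (count m e - 2) + 2" if "e \<in># m" for e using c2[OF that] by linarith
        qed
        also have "\<dots> = (\<Sum>e\<in>set_mset m. count m e - 2) + 2 * card (set_mset m)"
          by (simp only: sum.distrib) simp
        finally show ?thesis by simp
      qed
      finally show ?thesis .
    qed (use \<sigma> L in \<open>simp add: prodX\<close>)
  qed (rule L)
qed

text \<open>Splitting off a power S repeatedly reaches the window S <= s < 2 S. Entrywise bounds
  multiply at the cost of a factor n for the inner sum, which \<delta> absorbs.\<close>

lemma tail_from_window:
  fixes A :: "nat \<Rightarrow> nat \<Rightarrow> real"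
  assumes S: "0 < S" and \<delta>: "0 \<le> \<delta>" "real n * \<delta> \<le> 1" and \<tau>: "0 \<le> \<tau>"
    and window: "\<And>s i j. S \<le> s \<Longrightarrow> s < 2 * S \<Longrightarrow> i < n \<Longrightarrow> j < n \<Longrightarrow> \<bar>mpow n A s i j\<bar> \<le> \<delta> * \<tau> ^ s"
  shows "S \<le> s \<Longrightarrow> i < n \<Longrightarrow> j < n \<Longrightarrow> \<bar>mpow n A s i j\<bar> \<le> \<delta> * \<tau> ^ s"
proof (induction s arbitrary: i j rule: less_induct)
  case (less s)
  show ?case
  proof (cases "s < 2 * S")
    case False
    have s: "s = S + (s - S)" using less.prems by simp
    have "\<bar>mpow n A s i j\<bar> \<le> (\<Sum>x<n. \<bar>mpow n A S i x\<bar> * \<bar>mpow n A (s - S) x j\<bar>)"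
      by (subst s, subst mpow_add[OF less.prems(2)]) (simp add: order_trans[OF sum_abs] flip: abs_mult)
    also have "\<dots> \<le> (\<Sum>x<n. (\<delta> * \<tau> ^ S) * (\<delta> * \<tau> ^ (s - S)))"
    proof (intro sum_mono mult_mono)
      fix x assume "x \<in> {..<n}"
      thus "\<bar>mpow n A S i x\<bar> \<le> \<delta> * \<tau> ^ S" using window[of S i x] S less.prems by simp
      show "\<bar>mpow n A (s - S) x j\<bar> \<le> \<delta> * \<tau> ^ (s - S)"
        using \<open>x \<in> {..<n}\<close> False S less.prems by (intro less.IH) auto
    qed (use \<delta> \<tau> in auto)
    also have "\<dots> = (real n * \<delta>) * (\<delta> * (\<tau> ^ S * \<tau> ^ (s - S)))" by simp
    also have "\<tau> ^ S * \<tau> ^ (s - S) = \<tau> ^ s" using less.prems by (simp flip: power_add)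
    also have "(real n * \<delta>) * (\<delta> * \<tau> ^ s) \<le> 1 * (\<delta> * \<tau> ^ s)" using \<delta> \<tau> by (intro mult_right_mono) auto
    finally show ?thesis by simp
  qed (use window less.prems in auto)
qed

lemma abs_bil_le:
  fixes A :: "nat \<Rightarrow> nat \<Rightarrow> real"
  assumes "\<And>i. i < n \<Longrightarrow> \<bar>b i\<bar> \<le> 1" "\<And>i. i < n \<Longrightarrow> \<bar>c i\<bar> \<le> 1"
    and "\<And>i j. i < n \<Longrightarrow> j < n \<Longrightarrow> \<bar>mpow n A s i j\<bar> \<le> B"
  shows "\<bar>bil n A s b c\<bar> \<le> (real n)\<^sup>2 * B"
proof -
  have "\<bar>bil n A s b c\<bar> \<le> (\<Sum>i<n. \<Sum>j<n. \<bar>b i * c j * mpow n A s i j\<bar>)"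
    unfolding bil_def by (intro order_trans[OF sum_abs] sum_mono order_refl)
  also have "\<dots> \<le> (\<Sum>i<n. \<Sum>j<n. 1 * 1 * B)"
    unfolding abs_mult using assms by (intro sum_mono mult_mono) auto
  finally show ?thesis by (simp add: power2_eq_square)
qed

text \<open>The parameters of the moment method: powers \<open>s < 2 S\<close> with \<open>S = \<lceil>ln n\<rceil>\<close>, moments of order
  \<open>p = 2 S\<close>, hence at most \<open>N = 4 S\<^sup>2\<close> steps in a tuple of walks.\<close>

locale scales =
  fixes n R S :: nat and \<sigma> L C\<^sub>0 x \<beta> \<tau> \<rho> g T \<epsilon> :: real
  assumes x: "x = ln (real n)" and big: "(48 * exp 10)\<^sup>2 \<le> x" and S: "S = nat \<lceil>x\<rceil>" and R: "0 < R"
    and \<sigma>: "0 < \<sigma>" "\<sigma> \<le> L" and C\<^sub>0: "0 < C\<^sub>0" and \<beta>: "0 < \<beta>" "\<beta> \<le> 1"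
    and L\<beta>: "L * \<beta> \<le> C\<^sub>0 * \<sigma> * sqrt (real R) / sqrt x" and Ln: "L \<le> C\<^sub>0 * \<sigma> * sqrt (real n)"
    and \<tau>: "\<tau> = max (\<sigma> * sqrt (real n * x ^ 3)) (L * x ^ 3)"
    and \<rho>: "\<rho> = max (2 * real S * sqrt (real n) * \<sigma>) (4 * (real S)\<^sup>2 * L)"
    and g: "g = max (sqrt (8 * real S ^ 3) * \<sigma>) (4 * (real S)\<^sup>2 * L * \<beta>)"
    and T: "T = 300 * exp 20 * (8 + 16 * C\<^sub>0 * sqrt (real R))" and \<epsilon>: "\<epsilon> = T * \<sigma> * (x ^ 3 * sqrt x)"
begin

lemma exp10: "1 \<le> exp (10::real)" "1 \<le> exp (20::real)" by simp_all

lemma exp_20: "exp (20::real) = exp 10 * exp 10" by (simp flip: exp_add)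

lemma sqrt_x: "48 * exp 10 \<le> sqrt x"
  using big by (intro real_le_rsqrt)

lemma x_large: "2304 * exp 20 \<le> x"
  using big by (simp add: power2_eq_square exp_20)

lemma x_ge: "2304 \<le> x" using x_large exp10 by linarith

lemma x_48: "48 * exp 10 \<le> x"
proof -
  have "48 * exp 10 * 1 \<le> sqrt x * sqrt x" using sqrt_x x_ge by (intro mult_mono) auto
  thus ?thesis using x_ge by simp
qed

lemma n_pos: "0 < n"
  using x x_ge by (cases "n = 0") auto

lemma exp_x: "exp x = real n" using n_pos by (simp add: x)

lemma x_le_n: "x \<le> real n" unfolding exp_x[symmetric] using exp_ge_add_one_self[of x] by linarith

lemma S_bounds: "x \<le> real S" "real S \<le> 2 * x" "0 < S"
proof -
  have "real S = of_int \<lceil>x\<rceil>" using x_ge by (simp add: S)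
  thus "x \<le> real S" "real S \<le> 2 * x" using x_ge by linarith+
  thus "0 < S" using x_ge by linarith
qed

lemma four_x_le_n: "4 * x \<le> real n"
proof -
  have "1 + x + x\<^sup>2 / 2 \<le> exp x" using exp_lower_Taylor_quadratic[of x] x_ge by simp
  moreover have "8 * x \<le> x\<^sup>2" unfolding power2_eq_square using x_ge by (intro mult_right_mono) auto
  ultimately show ?thesis using x_ge unfolding exp_x by linarith
qed

lemma L_pos: "0 < L" using \<sigma> by linarith

lemma \<rho>_pos: "0 < \<rho>" 
proof -
  have "0 < 2 * real S * sqrt (real n) * \<sigma>" using S_bounds n_pos \<sigma> by simp
  thus ?thesis unfolding \<rho> by linarith
qed

lemma g_pos: "0 < g"
proof -
  have "0 < sqrt (8 * real S ^ 3) * \<sigma>" using S_bounds \<sigma> by simp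
  thus ?thesis unfolding g by linarith
qed

text \<open>The last inequality is the second with \<rho> for g. It serves for single entries, where
  the right vector is a coordinate vector, \<beta> is 1 and nothing is gained.\<close>

lemma moment_conditions:
  "real n * (4 * (real S)\<^sup>2) * \<sigma>\<^sup>2 \<le> \<rho>\<^sup>2" "real (2 * S) * (4 * (real S)\<^sup>2) * \<sigma>\<^sup>2 \<le> g\<^sup>2"
  "4 * (real S)\<^sup>2 * L \<le> \<rho>" "4 * (real S)\<^sup>2 * L * \<beta> \<le> g" "g \<le> \<rho>"
  "real (2 * S) * (4 * (real S)\<^sup>2) * \<sigma>\<^sup>2 \<le> \<rho>\<^sup>2"
proof -
  have "(2 * real S * sqrt (real n) * \<sigma>)\<^sup>2 \<le> \<rho>\<^sup>2"
    unfolding \<rho> using \<sigma> by (intro power_mono) auto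
  thus 1: "real n * (4 * (real S)\<^sup>2) * \<sigma>\<^sup>2 \<le> \<rho>\<^sup>2" by (simp add: power_mult_distrib mult_ac)
  have "(sqrt (8 * real S ^ 3) * \<sigma>)\<^sup>2 \<le> g\<^sup>2"
    unfolding g using \<sigma> by (intro power_mono) auto
  thus 2: "real (2 * S) * (4 * (real S)\<^sup>2) * \<sigma>\<^sup>2 \<le> g\<^sup>2"
    by (simp add: power_mult_distrib power2_eq_square power3_eq_cube mult_ac)
  show "4 * (real S)\<^sup>2 * L \<le> \<rho>" "4 * (real S)\<^sup>2 * L * \<beta> \<le> g" by (simp_all add: \<rho> g)
  have Sn: "real (2 * S) \<le> real n" using S_bounds four_x_le_n by simp
  have "sqrt (8 * real S ^ 3) \<le> 2 * real S * sqrt (real n)"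
  proof (rule real_le_lsqrt)
    have "8 * real S ^ 3 = 4 * (real S)\<^sup>2 * real (2 * S)" by (simp add: power2_eq_square power3_eq_cube)
    also have "\<dots> \<le> 4 * (real S)\<^sup>2 * real n" using Sn by (intro mult_left_mono) auto
    finally show "8 * real S ^ 3 \<le> (2 * real S * sqrt (real n))\<^sup>2" by (simp add: power_mult_distrib)
  qed simp
  hence h1: "sqrt (8 * real S ^ 3) * \<sigma> \<le> 2 * real S * sqrt (real n) * \<sigma>" using \<sigma> by (intro mult_right_mono) auto
  have h2: "4 * (real S)\<^sup>2 * L * \<beta> \<le> 4 * (real S)\<^sup>2 * L"
    using \<beta> L_pos mult_left_mono[of \<beta> 1 "4 * (real S)\<^sup>2 * L"] by simp
  show "g \<le> \<rho>" unfolding \<rho> g by (rule max.mono[OF h1 h2])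
  hence "g\<^sup>2 \<le> \<rho>\<^sup>2" using g_pos by (intro power_mono) auto
  thus "real (2 * S) * (4 * (real S)\<^sup>2) * \<sigma>\<^sup>2 \<le> \<rho>\<^sup>2" using 2 by linarith
qed

lemma S_sq: "(real S)\<^sup>2 \<le> 4 * x\<^sup>2"
proof -
  have "(real S)\<^sup>2 \<le> (2 * x)\<^sup>2" using S_bounds by (intro power_mono) auto
  thus ?thesis by simp
qed

lemma sqrt_n_x3: "sqrt (real n * x ^ 3) = sqrt (real n) * (x * sqrt x)"
  using x_ge by (simp add: real_sqrt_mult power3_eq_cube)

lemma \<tau>_pos: "0 < \<tau>"
proof -
  have "0 < \<sigma> * sqrt (real n * x ^ 3)" using \<sigma> n_pos x_ge by simp
  thus ?thesis unfolding \<tau> by linarith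
qed

text \<open>\<tau> exceeds \<rho> by at least a constant times a power of ln n. This pays for the
  factor 3 per step and leaves a reserve exp 10 per step, so that powers of order ln n gain a power
  of n; the constant in \<open>big\<close> is chosen for this.\<close>

lemma \<rho>_le_\<tau>: "3 * exp 10 * \<rho> \<le> \<tau>" "3 * \<rho> \<le> \<tau>"
proof -
  have "3 * exp 10 * (2 * real S * sqrt (real n) * \<sigma>) \<le> 3 * exp 10 * (2 * (2 * x) * sqrt (real n) * \<sigma>)"
    using S_bounds \<sigma> by (intro mult_left_mono mult_right_mono) auto
  also have "\<dots> = (12 * exp 10) * (x * sqrt (real n) * \<sigma>)" by simp
  also have "\<dots> \<le> sqrt x * (x * sqrt (real n) * \<sigma>)"
  proof (rule mult_right_mono)
    show "12 * exp 10 \<le> sqrt x" using sqrt_x exp10 by linarith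
  qed (use \<sigma> x_ge in auto)
  also have "\<dots> = \<sigma> * sqrt (real n * x ^ 3)" by (simp add: sqrt_n_x3)
  finally have 1: "3 * exp 10 * (2 * real S * sqrt (real n) * \<sigma>) \<le> \<tau>" unfolding \<tau> by linarith
  have "3 * exp 10 * (4 * (real S)\<^sup>2 * L) \<le> 3 * exp 10 * (4 * (4 * x\<^sup>2) * L)"
    using S_sq L_pos by (intro mult_left_mono mult_right_mono) auto
  also have "\<dots> = (48 * exp 10) * (x\<^sup>2 * L)" by simp
  also have "\<dots> \<le> x * (x\<^sup>2 * L)" using x_48 L_pos by (intro mult_right_mono) auto
  also have "\<dots> = L * x ^ 3" by (simp add: power2_eq_square power3_eq_cube)
  finally have 2: "3 * exp 10 * (4 * (real S)\<^sup>2 * L) \<le> \<tau>" unfolding \<tau> by linarith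
  show *: "3 * exp 10 * \<rho> \<le> \<tau>" using 1 2 unfolding \<rho> by (auto simp: max_def)
  have "3 * 1 * \<rho> \<le> 3 * exp 10 * \<rho>" using exp10 \<rho>_pos by (intro mult_right_mono mult_left_mono) auto
  thus "3 * \<rho> \<le> \<tau>" using * by linarith
qed

lemma T_ge: "1 + C\<^sub>0 \<le> T" "0 < T"
proof -
  have "1 \<le> sqrt (real R)" using R by simp
  hence "16 * C\<^sub>0 * 1 \<le> 16 * C\<^sub>0 * sqrt (real R)" using C\<^sub>0 by (intro mult_left_mono) auto
  hence G: "1 + C\<^sub>0 \<le> 8 + 16 * C\<^sub>0 * sqrt (real R)" using C\<^sub>0 by linarith
  have "1 \<le> 300 * exp (20::real)" using exp10 by linarith
  hence "1 * (8 + 16 * C\<^sub>0 * sqrt (real R)) \<le> T"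
    unfolding T using C\<^sub>0 by (intro mult_right_mono) auto
  from order_trans[OF G this[unfolded mult_1_left]] show "1 + C\<^sub>0 \<le> T" .
  thus "0 < T" using C\<^sub>0 by linarith
qed

lemma \<epsilon>_pos: "0 < \<epsilon>"
  unfolding \<epsilon> using T_ge \<sigma> x_ge by simp

lemma p_sq: "(2 + 2 * real (2 * S))\<^sup>2 \<le> 100 * x\<^sup>2"
proof -
  have "(2 + 2 * real (2 * S))\<^sup>2 \<le> (10 * x)\<^sup>2" using S_bounds x_ge by (intro power_mono) auto
  thus ?thesis by simp
qed

text \<open>Origin of the exponent 7/2: x^2 comes from the choice of end points and x^(3/2) from g.
  The last factor of \<open>T\<close> adds the two parts of g, and 300 = 100 * 3 with 100 from
  \<open>p_sq\<close>.\<close>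

lemma g_le_\<epsilon>: "exp 20 * ((2 + 2 * real (2 * S))\<^sup>2 * (3 * g)) \<le> \<epsilon>"
proof -
  let ?G = "8 + 16 * C\<^sub>0 * sqrt (real R)"
  have "sqrt (8 * real S ^ 3) \<le> 8 * (x * sqrt x)"
  proof (rule real_le_lsqrt)
    have "real S ^ 3 \<le> (2 * x) ^ 3" using S_bounds by (intro power_mono) auto
    hence "8 * real S ^ 3 \<le> 64 * x ^ 3" by simp
    also have "\<dots> = (8 * (x * sqrt x))\<^sup>2" using x_ge by (simp add: power_mult_distrib power2_eq_square power3_eq_cube)
    finally show "8 * real S ^ 3 \<le> (8 * (x * sqrt x))\<^sup>2" .
  qed (use x_ge in simp)
  hence "sqrt (8 * real S ^ 3) * \<sigma> \<le> 8 * (x * sqrt x) * \<sigma>" using \<sigma> by (intro mult_right_mono) auto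
  also have "\<dots> \<le> ?G * (x * sqrt x * \<sigma>)"
    using C\<^sub>0 x_ge \<sigma> by (simp add: distrib_right)
  finally have 1: "sqrt (8 * real S ^ 3) * \<sigma> \<le> ?G * (x * sqrt x * \<sigma>)" .
  have "4 * (real S)\<^sup>2 * L * \<beta> \<le> 4 * (4 * x\<^sup>2) * (C\<^sub>0 * \<sigma> * sqrt (real R) / sqrt x)"
    using mult_mono[OF mult_left_mono[OF S_sq, of 4] L\<beta>] L_pos \<beta> by (simp add: mult.assoc)
  also have "\<dots> = 16 * C\<^sub>0 * sqrt (real R) * (x * (x / sqrt x) * \<sigma>)" by (simp add: power2_eq_square)
  also have "x / sqrt x = sqrt x" using x_ge by (simp add: real_div_sqrt)
  also have "16 * C\<^sub>0 * sqrt (real R) * (x * sqrt x * \<sigma>) \<le> ?G * (x * sqrt x * \<sigma>)"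
    using x_ge \<sigma> by (intro mult_right_mono) auto
  finally have gG: "g \<le> ?G * (x * sqrt x * \<sigma>)" unfolding g using 1 by simp
  have "exp 20 * ((2 + 2 * real (2 * S))\<^sup>2 * (3 * g)) \<le> exp 20 * (100 * x\<^sup>2 * (3 * (?G * (x * sqrt x * \<sigma>))))"
    using p_sq gG g_pos x_ge by (intro mult_left_mono mult_mono) auto
  also have "\<dots> = \<epsilon>" unfolding \<epsilon> T by (simp add: power2_eq_square power3_eq_cube)
  finally show ?thesis .
qed

lemma window_constant: "exp 20 * (2 + 2 * real (2 * S))\<^sup>2 * exp (- 10 * real S) \<le> 1 / real n ^ 5"
proof -
  have "exp (- 10 * real S) \<le> exp (- 10 * x)" using S_bounds by simp
  also have "\<dots> = 1 / real n ^ 10"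
    using exp_of_nat_mult[of 10 x] by (simp add: exp_x exp_minus inverse_eq_divide)
  finally have e: "exp (- 10 * real S) \<le> 1 / real n ^ 10" .
  have "exp 20 * (2 + 2 * real (2 * S))\<^sup>2 \<le> exp 20 * (100 * x\<^sup>2)" using p_sq by (intro mult_left_mono) auto
  also have "\<dots> = (100 * exp 20) * x\<^sup>2" by simp
  also have "\<dots> \<le> real n * (real n)\<^sup>2"
    using x_large x_le_n x_ge by (intro mult_mono power_mono) auto
  also have "\<dots> = real n ^ 3" by (simp add: power2_eq_square power3_eq_cube)
  also have "\<dots> \<le> real n ^ 5" using n_pos by (intro power_increasing) auto
  finally have "exp 20 * (2 + 2 * real (2 * S))\<^sup>2 * exp (- 10 * real S) \<le> real n ^ 5 * (1 / real n ^ 10)"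
    using e by (intro mult_mono) auto
  also have "\<dots> = 1 / real n ^ 5" using n_pos by (simp add: field_simps flip: power_add)
  finally show ?thesis .
qed

text \<open>For s >= 2 S bilinear forms are bounded by summing n^2 entries. The gain n^-5 outweighs
  this loss and the ratio \<tau> / \<epsilon>, which is at most of order \<surd>n.\<close>

lemma tail_constant: "(real n)\<^sup>2 * (1 / real n ^ 5 * \<tau>) \<le> \<epsilon>"
proof -
  have n1: "1 \<le> real n" using n_pos by simp
  have sx: "1 \<le> sqrt x" using x_ge by simp
  have x3: "x \<le> x ^ 3" using x_ge by (intro self_le_power) auto
  have c: "\<sigma> * sqrt (real n) * (x ^ 3 * sqrt x) \<ge> 0" using \<sigma> x_ge by simp
  have "\<sigma> * sqrt (real n) * (x * sqrt x) \<le> \<sigma> * sqrt (real n) * (x ^ 3 * sqrt x)"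
    using x3 \<sigma> x_ge by (intro mult_left_mono mult_right_mono) auto
  hence "\<sigma> * sqrt (real n * x ^ 3) \<le> \<sigma> * sqrt (real n) * (x ^ 3 * sqrt x)"
    unfolding sqrt_n_x3 mult.assoc .
  hence 1: "\<sigma> * sqrt (real n * x ^ 3) \<le> (1 + C\<^sub>0) * (\<sigma> * sqrt (real n) * (x ^ 3 * sqrt x))"
    using mult_nonneg_nonneg[OF less_imp_le[OF C\<^sub>0] c] by (simp add: distrib_right)
  have "L * x ^ 3 \<le> C\<^sub>0 * \<sigma> * sqrt (real n) * (x ^ 3 * sqrt x)"
  proof (rule mult_mono[OF Ln])
    show "x ^ 3 \<le> x ^ 3 * sqrt x" using mult_left_mono[OF sx, of "x ^ 3"] x_ge by simp
  qed (use C\<^sub>0 \<sigma> x_ge in auto)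
  hence 2: "L * x ^ 3 \<le> (1 + C\<^sub>0) * (\<sigma> * sqrt (real n) * (x ^ 3 * sqrt x))"
    using c by (simp add: distrib_right mult.assoc)
  have \<tau>le: "\<tau> \<le> (1 + C\<^sub>0) * (\<sigma> * sqrt (real n) * (x ^ 3 * sqrt x))" using 1 2 by (simp add: \<tau>)
  have "sqrt (real n) \<le> real n" by (rule real_le_lsqrt) (use n1 in \<open>auto simp: power2_eq_square\<close>)
  also have "\<dots> \<le> real n ^ 3" using n1 by (intro self_le_power) auto
  finally have sn: "sqrt (real n) / real n ^ 3 \<le> 1" using n1 by simp
  have "real n ^ 5 = (real n)\<^sup>2 * real n ^ 3" by (simp flip: power_add)
  note n5 = this
  have "(real n)\<^sup>2 * (1 / real n ^ 5 * \<tau>) = \<tau> / real n ^ 3"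
  proof -
    have "(real n)\<^sup>2 * (1 / real n ^ 5 * \<tau>) = ((real n)\<^sup>2 * \<tau>) / ((real n)\<^sup>2 * real n ^ 3)"
      unfolding n5 by (simp only: times_divide_eq_left times_divide_eq_right mult_1_left)
    also have "\<dots> = \<tau> / real n ^ 3" by (rule mult_divide_mult_cancel_left) (use n_pos in simp)
    finally show ?thesis .
  qed
  also have "\<dots> \<le> ((1 + C\<^sub>0) * (\<sigma> * sqrt (real n) * (x ^ 3 * sqrt x))) / real n ^ 3"
    using \<tau>le by (intro divide_right_mono) auto
  also have "\<dots> = (1 + C\<^sub>0) * (\<sigma> * (x ^ 3 * sqrt x)) * (sqrt (real n) / real n ^ 3)" by simp
  also have "\<dots> \<le> (1 + C\<^sub>0) * (\<sigma> * (x ^ 3 * sqrt x)) * 1"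
    using sn C\<^sub>0 \<sigma> x_ge by (intro mult_left_mono) auto
  also have "\<dots> \<le> T * (\<sigma> * (x ^ 3 * sqrt x))"
    unfolding mult_1_right by (rule mult_right_mono[OF T_ge(1)]) (use \<sigma> x_ge in simp)
  also have "\<dots> = \<epsilon>" by (simp add: \<epsilon>)
  finally show ?thesis .
qed

end

section \<open>Union bound over the bad events\<close>

lemma (in prob_space) prob_UN_le:
  assumes "finite I" "\<And>i. i \<in> I \<Longrightarrow> A i \<in> events" "\<And>i. i \<in> I \<Longrightarrow> prob (A i) \<le> c"
  shows "prob (\<Union>i\<in>I. A i) \<le> real (card I) * c"
proof -
  have "prob (\<Union>i\<in>I. A i) \<le> (\<Sum>i\<in>I. prob (A i))"
    using assms by (intro finite_measure_subadditive_finite) auto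
  also have "\<dots> \<le> real (card I) * c" using assms sum_bounded_above[of I "\<lambda>i. prob (A i)" c] by simp
  finally show ?thesis .
qed

lemma bil_unit_vectors:
  assumes "i < n" "j < n"
  shows "bil n A s (\<lambda>k. of_bool (k = i)) (\<lambda>k. of_bool (k = j)) = mpow n A s i j"
proof -
  have "bil n A s (\<lambda>k. of_bool (k = i)) (\<lambda>k. of_bool (k = j))
    = (\<Sum>k<n. \<Sum>l<n. if l = j then (if k = i then mpow n A s k l else 0) else 0)"
    unfolding bil_def by (intro sum.cong) auto
  also have "\<dots> = mpow n A s i j" using assms by simp
  finally show ?thesis .
qed

locale noise_scales = even_moments P h \<sigma> L + scales n R S \<sigma> L C\<^sub>0 x \<beta> \<tau> \<rho> g T \<epsilon>
  for P :: "'w measure" and h \<sigma> L n R S C\<^sub>0 x \<beta> \<tau> \<rho> g T \<epsilon>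
begin

text \<open>The level of \<open>bilinear_tail\<close> for \<kappa> = 20 and p = 2 S.\<close>

definition threshold :: "real \<Rightarrow> nat \<Rightarrow> real" where
  "threshold g' s = exp 20 * ((2 + 2 * real (2 * S))\<^sup>2 * (3 ^ s * (g' * \<rho> ^ (s - 1))))"

text \<open>With p = 2 S >= ln n and \<kappa> = 20, the failure probability exp (- \<kappa> p) is at
  most n^-20. Walks of length s < 2 S have fewer than 4 S^2 steps in total.\<close>

lemma prob_bad_bilinear:
  assumes s: "1 \<le> s" "s < 2 * S" and b: "(\<Sum>i<n. (b i)\<^sup>2) = 1" and c: "(\<Sum>i<n. (c i)\<^sup>2) = 1"
    and cb: "\<And>i. i < n \<Longrightarrow> \<bar>c i\<bar> \<le> \<beta>'" and \<beta>': "0 < \<beta>'" "\<beta>' \<le> 1" and g': "0 < g'" "g' \<le> \<rho>"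
    "real (2 * S) * (4 * (real S)\<^sup>2) * \<sigma>\<^sup>2 \<le> g'\<^sup>2" "4 * (real S)\<^sup>2 * L * \<beta>' \<le> g'"
  shows "prob {\<omega> \<in> space P. threshold g' s \<le> \<bar>bil n (\<lambda>i j. h i j \<omega>) s b c\<bar>} \<le> 1 / real n ^ 20"
proof -
  have "real (2 * S * s) \<le> real (2 * S * (2 * S))" unfolding of_nat_le_iff using s by (intro mult_le_mono2) auto
  hence N: "real (2 * S * s) \<le> 4 * (real S)\<^sup>2" by (simp add: power2_eq_square)
  have "prob {\<omega> \<in> space P. threshold g' s \<le> \<bar>bil n (\<lambda>i j. h i j \<omega>) s b c\<bar>} \<le> exp (- 20 * real (2 * S))"
    unfolding threshold_def
    by (rule bilinear_tail[where \<beta> = \<beta>' and N = "4 * (real S)\<^sup>2"])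
       (use s S_bounds n_pos b c cb \<beta>' g' moment_conditions N in auto)
  also have "\<dots> \<le> exp (- 20 * x)" using S_bounds x_ge by simp
  also have "\<dots> = 1 / real n ^ 20"
    using exp_of_nat_mult[of 20 x] by (simp add: exp_x exp_minus inverse_eq_divide)
  finally show ?thesis .
qed

lemma threshold_le: 
  assumes "1 \<le> s"
  shows "threshold g s \<le> \<epsilon> * \<tau> ^ (s - 1)"
proof -
  have "threshold g s = exp 20 * ((2 + 2 * real (2 * S))\<^sup>2 * (3 * g)) * (3 * \<rho>) ^ (s - 1)"
    unfolding threshold_def using assms by (cases s) (auto simp: power_mult_distrib)
  also have "\<dots> \<le> \<epsilon> * \<tau> ^ (s - 1)"
    using g_le_\<epsilon> \<rho>_le_\<tau> \<rho>_pos \<epsilon>_pos by (intro mult_mono power_mono) auto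
  finally show ?thesis .
qed

text \<open>For s >= S the reserve exp (-10) per step amounts to n^-10, half of which beats the
  polylogarithmic prefactor.\<close>

lemma threshold_entry_le:
  assumes "S \<le> s"
  shows "threshold \<rho> s \<le> 1 / real n ^ 5 * \<tau> ^ s"
proof -
  have s: "0 < s" using assms S_bounds by simp
  have "threshold \<rho> s = exp 20 * (2 + 2 * real (2 * S))\<^sup>2 * (3 * \<rho>) ^ s"
    unfolding threshold_def using s by (cases s) (auto simp: power_mult_distrib)
  also have "\<dots> \<le> exp 20 * (2 + 2 * real (2 * S))\<^sup>2 * (exp (- 10) * \<tau>) ^ s"
  proof (intro mult_left_mono power_mono)
    have "exp (- 10) * (3 * exp 10 * \<rho>) \<le> exp (- 10) * \<tau>" using \<rho>_le_\<tau> by (intro mult_left_mono) auto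
    moreover have "exp (- 10) * (3 * exp 10 * \<rho>) = 3 * \<rho>" by (simp add: exp_minus)
    ultimately show "3 * \<rho> \<le> exp (- 10) * \<tau>" by simp
  qed (use \<rho>_pos in auto)
  also have "\<dots> = exp 20 * (2 + 2 * real (2 * S))\<^sup>2 * exp (- 10) ^ s * \<tau> ^ s" by (simp add: power_mult_distrib)
  also have "exp (- 10 :: real) ^ s \<le> exp (- 10 * real S)"
  proof -
    have "exp (- 10 :: real) ^ s = exp (- 10 * real s)" using exp_of_nat_mult[of s "- 10 :: real"] by (simp add: mult.commute)
    thus ?thesis using assms by simp
  qed
  hence "exp 20 * (2 + 2 * real (2 * S))\<^sup>2 * exp (- 10) ^ s * \<tau> ^ s
    \<le> exp 20 * (2 + 2 * real (2 * S))\<^sup>2 * exp (- 10 * real S) * \<tau> ^ s"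
    using \<tau>_pos by (intro mult_right_mono mult_left_mono) auto
  also have "\<dots> \<le> 1 / real n ^ 5 * \<tau> ^ s"
    using window_constant \<tau>_pos by (intro mult_right_mono) auto
  finally show ?thesis .
qed

lemma abs_le_1_of_unit:
  assumes "(\<Sum>i<n. (c i)\<^sup>2) = (1::real)" "i < n"
  shows "\<bar>c i\<bar> \<le> 1"
proof -
  have "(c i)\<^sup>2 \<le> (\<Sum>i<n. (c i)\<^sup>2)" using assms by (intro member_le_sum) auto
  thus ?thesis by (simp add: assms abs_square_le_1)
qed

text \<open>Forms are controlled directly for s < 2 S; entries are controlled for S <= s < 2 S and
  then for all s >= S by \<open>tail_from_window\<close>; forms with s >= 2 S are sums of such
  entries.\<close>

lemma noise_event:
  fixes U :: "nat \<Rightarrow> nat \<Rightarrow> real" and a :: "nat \<Rightarrow> real"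
  assumes r: "r \<le> R" and U: "\<And>k. k < r \<Longrightarrow> (\<Sum>i<n. (U k i)\<^sup>2) = 1" and U\<beta>: "\<And>k i. k < r \<Longrightarrow> i < n \<Longrightarrow> \<bar>U k i\<bar> \<le> \<beta>"
    and a: "(\<Sum>i<n. (a i)\<^sup>2) = 1"
  shows "\<exists>E\<in>events. 1 - real (R\<^sup>2 + 2 * R + 1) / real n ^ 17 \<le> prob E \<and>
    (\<forall>\<omega>\<in>E. (\<forall>s\<ge>S. \<forall>i<n. \<forall>j<n. \<bar>mpow n (\<lambda>i j. h i j \<omega>) s i j\<bar> \<le> \<tau> ^ s) \<and>
      (\<forall>s\<ge>1. \<forall>k<r. \<forall>l<r. \<bar>bil n (\<lambda>i j. h i j \<omega>) s (U k) (U l)\<bar> \<le> \<epsilon> * \<tau> ^ (s - 1)) \<and>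
      (\<forall>s\<ge>1. \<forall>k<r. \<bar>bil n (\<lambda>i j. h i j \<omega>) s a (U k)\<bar> \<le> \<epsilon> * \<tau> ^ (s - 1)) \<and>
      (\<forall>s\<ge>1. \<forall>k<r. \<bar>bil n (\<lambda>i j. h i j \<omega>) s (U k) a\<bar> \<le> \<epsilon> * \<tau> ^ (s - 1)))"
proof -
  interpret T: noise_scales P "\<lambda>i j. h j i" \<sigma> L n R S C\<^sub>0 x \<beta> \<tau> \<rho> g T \<epsilon>
    by (intro noise_scales.intro even_moments_transposed scales_axioms)
  let ?h = "\<lambda>\<omega> i j. h i j \<omega>"
  define bad where "bad g' s b c = {\<omega> \<in> space P. threshold g' s \<le> \<bar>bil n (?h \<omega>) s b c\<bar>}" for g' s b c
  have bad_ev: "bad g' s b c \<in> events" for g' s b c unfolding bad_def by measurable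
  let ?e = "\<lambda>i k. of_bool (k = i) :: real"
  define I1 where "I1 = {1..<2 * S} \<times> {..<r} \<times> {..<r}"
  define I2 where "I2 = {1..<2 * S} \<times> {..<r}"
  define I4 where "I4 = {S..<2 * S} \<times> {..<n} \<times> {..<n}"
  define B1 where "B1 = (\<Union>(s, k, l)\<in>I1. bad g s (U k) (U l))"
  define B2 where "B2 = (\<Union>(s, k)\<in>I2. bad g s a (U k))"
  define B3 where "B3 = (\<Union>(s, k)\<in>I2. bad g s (U k) a)"
  define B4 where "B4 = (\<Union>(s, i, j)\<in>I4. bad \<rho> s (?e i) (?e j))"
  let ?c = "1 / real n ^ 20"
  have fin: "finite I1" "finite I2" "finite I4" by (auto simp: I1_def I2_def I4_def)
  have p1: "prob (bad g s b (U k)) \<le> ?c" if "1 \<le> s" "s < 2 * S" "k < r" "(\<Sum>i<n. (b i)\<^sup>2) = 1" for s k b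
    unfolding bad_def
    by (rule prob_bad_bilinear[where \<beta>' = \<beta>]) (use that U U\<beta> \<beta> g_pos moment_conditions in auto)
  \<comment> \<open>The incoherent vector stands on the left here, hence the transposed
    noise.\<close>
  have p3: "prob (bad g s (U k) a) \<le> ?c" if "1 \<le> s" "s < 2 * S" "k < r" for s k
  proof -
    have "bad g s (U k) a = {\<omega> \<in> space P. T.threshold g s \<le> \<bar>bil n (\<lambda>i j. h j i \<omega>) s a (U k)\<bar>}"
      unfolding bad_def bil_transpose[of n "\<lambda>i j. h i j _"] threshold_def T.threshold_def ..
    also have "prob \<dots> \<le> ?c"
      by (rule T.prob_bad_bilinear[where \<beta>' = \<beta>]) (use that U U\<beta> \<beta> g_pos moment_conditions a in auto)
    finally show ?thesis .
  qed
  have unit: "(\<Sum>k<n. (?e i k)\<^sup>2) = 1" if "i < n" for i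
    using that by (simp add: of_bool_def if_distrib[of "\<lambda>x. x\<^sup>2"] cong: if_cong)
  have p4: "prob (bad \<rho> s (?e i) (?e j)) \<le> ?c" if "S \<le> s" "s < 2 * S" "i < n" "j < n" for s i j
    unfolding bad_def
    by (rule prob_bad_bilinear[where \<beta>' = 1]) (use that S_bounds \<rho>_pos moment_conditions unit in auto)
  have B1: "prob B1 \<le> real (card I1) * ?c"
    unfolding B1_def by (rule prob_UN_le) (use fin bad_ev p1 U in \<open>auto simp: I1_def\<close>)
  have B2: "prob B2 \<le> real (card I2) * ?c"
    unfolding B2_def by (rule prob_UN_le) (use fin bad_ev p1 a in \<open>auto simp: I2_def\<close>)
  have B3: "prob B3 \<le> real (card I2) * ?c"
    unfolding B3_def by (rule prob_UN_le) (use fin bad_ev p3 in \<open>auto simp: I2_def\<close>)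
  have B4: "prob B4 \<le> real (card I4) * ?c"
    unfolding B4_def by (rule prob_UN_le) (use fin bad_ev p4 in \<open>auto simp: I4_def\<close>)
  have ev: "B1 \<in> events" "B2 \<in> events" "B3 \<in> events" "B4 \<in> events"
    unfolding B1_def B2_def B3_def B4_def using fin bad_ev by (auto intro!: sets.finite_UN)
  define E where "E = space P - (B1 \<union> B2 \<union> B3 \<union> B4)"
  have "prob (B1 \<union> B2 \<union> B3 \<union> B4) \<le> prob B1 + prob B2 + prob B3 + prob B4"
    using ev by (intro order_trans[OF measure_Un_le] add_right_mono) auto
  also have "\<dots> \<le> (real (card I1) + 2 * real (card I2) + real (card I4)) * ?c"
    using B1 B2 B3 B4 unfolding distrib_right mult.assoc by linarith
  also have "\<dots> \<le> real (R\<^sup>2 + 2 * R + 1) * real n ^ 3 * ?c"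
  proof (rule mult_right_mono)
    have Sn: "2 * S \<le> n" using S_bounds four_x_le_n by linarith
    have n3: "n \<le> n ^ 3" using n_pos by (intro self_le_power) auto
    have "card I1 \<le> n ^ 3 * R\<^sup>2"
      unfolding I1_def card_cartesian_product power2_eq_square using r Sn n3 by (intro mult_le_mono) auto
    moreover have "card I2 \<le> n ^ 3 * R"
      unfolding I2_def card_cartesian_product using r Sn n3 by (intro mult_le_mono) auto
    moreover have "card I4 \<le> n ^ 3"
    proof -
      have "card I4 = S * (n * n)" by (simp add: I4_def)
      also have "\<dots> \<le> n * (n * n)" using Sn by (intro mult_le_mono) auto
      finally show ?thesis by (simp add: power3_eq_cube)
    qed
    ultimately have "card I1 + 2 * card I2 + card I4 \<le> (R\<^sup>2 + 2 * R + 1) * n ^ 3"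
      by (simp add: algebra_simps)
    hence "real (card I1 + 2 * card I2 + card I4) \<le> real ((R\<^sup>2 + 2 * R + 1) * n ^ 3)"
      by (simp only: of_nat_le_iff)
    thus "real (card I1) + 2 * real (card I2) + real (card I4) \<le> real (R\<^sup>2 + 2 * R + 1) * real n ^ 3"
      by (simp only: of_nat_add of_nat_mult of_nat_power of_nat_numeral of_nat_1)
  qed simp
  also have "\<dots> = real (R\<^sup>2 + 2 * R + 1) / real n ^ 17"
  proof -
    have n20: "real n ^ 20 = real n ^ 3 * real n ^ 17" by (simp flip: power_add)
    have "real (R\<^sup>2 + 2 * R + 1) * real n ^ 3 * ?c
      = (real n ^ 3 * real (R\<^sup>2 + 2 * R + 1)) / (real n ^ 3 * real n ^ 17)"
      unfolding n20 by (simp only: times_divide_eq_right mult_1_right mult.commute[of _ "real n ^ 3"])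
    also have "\<dots> = real (R\<^sup>2 + 2 * R + 1) / real n ^ 17"
      by (rule mult_divide_mult_cancel_left) (use n_pos in simp)
    finally show ?thesis .
  qed
  finally have pE: "1 - real (R\<^sup>2 + 2 * R + 1) / real n ^ 17 \<le> prob E"
    unfolding E_def using ev by (subst prob_compl) auto
  have main: "(\<forall>s\<ge>S. \<forall>i<n. \<forall>j<n. \<bar>mpow n (?h \<omega>) s i j\<bar> \<le> \<tau> ^ s) \<and>
      (\<forall>s\<ge>1. \<forall>k<r. \<forall>l<r. \<bar>bil n (?h \<omega>) s (U k) (U l)\<bar> \<le> \<epsilon> * \<tau> ^ (s - 1)) \<and>
      (\<forall>s\<ge>1. \<forall>k<r. \<bar>bil n (?h \<omega>) s a (U k)\<bar> \<le> \<epsilon> * \<tau> ^ (s - 1)) \<and>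
      (\<forall>s\<ge>1. \<forall>k<r. \<bar>bil n (?h \<omega>) s (U k) a\<bar> \<le> \<epsilon> * \<tau> ^ (s - 1))" if \<omega>: "\<omega> \<in> E" for \<omega>
  proof -
    have sp: "\<omega> \<in> space P" and nB: "\<omega> \<notin> B1" "\<omega> \<notin> B2" "\<omega> \<notin> B3" "\<omega> \<notin> B4" using \<omega> by (auto simp: E_def)
    have good: "\<bar>bil n (?h \<omega>) s b c\<bar> \<le> threshold g' s" if "\<omega> \<notin> bad g' s b c" for g' s b c
      using that sp by (auto simp: bad_def)
    have n1: "1 \<le> real n" using n_pos by simp
    have n5: "1 \<le> real n ^ 5" using n1 by simp
    have tail: "\<bar>mpow n (?h \<omega>) s i j\<bar> \<le> 1 / real n ^ 5 * \<tau> ^ s" if "S \<le> s" "i < n" "j < n" for s i j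
    proof (rule tail_from_window[where S = S])
      fix s i j assume *: "S \<le> s" "s < 2 * S" "i < n" "j < n"
      have "\<omega> \<notin> bad \<rho> s (?e i) (?e j)" using nB(4) * by (auto simp: B4_def I4_def)
      from good[OF this] show "\<bar>mpow n (?h \<omega>) s i j\<bar> \<le> 1 / real n ^ 5 * \<tau> ^ s"
        using threshold_entry_le[OF *(1)] by (simp add: bil_unit_vectors *)
    next
      have "real n * (1 / real n ^ 5) = real n / real n ^ 5" by simp
      also have "\<dots> \<le> 1" using n1 self_le_power[of "real n" 5] by (simp add: divide_le_eq)
      finally show "real n * (1 / real n ^ 5) \<le> 1" .
    qed (use that S_bounds \<tau>_pos in auto)
    have big: "\<bar>bil n (?h \<omega>) s b c\<bar> \<le> \<epsilon> * \<tau> ^ (s - 1)"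
      if "2 * S \<le> s" "(\<Sum>i<n. (b i)\<^sup>2) = 1" "(\<Sum>i<n. (c i)\<^sup>2) = 1" for s b c
    proof -
      have "\<bar>bil n (?h \<omega>) s b c\<bar> \<le> (real n)\<^sup>2 * (1 / real n ^ 5 * \<tau> ^ s)"
        using that tail[of s] by (intro abs_bil_le) (auto intro: abs_le_1_of_unit)
      also have "\<tau> ^ s = \<tau> * \<tau> ^ (s - 1)" using that(1) S_bounds by (cases s) auto
      also have "(real n)\<^sup>2 * (1 / real n ^ 5 * (\<tau> * \<tau> ^ (s - 1))) = ((real n)\<^sup>2 * (1 / real n ^ 5 * \<tau>)) * \<tau> ^ (s - 1)" by simp
      also have "\<dots> \<le> \<epsilon> * \<tau> ^ (s - 1)" using tail_constant \<tau>_pos by (intro mult_right_mono) auto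
      finally show ?thesis .
    qed
    have all: "\<bar>bil n (?h \<omega>) s b c\<bar> \<le> \<epsilon> * \<tau> ^ (s - 1)"
      if "1 \<le> s" "(\<Sum>i<n. (b i)\<^sup>2) = 1" "(\<Sum>i<n. (c i)\<^sup>2) = 1" "s < 2 * S \<Longrightarrow> \<omega> \<notin> bad g s b c" for s b c
      using big[of s b c] good[of g s b c] threshold_le[of s] that by (cases "s < 2 * S") auto
    have small_n: "1 / real n ^ 5 * \<tau> ^ s \<le> \<tau> ^ s" for s
      using n5 \<tau>_pos by (simp add: divide_le_eq mult_le_cancel_left1)
    show ?thesis
    proof (intro conjI allI impI)
      show "\<bar>mpow n (?h \<omega>) s i j\<bar> \<le> \<tau> ^ s" if "S \<le> s" "i < n" "j < n" for s i j
        using tail[OF that] small_n[of s] by linarith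
      show "\<bar>bil n (?h \<omega>) s (U k) (U l)\<bar> \<le> \<epsilon> * \<tau> ^ (s - 1)" if "1 \<le> s" "k < r" "l < r" for s k l
        using that nB(1) U by (intro all) (auto simp: B1_def I1_def)
      show "\<bar>bil n (?h \<omega>) s a (U k)\<bar> \<le> \<epsilon> * \<tau> ^ (s - 1)" if "1 \<le> s" "k < r" for s k
        using that nB(2) U a by (intro all) (auto simp: B2_def I2_def)
      show "\<bar>bil n (?h \<omega>) s (U k) a\<bar> \<le> \<epsilon> * \<tau> ^ (s - 1)" if "1 \<le> s" "k < r" for s k
        using that nB(3) U a by (intro all) (auto simp: B3_def I2_def)
    qed
  qed
  show ?thesis
  proof (rule bexI[of _ E], rule conjI[OF pE], rule ballI)
    show "E \<in> events" unfolding E_def using ev by auto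
  qed (rule main)
qed

end

section \<open>The theorem\<close>

lemma INF_ereal_eq_Min:
  assumes "finite A" "A \<noteq> {}"
  shows "(INF k\<in>A. ereal (f k)) = ereal (Min (f ` A))"
proof (rule antisym)
  have "Min (f ` A) \<in> f ` A" using assms by (intro Min_in) auto
  then obtain k where "k \<in> A" "Min (f ` A) = f k" by auto
  thus "(INF k\<in>A. ereal (f k)) \<le> ereal (Min (f ` A))" by (auto intro: INF_lower)
  show "ereal (Min (f ` A)) \<le> (INF k\<in>A. ereal (f k))"
    using assms by (intro INF_greatest) simp
qed

text \<open>Here \<open>q\<close> stands for \<open>1 / (\<delta>\<^sub>l)\<^sup>2\<close>, which is \<open>0\<close> if \<open>r = 1\<close>.\<close>

lemma le_error_bound:
  assumes l: "l < r" and C: "0 \<le> C"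
    and gap: "\<And>k. k < r \<Longrightarrow> k \<noteq> l \<Longrightarrow> 0 < \<bar>lam l - lam k\<bar>"
    and B: "\<And>q. 0 \<le> q \<Longrightarrow> (\<And>k. k < r \<Longrightarrow> k \<noteq> l \<Longrightarrow> 1 / \<bar>lam l - lam k\<bar>\<^sup>2 \<le> q) \<Longrightarrow>
        (\<forall>k. k < r \<longrightarrow> k \<noteq> l \<longrightarrow> q \<le> 1 / (Min ((\<lambda>k. \<bar>lam l - lam k\<bar>) ` ({..<r} - {l})))\<^sup>2) \<Longrightarrow>
        ({..<r} - {l} = {} \<Longrightarrow> q = 0) \<Longrightarrow>
      B \<le> C * ((1 / lam_min r lam + Max (insert 0 ((\<lambda>k. \<bar>a \<bullet> col U k\<bar> / \<bar>lam l - lam k\<bar>) ` ({..<r} - {l}))))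
            * sqrt (\<sigma>\<^sup>2 * ln (real n) ^ 7)) + C * (\<bar>a \<bullet> col U l\<bar> * (\<sigma>\<^sup>2 * ln (real n) ^ 7) * q)"
  shows "ereal B \<le> ereal C * error_bound n r U lam \<sigma> a l"
proof (cases "{..<r} - {l} = {}")
  case True
  have "eigengap r lam l = \<infinity>" unfolding eigengap_def True by (simp add: top_ereal_def)
  hence "(eigengap r lam l)\<^sup>2 = \<infinity>" by (simp add: power2_eq_square)
  moreover have "B \<le> C * ((1 / lam_min r lam + Max (insert 0 ((\<lambda>k. \<bar>a \<bullet> col U k\<bar> / \<bar>lam l - lam k\<bar>) ` ({..<r} - {l}))))
            * sqrt (\<sigma>\<^sup>2 * ln (real n) ^ 7)) + C * (\<bar>a \<bullet> col U l\<bar> * (\<sigma>\<^sup>2 * ln (real n) ^ 7) * 0)"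
    by (rule B) (use True in auto)
  ultimately show ?thesis unfolding error_bound_def by simp
next
  case False
  define \<delta> where "\<delta> = Min ((\<lambda>k. \<bar>lam l - lam k\<bar>) ` ({..<r} - {l}))"
  have "\<delta> \<in> (\<lambda>k. \<bar>lam l - lam k\<bar>) ` ({..<r} - {l})" unfolding \<delta>_def using False by (intro Min_in) auto
  then obtain k where "k < r" "k \<noteq> l" "\<delta> = \<bar>lam l - lam k\<bar>" by auto
  hence \<delta>0: "0 < \<delta>" using gap[of k] by simp
  have \<delta>: "\<delta> \<le> \<bar>lam l - lam k\<bar>" if "k < r" "k \<noteq> l" for k unfolding \<delta>_def using that by (intro Min_le) auto
  have eg: "eigengap r lam l = ereal \<delta>" unfolding eigengap_def \<delta>_def using False by (intro INF_ereal_eq_Min) auto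
  have "B \<le> C * ((1 / lam_min r lam + Max (insert 0 ((\<lambda>k. \<bar>a \<bullet> col U k\<bar> / \<bar>lam l - lam k\<bar>) ` ({..<r} - {l}))))
            * sqrt (\<sigma>\<^sup>2 * ln (real n) ^ 7)) + C * (\<bar>a \<bullet> col U l\<bar> * (\<sigma>\<^sup>2 * ln (real n) ^ 7) * (1 / \<delta>\<^sup>2))"
  proof (rule B)
    show "1 / \<bar>lam l - lam k\<bar>\<^sup>2 \<le> 1 / \<delta>\<^sup>2" if "k < r" "k \<noteq> l" for k
      using \<delta>[OF that] \<delta>0 by (intro divide_left_mono power_mono mult_pos_pos zero_less_power) auto
  qed (use False in \<open>auto simp: \<delta>_def\<close>)
  thus ?thesis unfolding error_bound_def eg using \<delta>0 by (simp add: distrib_left)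
qed

lemma min_eigengap_le:
  assumes "ereal c \<le> min_eigengap r lam" "i < r" "j < r" "i \<noteq> j"
  shows "c \<le> \<bar>lam i - lam j\<bar>"
proof -
  have "min_eigengap r lam \<le> eigengap r lam i" unfolding min_eigengap_def using assms by (intro INF_lower) auto
  also have "\<dots> \<le> ereal \<bar>lam i - lam j\<bar>" unfolding eigengap_def using assms by (intro INF_lower) auto
  finally show ?thesis using assms(1) by (metis ereal_less_eq(3) order_trans)
qed

text \<open>The squared row norms sum to r, so the largest is at least the average r / n.
  \<open>\<beta>0\<close> is the largest row norm.\<close>

lemma incoherence_facts:
  assumes lr: "low_rank_factors n r U lam" and n: "0 < n"
  obtains \<beta>0 where "0 < \<beta>0" "incoherence n r U = real n / real r * \<beta>0\<^sup>2" "1 \<le> incoherence n r U"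
    "\<And>i k. i < n \<Longrightarrow> k < r \<Longrightarrow> \<bar>U $$ (i, k)\<bar> \<le> \<beta>0"
proof -
  have U: "U \<in> carrier_mat n r" and r: "0 < r" using lr by (auto simp: low_rank_factors_def)
  define f where "f i = (l2_norm (row U i))\<^sup>2" for i
  have f: "f i = (\<Sum>k<r. (U $$ (i, k))\<^sup>2)" if "i < n" for i
    using U that by (simp add: f_def l2_norm_def L2_set_def sum_nonneg)
  define mx where "mx = Max (f ` {..<n})"
  have fm: "f i \<le> mx" if "i < n" for i unfolding mx_def using that by auto
  have "real r = (\<Sum>k<r. \<Sum>i<n. (U $$ (i, k))\<^sup>2)"
    using columns_orthonormal[OF lr] by (simp add: power2_eq_square)
  also have "\<dots> = (\<Sum>i<n. f i)" by (subst sum.swap) (simp add: f)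
  also have "\<dots> \<le> real n * mx" using sum_bounded_above[of "{..<n}" f mx] fm by auto
  finally have rn: "real r \<le> real n * mx" .
  have mx: "0 < mx"
  proof (rule ccontr)
    assume "\<not> 0 < mx"
    hence "real n * mx \<le> 0" by (simp add: mult_nonneg_nonpos)
    thus False using rn r by simp
  qed
  have inc: "incoherence n r U = real n / real r * mx" by (simp add: incoherence_def mx_def f_def)
  show thesis
  proof (rule that[of "sqrt mx"])
    show "incoherence n r U = real n / real r * (sqrt mx)\<^sup>2" using mx by (simp add: inc)
    show "1 \<le> incoherence n r U" using rn r by (simp add: inc field_simps)
    show "\<bar>U $$ (i, k)\<bar> \<le> sqrt mx" if "i < n" "k < r" for i k
    proof (rule real_le_rsqrt)
      have "(U $$ (i, k))\<^sup>2 \<le> f i" unfolding f[OF that(1)] using that(2) by (intro member_le_sum) auto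
      thus "\<bar>U $$ (i, k)\<bar>\<^sup>2 \<le> mx" using fm[OF that(1)] by simp
    qed
  qed (use mx in simp)
qed

lemma l2_norm_eq_1:
  fixes a :: "real Matrix.vec"
  assumes "a \<in> carrier_vec n" "l2_norm a = 1"
  shows "(\<Sum>i<n. (a $ i)\<^sup>2) = 1"
  using assms by (simp add: l2_norm_def L2_set_def)

text \<open>The second inequality compares \<sigma> ln^(7/2) n, the size of \<eta>, with \<sigma>
  \<surd>(n ln^3 n), the lower bound for the eigenvalues: their quotient is ln^2 n /
  \<surd>n.\<close>

lemma eventually_scales:
  fixes A B :: real
  shows "\<exists>N. \<forall>n\<ge>N. B \<le> ln (real n) \<and> A * ln (real n) ^ 2 \<le> sqrt (real n)"
proof -
  have "eventually (\<lambda>n. B \<le> ln (real n)) sequentially"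
    by real_asymp
  moreover have "eventually (\<lambda>n. \<bar>A\<bar> * ln (real n) ^ 2 \<le> sqrt (real n)) sequentially"
  proof -
    have "(\<lambda>n. ln (real n) ^ 2 / sqrt (real n)) \<longlonglongrightarrow> 0" by real_asymp
    hence "eventually (\<lambda>n. ln (real n) ^ 2 / sqrt (real n) < 1 / (\<bar>A\<bar> + 1)) sequentially"
      by (rule order_tendstoD(2)) simp
    with eventually_gt_at_top[of 0] show ?thesis
    proof eventually_elim
      case (elim n)
      have "(\<bar>A\<bar> + 1) * ln (real n) ^ 2 \<le> sqrt (real n)" using elim by (simp add: field_simps)
      moreover have "0 \<le> ln (real n) ^ 2" by simp
      ultimately show ?case by (simp only: distrib_right mult_1_left)
    qed
  qed
  ultimately have "eventually (\<lambda>n. B \<le> ln (real n) \<and> A * ln (real n) ^ 2 \<le> sqrt (real n)) sequentially"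
  proof eventually_elim
    case (elim n)
    have "A * ln (real n) ^ 2 \<le> \<bar>A\<bar> * ln (real n) ^ 2" by (intro mult_right_mono) auto
    thus ?case using elim by linarith
  qed
  thus ?thesis by (simp add: eventually_sequentially)
qed

lemma ln_powers:
  assumes "0 < x" "0 \<le> \<sigma>"
  shows "x powr (7 / 2) = x ^ 3 * sqrt x" "sqrt (\<sigma>\<^sup>2 * x ^ 7) = \<sigma> * (x ^ 3 * sqrt x)"
    "(\<sigma> * (x ^ 3 * sqrt x))\<^sup>2 = \<sigma>\<^sup>2 * x ^ 7"
proof -
  have "x powr (7 / 2) = x powr (3 + 1 / 2)" by simp
  also have "\<dots> = x ^ 3 * sqrt x" using assms by (subst powr_add) (simp add: powr_half_sqrt)
  finally show "x powr (7 / 2) = x ^ 3 * sqrt x" .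
  show sq: "(\<sigma> * (x ^ 3 * sqrt x))\<^sup>2 = \<sigma>\<^sup>2 * x ^ 7"
  proof -
    have "(\<sigma> * (x ^ 3 * sqrt x))\<^sup>2 = \<sigma>\<^sup>2 * ((x ^ 3)\<^sup>2 * x)" using assms by (simp add: power_mult_distrib)
    also have "(x ^ 3)\<^sup>2 * x = x ^ 7" by (simp flip: power_mult power_Suc2)
    finally show ?thesis .
  qed
  show "sqrt (\<sigma>\<^sup>2 * x ^ 7) = \<sigma> * (x ^ 3 * sqrt x)"
    unfolding sq[symmetric] using assms by simp
qed

text \<open>The event is chosen before \<open>z\<close>, \<open>u\<close> and \<open>w\<close>, so
  the bound holds for every admissible choice of eigenpairs at once, and no measurable selection of
  eigenvectors enters.\<close>

theorem theorem16:
  fixes C\<^sub>0 c\<^sub>1 c\<^sub>2 K :: real and R :: nat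
  assumes "C\<^sub>0 > 0" and "c\<^sub>1 > 0" and "c\<^sub>2 > 0"
  shows
    "\<exists>C\<^sub>1>0. \<forall>C\<ge>C\<^sub>1. \<exists>C'>0. \<exists>C''>0. \<exists>N. \<forall>n\<ge>N.
     \<forall>(r::nat) U lam (P :: 'w measure) H \<sigma>_min \<sigma> L a l.
       prob_space P \<longrightarrow>
       noise_conditions P n H \<sigma>_min \<sigma> L \<longrightarrow>
       c\<^sub>1 \<le> \<sigma>\<^sup>2 / \<sigma>_min\<^sup>2 \<longrightarrow> \<sigma>\<^sup>2 / \<sigma>_min\<^sup>2 \<le> c\<^sub>2 \<longrightarrow>
       low_rank_factors n r U lam \<longrightarrow>
       \<sigma> \<le> L \<longrightarrow> L \<le> C\<^sub>0 * \<sigma> * sqrt (real n / (incoherence n r U * ln (real n))) \<longrightarrow>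
       cond_num r lam \<le> K \<longrightarrow> r \<le> R \<longrightarrow>
       lam_min r lam \<ge> C * max (\<sigma> * sqrt (real n * ln (real n) ^ 3)) (L * ln (real n) ^ 3) \<longrightarrow>
       min_eigengap r lam \<ge>
         ereal (C * cond_num r lam ^ 3 * real r ^ 2 *
                max (incoherence n r U * L * ln (real n) ^ 5 / real n)
                    (\<sigma> * ln (real n) powr (7 / 2))) \<longrightarrow>
       a \<in> carrier_vec n \<longrightarrow> l2_norm a = 1 \<longrightarrow> l < r \<longrightarrow>
       (\<exists>E \<in> sets P. measure P E \<ge> 1 - C'' / real n ^ 17 \<and>
          (\<forall>\<omega>\<in>E. \<forall>z u w.
             let M = map_mat complex_of_real (low_rank_mat r U lam + H \<omega>) in
               leading_eigenvalues M r z \<longrightarrow> matched_eigenvalues r lam z \<longrightarrow>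
               eigenvector M u (z l) \<longrightarrow> eigenvector (transpose_mat M) w (z l) \<longrightarrow>
               l2_norm u = 1 \<longrightarrow> l2_norm w = 1 \<longrightarrow>
               ereal (min_pm (u_hat a u w) (a \<bullet> col U l))
                 \<le> ereal C' * error_bound n r U lam \<sigma> a l))"
proof -
  define K1 where "K1 = max K 1"
  define T where "T = 300 * exp 20 * (8 + 16 * C\<^sub>0 * sqrt (real R))"
  \<comment> \<open>The first summand makes every gap at least 4 (1 + R K1) \<eta>, where \<eta> = 8
    r K1 \<epsilon> gives 32 = 4 * 8; the 4 yields 4 \<tau> <= lam_min.\<close>
  define C\<^sub>1 where "C\<^sub>1 = 32 * K1 * T * (1 + real R * K1) + 4"
  \<comment> \<open>Substituting \<eta> = 8 r K1 T E1 in \<open>estimator_error\<close> gives 48 = 6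
    * 8 for the first error term and 64 = 8^2 for the second, which is quadratic in \<eta>.\<close>
  define C' where "C' = 48 * (real R)\<^sup>2 * K1\<^sup>2 * T + 64 * (real R) ^ 3 * K1 ^ 3 * T\<^sup>2 + 1"
  define C'' where "C'' = real (R\<^sup>2 + 2 * R + 1)"
  have K1: "1 \<le> K1" "K \<le> K1" by (auto simp: K1_def)
  have T0: "0 < T" unfolding T_def using assms by (intro mult_pos_pos add_pos_nonneg) auto
  have C1: "4 \<le> C\<^sub>1" unfolding C\<^sub>1_def using K1 T0 by simp
  have C'0: "0 < C'" unfolding C'_def using K1 T0 by (intro add_nonneg_pos add_nonneg_nonneg mult_nonneg_nonneg) auto
  have C''0: "0 < C''" unfolding C''_def by (simp only: of_nat_0_less_iff)
  obtain N where N: "\<And>n. N \<le> n \<Longrightarrow> (48 * exp 10)\<^sup>2 \<le> ln (real n) \<and>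
      (16 * (1 + real R * K1) * (8 * real R * K1 * T)) * ln (real n) ^ 2 \<le> sqrt (real n)"
    using eventually_scales by blast
  have core: "\<exists>E \<in> sets P. measure P E \<ge> 1 - C'' / real n ^ 17 \<and>
          (\<forall>\<omega>\<in>E. \<forall>z u w.
               leading_eigenvalues (map_mat complex_of_real (low_rank_mat r U lam + H \<omega>)) r z \<longrightarrow> matched_eigenvalues r lam z \<longrightarrow>
               eigenvector (map_mat complex_of_real (low_rank_mat r U lam + H \<omega>)) u (z l) \<longrightarrow>
               eigenvector (transpose_mat (map_mat complex_of_real (low_rank_mat r U lam + H \<omega>))) w (z l) \<longrightarrow>
               ereal (min_pm (u_hat a u w) (a \<bullet> col U l))
                 \<le> ereal C' * error_bound n r U lam \<sigma> a l)"
    if C: "C\<^sub>1 \<le> C" and n: "N \<le> n" and P: "prob_space P" and nc: "noise_conditions P n H \<sigma>_min \<sigma> L"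
      and lr: "low_rank_factors n r U lam" and \<sigma>L: "\<sigma> \<le> L"
      and Lle: "L \<le> C\<^sub>0 * \<sigma> * sqrt (real n / (incoherence n r U * ln (real n)))"
      and \<kappa>: "cond_num r lam \<le> K" and rR: "r \<le> R"
      and mC: "C * max (\<sigma> * sqrt (real n * ln (real n) ^ 3)) (L * ln (real n) ^ 3) \<le> lam_min r lam"
      and gap: "ereal (C * cond_num r lam ^ 3 * real r ^ 2 *
                max (incoherence n r U * L * ln (real n) ^ 5 / real n)
                    (\<sigma> * ln (real n) powr (7 / 2))) \<le> min_eigengap r lam"
      and a: "a \<in> carrier_vec n" "l2_norm a = 1" and l: "l < r"
    for C n r U lam and P :: "'w measure" and H \<sigma>_min \<sigma> L a l
  proof -
    define x where "x = ln (real n)"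
    have big: "(48 * exp 10)\<^sup>2 \<le> x" and nbig: "(16 * (1 + real R * K1) * (8 * real R * K1 * T)) * x ^ 2 \<le> sqrt (real n)"
      using N[OF n] unfolding x_def by blast+
    have x0: "0 < x" using big by (meson exp_gt_zero less_le_trans mult_pos_pos zero_less_numeral zero_less_power)
    have x1: "1 \<le> x"
    proof -
      have "1 \<le> 48 * exp (10::real)" by (rule order_trans[of _ "exp 10"]) simp_all
      hence "1 \<le> (48 * exp (10::real))\<^sup>2" by (rule one_le_power)
      thus ?thesis using big by linarith
    qed
    have n0: "0 < n" using x0 by (cases "n = 0") (auto simp: x_def)
    have \<sigma>: "0 < \<sigma>" using nc by (simp add: noise_conditions_def)
    have r: "0 < r" using l by simp
    have R: "0 < R" using r rR by simp
    note m = lam_min_le(3)[OF lr l]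
    obtain \<beta>0 where \<beta>0: "0 < \<beta>0" "incoherence n r U = real n / real r * \<beta>0\<^sup>2" "1 \<le> incoherence n r U"
      "\<And>i k. i < n \<Longrightarrow> k < r \<Longrightarrow> \<bar>U $$ (i, k)\<bar> \<le> \<beta>0"
      using incoherence_facts[OF lr n0] by blast
    \<comment> \<open>The moment bound requires \<beta> <= 1; truncation is harmless because entries
      of unit vectors have modulus at most 1.\<close>
    define \<beta> where "\<beta> = min 1 \<beta>0"
    define S where "S = nat \<lceil>x\<rceil>"
    define \<tau> where "\<tau> = max (\<sigma> * sqrt (real n * x ^ 3)) (L * x ^ 3)"
    define \<rho> where "\<rho> = max (2 * real S * sqrt (real n) * \<sigma>) (4 * (real S)\<^sup>2 * L)"
    define g where "g = max (sqrt (8 * real S ^ 3) * \<sigma>) (4 * (real S)\<^sup>2 * L * \<beta>)"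
    define E1 where "E1 = \<sigma> * (x ^ 3 * sqrt x)"
    define \<epsilon> where "\<epsilon> = T * \<sigma> * (x ^ 3 * sqrt x)"
    have \<epsilon>E: "\<epsilon> = T * E1" by (simp add: \<epsilon>_def E1_def)
    have E10: "0 < E1" using \<sigma> x0 by (simp add: E1_def)
    have L0: "0 < L" using \<sigma> \<sigma>L by linarith
    have Ln: "L \<le> C\<^sub>0 * \<sigma> * sqrt (real n)"
    proof (rule order_trans[OF Lle mult_left_mono])
      have "1 * 1 \<le> incoherence n r U * x" using \<beta>0(3) x1 by (intro mult_mono) auto
      hence "real n / (incoherence n r U * x) \<le> real n / 1" by (intro divide_left_mono) auto
      thus "sqrt (real n / (incoherence n r U * ln (real n))) \<le> sqrt (real n)" by (simp add: x_def)
    qed (use assms \<sigma> in simp)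
    \<comment> \<open>The incoherence equals n \<beta>0^2 / r, so in the upper bound for L both n
      and \<beta>0 cancel and the square root of r / x remains.\<close>
    have L\<beta>: "L * \<beta> \<le> C\<^sub>0 * \<sigma> * sqrt (real R) / sqrt x"
    proof -
      have "L * \<beta> \<le> L * \<beta>0" using L0 by (intro mult_left_mono) (auto simp: \<beta>_def)
      also have "\<dots> \<le> C\<^sub>0 * \<sigma> * sqrt (real n / (incoherence n r U * x)) * \<beta>0"
        using Lle \<beta>0(1) by (intro mult_right_mono) (auto simp: x_def)
      also have "real n / (incoherence n r U * x) = real r / x / \<beta>0\<^sup>2"
        unfolding \<beta>0(2) using n0 r x0 \<beta>0(1) by simp
      also have "C\<^sub>0 * \<sigma> * sqrt (real r / x / \<beta>0\<^sup>2) * \<beta>0 = C\<^sub>0 * \<sigma> * (sqrt (real r) / sqrt x)"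
      proof -
        have "sqrt (real r / x / \<beta>0\<^sup>2) = sqrt (real r) / sqrt x / \<beta>0"
          using \<beta>0(1) by (simp only: real_sqrt_divide real_sqrt_abs abs_of_pos)
        thus ?thesis using \<beta>0(1) by simp
      qed
      also have "\<dots> \<le> C\<^sub>0 * \<sigma> * (sqrt (real R) / sqrt x)"
        using assms \<sigma> x0 rR by (intro mult_left_mono divide_right_mono) auto
      finally show ?thesis by simp
    qed
    interpret noise_scales P "noise_entry n H" \<sigma> L n R S C\<^sub>0 x \<beta> \<tau> \<rho> g T \<epsilon>
    proof (intro noise_scales.intro even_moments_noise[OF P nc \<sigma>L])
      show "scales n R S \<sigma> L C\<^sub>0 x \<beta> \<tau> \<rho> g T \<epsilon>"
        by unfold_locales (fact x_def big S_def R \<sigma> \<sigma>L assms(1) L\<beta> Ln \<tau>_def \<rho>_def g_def T_def \<epsilon>_def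
          | use \<beta>0(1) in \<open>simp add: \<beta>_def; fail\<close>)+
    qed
    have unitU: "(\<Sum>i<n. (U $$ (i, k))\<^sup>2) = 1" if "k < r" for k
      using columns_orthonormal[OF lr that that] by (simp add: power2_eq_square)
    have U\<beta>: "\<bar>U $$ (i, k)\<bar> \<le> \<beta>" if "k < r" "i < n" for i k
      using \<beta>0(4)[OF that(2,1)] abs_le_1_of_unit[OF unitU[OF that(1)] that(2)] by (simp add: \<beta>_def)
    obtain E where E: "E \<in> sets P" "1 - C'' / real n ^ 17 \<le> measure P E"
      and good: "\<forall>\<omega>\<in>E. (\<forall>s\<ge>S. \<forall>i<n. \<forall>j<n. \<bar>mpow n (\<lambda>i j. noise_entry n H i j \<omega>) s i j\<bar> \<le> \<tau> ^ s) \<and>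
      (\<forall>s\<ge>1. \<forall>k<r. \<forall>l<r. \<bar>bil n (\<lambda>i j. noise_entry n H i j \<omega>) s (\<lambda>i. U $$ (i, k)) (\<lambda>i. U $$ (i, l))\<bar> \<le> \<epsilon> * \<tau> ^ (s - 1)) \<and>
      (\<forall>s\<ge>1. \<forall>k<r. \<bar>bil n (\<lambda>i j. noise_entry n H i j \<omega>) s (\<lambda>i. a $ i) (\<lambda>i. U $$ (i, k))\<bar> \<le> \<epsilon> * \<tau> ^ (s - 1)) \<and>
      (\<forall>s\<ge>1. \<forall>k<r. \<bar>bil n (\<lambda>i j. noise_entry n H i j \<omega>) s (\<lambda>i. U $$ (i, k)) (\<lambda>i. a $ i)\<bar> \<le> \<epsilon> * \<tau> ^ (s - 1))"
      apply (rule bexE[OF noise_event[OF rR, of "\<lambda>k i. U $$ (i, k)" "\<lambda>i. a $ i"]])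
      subgoal by (erule unitU)
      subgoal by (rule U\<beta>)
      subgoal by (rule l2_norm_eq_1[OF a])
      subgoal unfolding C''_def[symmetric] by (erule conjE) (rule that; assumption)
      done
    define \<eta> where "\<eta> = 8 * real r * K1 * \<epsilon>"
    define Mx where "Mx = Max (insert 0 ((\<lambda>k. \<bar>a \<bullet> col U k\<bar> / \<bar>lam l - lam k\<bar>) ` ({..<r} - {l})))"
    have C4: "4 \<le> C" using C C1 by linarith
    have rK: "real r * K1 \<le> real R * K1" using rR K1 by (intro mult_right_mono) auto
    have rK1: "1 \<le> real r * K1" using r K1 by (auto intro: mult_ge1_I)
    have m\<tau>: "C * \<tau> \<le> lam_min r lam" using mC by (simp add: \<tau>_def x_def)
    have \<tau>m: "4 * \<tau> \<le> lam_min r lam" using mult_right_mono[OF C4 less_imp_le[OF \<tau>_pos]] m\<tau> by linarith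
    have \<eta>0: "0 < \<eta>" unfolding \<eta>_def using r K1 \<epsilon>_pos by simp
    \<comment> \<open>No enlargement of C is used here: \<eta> has no factor \<surd>n, so it is
      negligible against \<tau> once n >= N.\<close>
    have \<eta>m: "16 * (1 + real R * K1) * \<eta> \<le> lam_min r lam"
    proof -
      have "16 * (1 + real R * K1) * \<eta> \<le> 16 * (1 + real R * K1) * (8 * real R * K1 * T * (\<sigma> * (x ^ 3 * sqrt x)))"
        unfolding \<eta>_def \<epsilon>_def using rR K1 T0 \<sigma> x0
        by (intro mult_left_mono) (auto simp: mult.assoc intro!: mult_mono mult_nonneg_nonneg)
      also have "\<dots> = (16 * (1 + real R * K1) * (8 * real R * K1 * T) * x ^ 2) * (\<sigma> * (x * sqrt x))"
        by (simp add: power2_eq_square power3_eq_cube)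
      also have "\<dots> \<le> sqrt (real n) * (\<sigma> * (x * sqrt x))"
        using nbig \<sigma> x0 by (intro mult_right_mono) auto
      also have "\<dots> = \<sigma> * sqrt (real n * x ^ 3)" by (simp add: sqrt_n_x3)
      also have "\<dots> \<le> 4 * \<tau>" using \<tau>_pos by (simp add: \<tau>_def)
      finally show ?thesis using \<tau>m by linarith
    qed
    have RK0: "0 \<le> real R * K1" using K1 by simp
    have \<eta>m4: "4 * \<eta> \<le> lam_min r lam"
    proof -
      have "4 * \<eta> \<le> 16 * (1 + real R * K1) * \<eta>" using \<eta>0 RK0 by (intro mult_right_mono) auto
      thus ?thesis using \<eta>m by linarith
    qed
    have \<kappa>1: "1 \<le> cond_num r lam"
    proof -
      have "1 * lam_min r lam \<le> cond_num r lam * lam_min r lam"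
        using order_trans[OF lam_min_le(1)[OF lr l] lam_min_le(2)[OF lr l]] by (simp only: mult_1_left)
      thus ?thesis using m by (simp only: mult_le_cancel_right_pos)
    qed
    have gapE: "C * (real r * E1) \<le> \<bar>lam i - lam j\<bar>" if "i < r" "j < r" "i \<noteq> j" for i j
    proof -
      have "C * (real r * E1) \<le> C * cond_num r lam ^ 3 * real r ^ 2 * E1"
      proof -
        have "1 * real r \<le> cond_num r lam ^ 3 * real r ^ 2"
          using \<kappa>1 r by (intro mult_mono self_le_power one_le_power) auto
        hence "C * (1 * real r) * E1 \<le> C * (cond_num r lam ^ 3 * real r ^ 2) * E1"
          using C4 E10 by (intro mult_right_mono mult_left_mono) auto
        thus ?thesis by (simp add: mult.assoc)
      qed
      also have "\<dots> \<le> C * cond_num r lam ^ 3 * real r ^ 2 *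
          max (incoherence n r U * L * ln (real n) ^ 5 / real n) (\<sigma> * ln (real n) powr (7 / 2))"
        using C4 \<kappa>1 ln_powers(1)[OF x0, of \<sigma>] \<sigma> by (intro mult_left_mono) (auto simp: E1_def x_def)
      also have "\<dots> \<le> \<bar>lam i - lam j\<bar>" by (rule min_eigengap_le[OF gap that])
      finally show ?thesis .
    qed
    have C32: "32 * K1 * T * (1 + real R * K1) \<le> C" using C unfolding C\<^sub>1_def by linarith
    have \<eta>gap: "4 * (1 + real R * K1) * \<eta> \<le> \<bar>lam i - lam j\<bar>" if "i < r" "j < r" "i \<noteq> j" for i j
    proof -
      have "4 * (1 + real R * K1) * \<eta> = (32 * K1 * T * (1 + real R * K1)) * (real r * E1)"
        by (simp add: \<eta>_def \<epsilon>E)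
      also have "\<dots> \<le> C * (real r * E1)" using C32 E10 by (intro mult_right_mono) auto
      finally show ?thesis using gapE[OF that] by linarith
    qed
    have gap4: "4 * \<eta> \<le> \<bar>lam i - lam j\<bar>" if "i < r" "j < r" "i \<noteq> j" for i j
    proof -
      have "4 * \<eta> \<le> 4 * (1 + real R * K1) * \<eta>" using \<eta>0 RK0 by (intro mult_right_mono) auto
      thus ?thesis using \<eta>gap[OF that] by linarith
    qed
    have Mx: "\<bar>a \<bullet> col U k\<bar> / \<bar>lam l - lam k\<bar> \<le> Mx" if "k < r" "k \<noteq> l" for k
      unfolding Mx_def using that by (intro Max_ge) auto
    have Mx0: "0 \<le> Mx" unfolding Mx_def by (intro Max_ge) auto
    show ?thesis
    proof (rule bexI[OF _ E(1)], rule conjI[OF E(2)], intro ballI allI impI)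
      fix \<omega> z u w
      assume \<omega>: "\<omega> \<in> E"
        and lead: "leading_eigenvalues (map_mat complex_of_real (low_rank_mat r U lam + H \<omega>)) r z"
        and match: "matched_eigenvalues r lam z"
        and u: "eigenvector (map_mat complex_of_real (low_rank_mat r U lam + H \<omega>)) u (z l)"
        and w: "eigenvector (transpose_mat (map_mat complex_of_real (low_rank_mat r U lam + H \<omega>))) w (z l)"
      have "\<omega> \<in> space P" using \<omega> E(1) sets.sets_into_space by blast
      hence Hc: "H \<omega> \<in> carrier_mat n n" using nc by (simp add: noise_conditions_def)
      have me: "mpow n (\<lambda>i j. noise_entry n H i j \<omega>) s i j = mpow n (entry (H \<omega>)) s i j" if "i < n" for s i j
        using that by (intro mpow_cong) (auto simp: noise_entry_def entry_def)
      have be: "bil n (\<lambda>i j. noise_entry n H i j \<omega>) s b c = bil n (entry (H \<omega>)) s b c" for s b c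
        unfolding bil_def by (intro sum.cong refl) (simp add: me)
      note G = bspec[OF good \<omega>, unfolded be]
      show "ereal (min_pm (u_hat a u w) (a \<bullet> col U l)) \<le> ereal C' * error_bound n r U lam \<sigma> a l"
      proof (rule le_error_bound[OF l less_imp_le[OF C'0]])
        show "0 < \<bar>lam l - lam k\<bar>" if "k < r" "k \<noteq> l" for k
          using gap4[OF l that(1)] that(2) \<eta>0 by linarith
      next
        fix q :: real
        assume q: "0 \<le> q" "\<And>k. k < r \<Longrightarrow> k \<noteq> l \<Longrightarrow> 1 / \<bar>lam l - lam k\<bar>\<^sup>2 \<le> q"
          and qmin: "\<forall>k. k < r \<longrightarrow> k \<noteq> l \<longrightarrow> q \<le> 1 / (Min ((\<lambda>k. \<bar>lam l - lam k\<bar>) ` ({..<r} - {l})))\<^sup>2"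
          and qe: "{..<r} - {l} = {} \<Longrightarrow> q = 0"
        \<comment> \<open>\<open>q\<close> is at most 1 / \<delta>^2 for the gap \<delta> of l, and
          \<delta> >= 4 (1 + R K1) \<eta>. This keeps the relative error below the 1/2 demanded by
          \<open>estimator_error\<close>.\<close>
        have \<eta>q: "16 * (1 + real R * K1)\<^sup>2 * (\<eta>\<^sup>2 * q) \<le> 1"
        proof (cases "{..<r} - {l} = {}")
          case False
          define \<delta> where "\<delta> = Min ((\<lambda>k. \<bar>lam l - lam k\<bar>) ` ({..<r} - {l}))"
          have "\<delta> \<in> (\<lambda>k. \<bar>lam l - lam k\<bar>) ` ({..<r} - {l})" unfolding \<delta>_def using False by (intro Min_in) auto
          then obtain k where k: "k < r" "k \<noteq> l" "\<delta> = \<bar>lam l - lam k\<bar>" by auto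
          have \<delta>: "4 * (1 + real R * K1) * \<eta> \<le> \<delta>" using \<eta>gap[OF l k(1)] k by simp
          have \<delta>0: "0 < \<delta>" using gap4[OF l k(1)] k \<eta>0 by linarith
          have "(4 * (1 + real R * K1) * \<eta>)\<^sup>2 \<le> \<delta>\<^sup>2" using \<delta> RK0 \<eta>0 by (intro power_mono) auto
          hence "(4 * (1 + real R * K1) * \<eta>)\<^sup>2 * q \<le> \<delta>\<^sup>2 * (1 / \<delta>\<^sup>2)"
            using qmin k(1,2) q(1) unfolding \<delta>_def[symmetric] by (intro mult_mono) auto
          also have "\<delta>\<^sup>2 * (1 / \<delta>\<^sup>2) = 1" using \<delta>0 by simp
          also have "(4 * (1 + real R * K1) * \<eta>)\<^sup>2 * q = 4\<^sup>2 * (1 + real R * K1)\<^sup>2 * (\<eta>\<^sup>2 * q)"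
            by (simp only: power_mult_distrib mult.assoc)
          finally show ?thesis by simp
        qed (use qe in simp)
        have q4: "real R * K1 * (\<eta>\<^sup>2 * q) \<le> 1 / 16"
        proof -
          have "real R * K1 \<le> (1 + real R * K1)\<^sup>2" 
          proof -
            have "y \<le> (1 + y)\<^sup>2" if "0 \<le> y" for y :: real
              using that zero_le_square[of y] unfolding power2_eq_square distrib_left distrib_right by linarith
            thus ?thesis using RK0 by blast
          qed
          hence "real R * K1 * (\<eta>\<^sup>2 * q) \<le> (1 + real R * K1)\<^sup>2 * (\<eta>\<^sup>2 * q)" using q(1) by (intro mult_right_mono) auto
          thus ?thesis using \<eta>q by linarith
        qed
        have m4: "real R * K1 * (4 * \<eta> / lam_min r lam) \<le> 1 / 4"
        proof -
          have "16 * (real R * K1 * \<eta>) \<le> lam_min r lam" using \<eta>m \<eta>0 by (simp add: algebra_simps)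
          thus ?thesis using m by (simp add: field_simps)
        qed
        have "min_pm (u_hat a u w) (a \<bullet> col U l)
          \<le> 6 * (real r * K1 * \<eta> * (1 / lam_min r lam + Mx)) + \<bar>a \<bullet> col U l\<bar> * (real r * K1 * (\<eta>\<^sup>2 * q))"
        proof (rule estimator_error[OF lr Hc \<tau>_pos \<tau>m order_trans[OF \<kappa> K1(2)] \<epsilon>_pos \<eta>_def \<eta>m4 gap4 _ _ l a _ _ lead match u w _ _ Mx Mx0])
          show "\<bar>mpow n (entry (H \<omega>)) s i j\<bar> \<le> \<tau> ^ s" if "S \<le> s" "i < n" "j < n" for s i j
            using G me[OF that(2)] that by metis
          show "(\<eta> / \<bar>lam l - lam k\<bar>)\<^sup>2 \<le> \<eta>\<^sup>2 * q" if "k < r" "k \<noteq> l" for k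
            using mult_left_mono[OF q(2)[OF that], of "\<eta>\<^sup>2"] by (simp add: power_divide)
          have "real r * K1 * (\<eta>\<^sup>2 * q + 4 * \<eta> / lam_min r lam) \<le> real R * K1 * (\<eta>\<^sup>2 * q + 4 * \<eta> / lam_min r lam)"
            by (rule mult_right_mono[OF rK]) (use q(1) \<eta>0 m in simp)
          also have "\<dots> \<le> 1 / 16 + 1 / 4" unfolding distrib_left by (rule add_mono[OF q4 m4])
          also have "1 / 16 + 1 / 4 \<le> (1 / 2 :: real)" by simp
          finally show "real r * K1 * (\<eta>\<^sup>2 * q + 4 * \<eta> / lam_min r lam) \<le> 1 / 2" .
        qed (use G q(1) in auto)
        also have "\<dots> = 48 * (real r)\<^sup>2 * K1\<^sup>2 * T * ((1 / lam_min r lam + Mx) * E1)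
            + 64 * real r ^ 3 * K1 ^ 3 * T\<^sup>2 * (\<bar>a \<bullet> col U l\<bar> * E1\<^sup>2 * q)"
          by (simp add: \<eta>_def \<epsilon>E power2_eq_square power3_eq_cube)
        also have "\<dots> \<le> C' * ((1 / lam_min r lam + Mx) * E1) + C' * (\<bar>a \<bullet> col U l\<bar> * E1\<^sup>2 * q)"
        proof (intro add_mono mult_right_mono)
          have "48 * (real r)\<^sup>2 * K1\<^sup>2 * T \<le> 48 * (real R)\<^sup>2 * K1\<^sup>2 * T"
            using rR T0 by (intro mult_right_mono mult_left_mono power_mono) auto
          moreover have "0 \<le> 64 * (real R) ^ 3 * K1 ^ 3 * T\<^sup>2" using K1 by simp
          ultimately show "48 * (real r)\<^sup>2 * K1\<^sup>2 * T \<le> C'" unfolding C'_def by linarith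
          have "64 * real r ^ 3 * K1 ^ 3 * T\<^sup>2 \<le> 64 * real R ^ 3 * K1 ^ 3 * T\<^sup>2"
            using rR K1 by (intro mult_right_mono mult_left_mono power_mono) auto
          moreover have "0 \<le> 48 * (real R)\<^sup>2 * K1\<^sup>2 * T" using T0 by simp
          ultimately show "64 * real r ^ 3 * K1 ^ 3 * T\<^sup>2 \<le> C'" unfolding C'_def by linarith
        qed (use m Mx0 E10 q(1) in auto)
        finally show "min_pm (u_hat a u w) (a \<bullet> col U l) \<le> C' * ((1 / lam_min r lam
              + Max (insert 0 ((\<lambda>k. \<bar>a \<bullet> col U k\<bar> / \<bar>lam l - lam k\<bar>) ` ({..<r} - {l}))))
            * sqrt (\<sigma>\<^sup>2 * ln (real n) ^ 7)) + C' * (\<bar>a \<bullet> col U l\<bar> * (\<sigma>\<^sup>2 * ln (real n) ^ 7) * q)"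
          using ln_powers(2,3)[OF x0 less_imp_le[OF \<sigma>(1)]] by (simp add: Mx_def E1_def x_def)
      qed
    qed
  qed
  show ?thesis
    unfolding Let_def
    apply (rule exI[of _ C\<^sub>1], rule conjI)
    subgoal using C1 by linarith
    apply (rule allI, rule impI, rule exI[of _ C'], rule conjI[OF C'0], rule exI[of _ C''], rule conjI[OF C''0], rule exI[of _ N])
    apply (intro allI impI)
    subgoal premises prems for C n r U lam P H \<sigma>_min \<sigma> L a l
      using core[OF prems(1-4,7-16)] by blast
    done
qed

end
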